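(* Set $\mathcal{A}= \mathbb{C}\langle X_1,\ldots,X_k,Y_1,\ldots,Y_{\ell}\rangle$, $\mathcal{A}_1=\mathbb{C}\langle X_1,\ldots,X_k\rangle$ and $\mathcal{A}_2=\mathbb{C}\langle Y_1,\ldots,Y_{\ell}\rangle$. Let $(\mathbf{A}_N)_{N\geq 1}$ and $(\mathbf{B}_N)_{N\geq 1}$ be two deterministic sequences of $k$-tuples and $\ell$-tuples of $N\times N$ complex matrices, and $(v_N)_{N\geq 1}$ a sequence of unit vectors of $\mathbb{C}^N$. Assume there are maps $\tau:\mathcal{A}_1\cup\mathcal{A}_2\to\mathbb{C}$ and $\varphi:\mathcal{A}_1\to\mathbb{C}$ such that for all $P\in \mathcal{A}_1$, $\tau_{\mathbf{A}_N}(P)=\tau(P)+o(1)$ and $\tau_{\mathbf{A}_N}^{v_N}(P)=\varphi(P)+o(1)$, and for all $P\in \mathcal{A}_2$, $\tau_{\mathbf{B}_N}(P)=\tau(P)+o(1)$. Let $(U_N)_{N\geq 1}$ be a sequence of Haar distributed unitary random matrices of size $N$. Then $\tau$ and $\varphi$ extend to linear functionals on $\mathcal{A}$ such that, for all $P\in\mathcal{A}$, $\mathbb{E}[ \tau_{\mathbf{A}_N, U_N\mathbf{B}_NU_N^*}(P)]=\tau(P)+o(1)$ and $\mathbb{E}[ \tau^{v_N}_{\mathbf{A}_N, U_N\mathbf{B}_NU_N^*}(P)]=\varphi(P)+o(1)$; moreover $\mathcal{A}_1$ and $\mathcal{A}_2$ are conditionally free with respect to $(\tau,\varphi)$, and $\varphi|_{\mathcal{A}_2}=\tau|_{\mathcal{A}_2}$.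 Furthermore, if all matrices of $\mathbf{A}_N$ and $\mathbf{B}_N$ are self-adjoint, then for all $P\in \mathcal{A}$, $\tau_{\mathbf{A}_N, U_N\mathbf{B}_NU_N^*}(P)=\tau(P)+o(1)$ almost surely and $\tau_{\mathbf{A}_N, U_N\mathbf{B}_NU_N^*}^{v_N}(P)=\varphi(P)+o(1)$ almost surely.
   Context: $\operatorname{tr}_N=\frac1N\operatorname{Tr}$; $\tau_{\mathbf{A}_N}(P)=\operatorname{tr}_N(P(\mathbf{A}_N))$ and $\tau^{v_N}_{\mathbf{A}_N}(P)=\langle P(\mathbf{A}_N)v_N,v_N\rangle$; joint versions are $\tau_{\mathbf{A}_N,U_N\mathbf{B}_NU_N^*}(P)=\operatorname{tr}_N(P(\mathbf{A}_N,U_N\mathbf{B}_NU_N^* ))$ and $\tau^{v_N}_{\mathbf{A}_N,U_N\mathbf{B}_NU_N^*}(P)=\langle P(\mathbf{A}_N,U_N\mathbf{B}_NU_N^* )v_N,v_N\rangle$, where $U_N\mathbf{B}_NU_N^*=(U_NB_N^{(1)}U_N^*,\dots,U_NB_N^{(\ell)}U_N^* )$. Unital subalgebras $\mathcal{A}_1,\mathcal{A}_2$ are conditionally free w.r.t. $(\tau,\varphi)$ if whenever $n>1$, $a_j\in\mathcal{A}_{i_j}$ with consecutive indices different and $\tau(a_j)=0$ for all $j$, one has $\tau(a_1\cdots a_n)=0$ and $\varphi(a_1\cdots a_n)=\varphi(a_1)\cdots\varphi(a_n)$. *)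

theory Defs
  imports "HOL-Probability.Probability" "HOL-Analysis.Function_Topology"
begin

text \<open>N x N complex matrices are functions nat => nat => complex, only entries with
  indices below N are relevant.  Vectors of C^N are functions nat => complex.\<close>

type_synonym cmat = "nat \<Rightarrow> nat \<Rightarrow> complex"
type_synonym cvec = "nat \<Rightarrow> complex"

definition mmult :: "nat \<Rightarrow> cmat \<Rightarrow> cmat \<Rightarrow> cmat" where
  "mmult N A B = (\<lambda>i j. if i < N \<and> j < N then (\<Sum>k<N. A i k * B k j) else 0)"

definition idm :: "nat \<Rightarrow> cmat" where
  "idm N = (\<lambda>i j. if i = j \<and> i < N then 1 else 0)"

definition adj :: "cmat \<Rightarrow> cmat" where
  "adj A = (\<lambda>i j. cnj (A j i))"

definition unitary_mat :: "nat \<Rightarrow> cmat \<Rightarrow> bool" where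
  "unitary_mat N U \<longleftrightarrow> (\<forall>i j. \<not> (i < N \<and> j < N) \<longrightarrow> U i j = 0) \<and> mmult N U (adj U) = idm N"

definition selfadj_mat :: "nat \<Rightarrow> cmat \<Rightarrow> bool" where
  "selfadj_mat N A \<longleftrightarrow> (\<forall>i<N. \<forall>j<N. A i j = cnj (A j i))"

definition unit_vec :: "nat \<Rightarrow> cvec \<Rightarrow> bool" where
  "unit_vec N v \<longleftrightarrow> (\<Sum>i<N. (cmod (v i))\<^sup>2) = 1"

definition ntr :: "nat \<Rightarrow> cmat \<Rightarrow> complex" where
  "ntr N M = (\<Sum>i<N. M i i) / of_nat N"

definition vstate :: "nat \<Rightarrow> cvec \<Rightarrow> cmat \<Rightarrow> complex" where
  "vstate N v M = (\<Sum>i<N. (\<Sum>j<N. M i j * v j) * cnj (v i))"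

text \<open>Haar distributed unitary random matrix of size N on the probability space M:
  a random variable with values (almost surely) in U(N) whose law is invariant under
  left multiplication by every fixed unitary (this characterizes Haar measure).\<close>
definition haar_unitary :: "'w measure \<Rightarrow> nat \<Rightarrow> ('w \<Rightarrow> cmat) \<Rightarrow> bool" where
  "haar_unitary M N U \<longleftrightarrow>
     U \<in> M \<rightarrow>\<^sub>M borel \<and> (AE \<omega> in M. unitary_mat N (U \<omega>)) \<and>
     (\<forall>V. unitary_mat N V \<longrightarrow> distr M borel (\<lambda>\<omega>. mmult N V (U \<omega>)) = distr M borel U)"

text \<open>Noncommutative polynomials: variables Inl i = X_(i+1), Inr j = Y_(j+1);
  a polynomial is a finitely supported function from words (monomials) to C.\<close>
type_synonym var = "nat + nat"
type_synonym ncpoly = "var list \<Rightarrow> complex"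

definition ncpolys :: "var set \<Rightarrow> ncpoly set" where
  "ncpolys V = {p. finite {w. p w \<noteq> 0} \<and> (\<forall>w. p w \<noteq> 0 \<longrightarrow> set w \<subseteq> V)}"

definition Xvars :: "nat \<Rightarrow> var set" where "Xvars k = Inl ` {..<k}"
definition Yvars :: "nat \<Rightarrow> var set" where "Yvars l = Inr ` {..<l}"

definition ncmult :: "ncpoly \<Rightarrow> ncpoly \<Rightarrow> ncpoly" where
  "ncmult p q = (\<lambda>w. \<Sum>i\<le>length w. p (take i w) * q (drop i w))"

definition ncone :: ncpoly where "ncone = (\<lambda>w. if w = [] then 1 else 0)"

definition ncprod :: "ncpoly list \<Rightarrow> ncpoly" where
  "ncprod ps = foldr ncmult ps ncone"

definition mono_eval :: "nat \<Rightarrow> (var \<Rightarrow> cmat) \<Rightarrow> var list \<Rightarrow> cmat" where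
  "mono_eval N X w = foldr (\<lambda>x M. mmult N (X x) M) w (idm N)"

definition poly_eval :: "nat \<Rightarrow> (var \<Rightarrow> cmat) \<Rightarrow> ncpoly \<Rightarrow> cmat" where
  "poly_eval N X p = (\<lambda>i j. \<Sum>w\<in>{w. p w \<noteq> 0}. p w * mono_eval N X w i j)"

definition lin_on :: "ncpoly set \<Rightarrow> (ncpoly \<Rightarrow> complex) \<Rightarrow> bool" where
  "lin_on S f \<longleftrightarrow> (\<forall>p\<in>S. \<forall>q\<in>S. f (\<lambda>w. p w + q w) = f p + f q) \<and> (\<forall>c. \<forall>p\<in>S. f (\<lambda>w. c * p w) = c * f p)"

definition cond_free :: "ncpoly set \<Rightarrow> ncpoly set \<Rightarrow> (ncpoly \<Rightarrow> complex) \<Rightarrow> (ncpoly \<Rightarrow> complex) \<Rightarrow> bool" where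
  "cond_free A1 A2 \<tau> \<phi> \<longleftrightarrow>
    (\<forall>as :: (ncpoly \<times> bool) list. length as > 1 \<longrightarrow>
       (\<forall>i. Suc i < length as \<longrightarrow> snd (as ! i) \<noteq> snd (as ! Suc i)) \<longrightarrow>
       (\<forall>(a, s)\<in>set as. a \<in> (if s then A1 else A2) \<and> \<tau> a = 0) \<longrightarrow>
       \<tau> (ncprod (map fst as)) = 0 \<and>
       \<phi> (ncprod (map fst as)) = (\<Prod>a\<leftarrow>map fst as. \<phi> a))"

end

theory Submission
  imports Defs "HOL-Library.Landau_Symbols"
begin

text \<open>Left invariance of Haar measure under \<open>U \<mapsto> V U\<close>, differentiated at \<open>V = I\<close>, gives a Schwinger--Dyson equation: the
  expectation of a product of normalized traces of words in \<open>A\<close> and \<open>U B U\<^sup>*\<close> is a sum of expectations in which one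
  word is split into two shorter ones, plus \<open>N\<^sup>-\<^sup>2\<close> times terms in which two words are merged. Only traces of words in
  \<open>A\<close> alone or in \<open>B\<close> alone remain at the end, so no bound on operator norms is needed. The vector state is
  the trace against the additional letter \<open>N v v\<^sup>*\<close>, which may occur at most once per word.

  The equation shows that all these moments are bounded, that products of \<open>s\<close> centered traces have expectation
  \<open>O(N\<^sup>-\<^sup>s\<^sup>/\<^sup>2)\<close>, and that expectations converge to a functional satisfying the equation without the merging terms.
  For that functional, alternating products of centered elements vanish even against one extra factor in \<open>A\<close> and
  the marked letter, which is freeness and conditional freeness at once. For self-adjoint matrices the complex
  conjugate of a trace is the trace of the reversed word, so fourth centered moments are \<open>O(N\<^sup>-\<^sup>2)\<close>,
  hence summable, and convergence is almost sure.\<close>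

subsection \<open>The liberation derivation on words\<close>

text \<open>\<open>lib_deriv D f w\<close> is the value of the bilinear form \<open>f\<close> on \<open>\<partial>w\<close>, where \<open>\<partial>\<close> is the derivation with
  \<open>\<partial>y = 1 \<otimes> y - y \<otimes> 1\<close> on the letters \<open>y\<close> in \<open>D\<close> and \<open>\<partial>x = 0\<close> on all others.\<close>

fun lib_deriv :: "('a \<Rightarrow> bool) \<Rightarrow> ('a list \<Rightarrow> 'a list \<Rightarrow> 'b::ab_group_add) \<Rightarrow> 'a list \<Rightarrow> 'b" where
  "lib_deriv D f [] = 0"
| "lib_deriv D f (x # w) = (if D x then f [] (x # w) - f [x] w else 0) + lib_deriv D (\<lambda>p. f (x # p)) w"

lemma lib_deriv_append:
  "lib_deriv D f (u @ w) = lib_deriv D (\<lambda>p s. f p (s @ w)) u + lib_deriv D (\<lambda>p. f (u @ p)) w"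
  by (induction u arbitrary: f) (simp_all add: add.assoc)

lemma lib_deriv_all_moving: "\<forall>x\<in>set w. D x \<Longrightarrow> lib_deriv D f w = f [] w - f w []"
  by (induction w arbitrary: f) simp_all

lemma lib_deriv_none_moving: "\<forall>x\<in>set w. \<not> D x \<Longrightarrow> lib_deriv D f w = 0"
  by (induction w arbitrary: f) simp_all

lemma lib_deriv_cong:
  "(\<And>p s. p @ s = w \<Longrightarrow> f p s = g p s) \<Longrightarrow> lib_deriv D f w = lib_deriv D g w"
proof (induction w arbitrary: f g)
  case (Cons x w)
  have "lib_deriv D (\<lambda>p. f (x # p)) w = lib_deriv D (\<lambda>p. g (x # p)) w"
    by (rule Cons.IH) (simp add: Cons.prems)
  then show ?case
    using Cons.prems[of "[]" "x # w"] Cons.prems[of "[x]" w] by simp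
qed simp

lemma lib_deriv_eq_0:
  "(\<And>p d s. w = p @ d # s \<Longrightarrow> D d \<Longrightarrow> f p (d # s) = f (p @ [d]) s) \<Longrightarrow> lib_deriv D f w = 0"
proof (induction w arbitrary: f)
  case (Cons x w)
  have "lib_deriv D (\<lambda>p. f (x # p)) w = 0"
    by (rule Cons.IH) (simp add: Cons.prems)
  then show ?case
    using Cons.prems[of "[]" x w] by simp
qed simp

lemma lib_deriv_zero [simp]: "lib_deriv D (\<lambda>p s. 0) w = 0"
  by (rule lib_deriv_eq_0) simp

lemma lib_deriv_diff:
  "lib_deriv D (\<lambda>p s. f p s - g p s) w = lib_deriv D f w - lib_deriv D g w"
  by (induction w arbitrary: f g) (simp_all add: algebra_simps)

lemma lib_deriv_sum:
  "lib_deriv D (\<lambda>p s. \<Sum>i\<in>I. f i p s) w = (\<Sum>i\<in>I. lib_deriv D (f i) w)"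
  by (induction w arbitrary: f) (simp_all add: sum.distrib sum_subtractf)

lemma lib_deriv_cmult:
  fixes c :: "'b::comm_ring"
  shows "lib_deriv D (\<lambda>p s. c * f p s) w = c * lib_deriv D f w"
  by (induction w arbitrary: f) (simp_all add: algebra_simps)

lemma lib_deriv_multc:
  fixes c :: "'b::comm_ring"
  shows "lib_deriv D (\<lambda>p s. f p s * c) w = lib_deriv D f w * c"
  using lib_deriv_cmult[of D c f w] by (simp add: mult.commute)

lemma lib_deriv_closed:
  fixes f :: "'a list \<Rightarrow> 'a list \<Rightarrow> 'i \<Rightarrow> 'b::ab_group_add"
  assumes zero: "C (\<lambda>_. 0)" and diff: "\<And>g h. C g \<Longrightarrow> C h \<Longrightarrow> C (\<lambda>n. g n - h n)"
    and "\<And>p s. p @ s = w \<Longrightarrow> C (f p s)"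
  shows "C (\<lambda>n. lib_deriv D (\<lambda>p s. f p s n) w)"
  using assms(3)
proof (induction w arbitrary: f)
  case (Cons x w)
  have add: "C (\<lambda>n. g n + h n)" if "C g" "C h" for g h
    using diff[OF \<open>C g\<close> diff[OF zero \<open>C h\<close>]] by simp
  have "C (\<lambda>n. f [] (x # w) n - f [x] w n)"
    by (intro diff Cons.prems) simp_all
  moreover have "C (\<lambda>n. lib_deriv D (\<lambda>p s. f (x # p) s n) w)"
    by (rule Cons.IH) (simp add: Cons.prems)
  ultimately show ?case
    using add by (cases "D x") simp_all
qed (simp add: zero)

lemma lib_deriv_tendsto:
  fixes L :: "'a list \<Rightarrow> 'a list \<Rightarrow> 'b::real_normed_vector"
  assumes "\<And>p s. p @ s = w \<Longrightarrow> (f p s \<longlongrightarrow> L p s) F"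
  shows "((\<lambda>n. lib_deriv D (\<lambda>p s. f p s n) w) \<longlongrightarrow> lib_deriv D L w) F"
  using assms
proof (induction w arbitrary: f L)
  case (Cons x w)
  have "((\<lambda>n. lib_deriv D (\<lambda>p s. f (x # p) s n) w) \<longlongrightarrow> lib_deriv D (\<lambda>p. L (x # p)) w) F"
    by (rule Cons.IH) (simp add: Cons.prems)
  moreover have "((\<lambda>n. f [] (x # w) n - f [x] w n) \<longlongrightarrow> L [] (x # w) - L [x] w) F"
    by (intro tendsto_diff Cons.prems) simp_all
  ultimately show ?case
    by (cases "D x") (auto intro: tendsto_add)
qed simp

lemma lib_deriv_integrable:
  fixes f :: "'a list \<Rightarrow> 'a list \<Rightarrow> 'w \<Rightarrow> 'b::{banach, second_countable_topology}"
  assumes "\<And>p s. integrable M (f p s)"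
  shows "integrable M (\<lambda>\<omega>. lib_deriv D (\<lambda>p s. f p s \<omega>) w)"
  by (rule lib_deriv_closed) (use assms in auto)

lemma lib_deriv_integral:
  fixes f :: "'a list \<Rightarrow> 'a list \<Rightarrow> 'w \<Rightarrow> 'b::{banach, second_countable_topology}"
  assumes "\<And>p s. integrable M (f p s)"
  shows "(\<integral>\<omega>. lib_deriv D (\<lambda>p s. f p s \<omega>) w \<partial>M) = lib_deriv D (\<lambda>p s. \<integral>\<omega>. f p s \<omega> \<partial>M) w"
  using assms
proof (induction w arbitrary: f)
  case (Cons x w)
  then show ?case
    using lib_deriv_integrable[of M "\<lambda>p. f (x # p)" D w] by simp
qed simp

definition inner_deriv :: "('a \<Rightarrow> bool) \<Rightarrow> ('a list \<Rightarrow> 'a list \<Rightarrow> 'b::ab_group_add) \<Rightarrow> 'a list \<Rightarrow> 'b" where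
  "inner_deriv D f w = f [] w - lib_deriv D f w"

text \<open>When \<open>w\<close> begins with a letter in \<open>D\<close> and ends with one outside \<open>D\<close>, subtracting \<open>\<partial>w\<close> from \<open>1 \<otimes> w\<close> leaves only
  tensors of two nonempty words, which makes an induction on the length of \<open>w\<close> possible.\<close>

lemma inner_deriv_closed:
  fixes f :: "'a list \<Rightarrow> 'a list \<Rightarrow> 'i \<Rightarrow> 'b::ab_group_add"
  assumes w: "w \<noteq> []" "D (hd w)" "\<not> D (last w)"
    and zero: "C (\<lambda>_. 0)" and diff: "\<And>g h. C g \<Longrightarrow> C h \<Longrightarrow> C (\<lambda>n. g n - h n)"
    and f: "\<And>p s. p \<noteq> [] \<Longrightarrow> s \<noteq> [] \<Longrightarrow> p @ s = w \<Longrightarrow> C (f p s)"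
  shows "C (\<lambda>n. inner_deriv D (\<lambda>p s. f p s n) w)"
proof -
  obtain y r where r: "w = y # r" using w(1) by (cases w) auto
  moreover from w(2,3) r have "r \<noteq> []" by auto
  ultimately obtain z x where w_eq: "w = y # z @ [x]"
    by (metis append_butlast_last_id)
  have "D y" "\<not> D x" using w w_eq by auto
  then have "inner_deriv D (\<lambda>p s. f p s n) w
      = f [y] (z @ [x]) n - lib_deriv D (\<lambda>p s. f (y # p) (s @ [x]) n) z" for n
    by (simp add: inner_deriv_def w_eq lib_deriv_append)
  moreover have "C (\<lambda>n. lib_deriv D (\<lambda>p s. f (y # p) (s @ [x]) n) z)"
    by (rule lib_deriv_closed[OF zero diff]) (auto simp: w_eq intro!: f)
  moreover have "C (f [y] (z @ [x]))"
    by (rule f) (simp_all add: w_eq)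
  ultimately show ?thesis
    using diff by simp
qed

lemma rotation_starting_in_ending_outside:
  assumes "\<exists>x\<in>set w. D x" "\<exists>x\<in>set w. \<not> D x"
  obtains n where "D (hd (rotate n w))" "\<not> D (last (rotate n w))"
proof -
  from assms(1) obtain u y v where w_eq: "w = u @ y # v" and "D y"
    by (meson split_list)
  have "\<exists>x\<in>set (v @ u). \<not> D x"
    using assms(2) w_eq \<open>D y\<close> by auto
  then obtain a x b where vu_eq: "v @ u = a @ x # b" and x: "\<not> D x" and "\<forall>z\<in>set b. D z"
    using split_list_last_prop[of "v @ u" "\<lambda>x. \<not> D x"] by auto
  then have b: "b = [] \<or> D (hd b)" by (cases b) auto
  have "rotate (length u) w = (y # a @ [x]) @ b"
    by (simp add: w_eq rotate_append vu_eq)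
  then have "rotate (length (y # a @ [x]) + length u) w = b @ y # a @ [x]"
    by (metis rotate_append rotate_rotate)
  then show thesis
    using x b \<open>D y\<close> by (intro that[of "length (y # a @ [x]) + length u"]) (auto simp: hd_append)
qed

subsection \<open>Matrices\<close>

definition supported :: "nat \<Rightarrow> cmat \<Rightarrow> bool" where
  "supported N A \<longleftrightarrow> (\<forall>i j. \<not> (i < N \<and> j < N) \<longrightarrow> A i j = 0)"

lemma supported_mmult [simp]: "supported N (mmult N A B)"
  by (auto simp: supported_def mmult_def)

lemma supported_idm [simp]: "supported N (idm N)"
  by (auto simp: supported_def idm_def)

lemma mmult_cong:
  "(\<And>i j. i < N \<Longrightarrow> j < N \<Longrightarrow> A i j = A' i j) \<Longrightarrow> (\<And>i j. i < N \<Longrightarrow> j < N \<Longrightarrow> B i j = B' i j) \<Longrightarrow>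
    mmult N A B = mmult N A' B'"
  by (auto simp: mmult_def fun_eq_iff)

lemma mmult_assoc: "mmult N (mmult N A B) C = mmult N A (mmult N B C)"
proof (intro ext)
  fix i j
  have "(\<Sum>k<N. (\<Sum>m<N. A i m * B m k) * C k j) = (\<Sum>m<N. A i m * (\<Sum>k<N. B m k * C k j))"
    unfolding sum_distrib_left sum_distrib_right by (subst sum.swap) (simp add: mult.assoc)
  then show "mmult N (mmult N A B) C i j = mmult N A (mmult N B C) i j"
    by (simp add: mmult_def)
qed

lemma mmult_idm_entry:
  assumes "i < N" "j < N"
  shows "mmult N (idm N) A i j = A i j" "mmult N A (idm N) i j = A i j"
proof -
  have "(\<Sum>k<N. idm N i k * A k j) = (\<Sum>k<N. if k = i then A k j else 0)"
    by (rule sum.cong) (auto simp: idm_def)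
  then show "mmult N (idm N) A i j = A i j"
    using assms by (simp add: mmult_def)
  have "(\<Sum>k<N. A i k * idm N k j) = (\<Sum>k<N. if k = j then A i k else 0)"
    by (rule sum.cong) (auto simp: idm_def)
  then show "mmult N A (idm N) i j = A i j"
    using assms by (simp add: mmult_def)
qed

lemma supported_eqI:
  assumes "supported N A" "supported N B" "\<And>i j. i < N \<Longrightarrow> j < N \<Longrightarrow> A i j = B i j"
  shows "A = B"
  using assms unfolding supported_def by (metis ext)

lemma mmult_idm_left [simp]: "supported N A \<Longrightarrow> mmult N (idm N) A = A"
  and mmult_idm_right [simp]: "supported N A \<Longrightarrow> mmult N A (idm N) = A"
  by (auto intro!: supported_eqI[of N] simp: mmult_idm_entry)

lemma mmult_idm_middle [simp]: "mmult N A (mmult N (idm N) B) = mmult N A B"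
  by (rule mmult_cong) (simp_all add: mmult_idm_entry)

lemma mmult_add_left: "mmult N (\<lambda>i j. A i j + B i j) C = (\<lambda>i j. mmult N A C i j + mmult N B C i j)"
  by (simp add: mmult_def fun_eq_iff sum.distrib ring_distribs)

lemma mmult_add_right: "mmult N C (\<lambda>i j. A i j + B i j) = (\<lambda>i j. mmult N C A i j + mmult N C B i j)"
  by (simp add: mmult_def fun_eq_iff sum.distrib ring_distribs)

lemma mmult_diff_left: "mmult N (\<lambda>i j. A i j - B i j) C = (\<lambda>i j. mmult N A C i j - mmult N B C i j)"
  by (simp add: mmult_def fun_eq_iff sum_subtractf ring_distribs)

lemma mmult_diff_right: "mmult N C (\<lambda>i j. A i j - B i j) = (\<lambda>i j. mmult N C A i j - mmult N C B i j)"
  by (simp add: mmult_def fun_eq_iff sum_subtractf ring_distribs)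

lemma mmult_scale_left: "mmult N (\<lambda>i j. c * A i j) B = (\<lambda>i j. c * mmult N A B i j)"
  by (simp add: mmult_def fun_eq_iff sum_distrib_left mult_ac)

lemma mmult_scale_right: "mmult N A (\<lambda>i j. c * B i j) = (\<lambda>i j. c * mmult N A B i j)"
  by (simp add: mmult_def fun_eq_iff sum_distrib_left mult_ac)

lemma mmult_zero_left [simp]: "mmult N (\<lambda>i j. 0) A = (\<lambda>i j. 0)"
  by (simp add: mmult_def fun_eq_iff)

lemma adj_mmult: "adj (mmult N A B) = mmult N (adj B) (adj A)"
  by (auto simp: adj_def mmult_def fun_eq_iff mult.commute)

lemma adj_adj [simp]: "adj (adj A) = A"
  by (simp add: adj_def)

lemma adj_idm [simp]: "adj (idm N) = idm N"
  by (auto simp: adj_def idm_def fun_eq_iff)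

lemma mmult_adj_diag: "i < N \<Longrightarrow> mmult N A (adj A) i i = of_real (\<Sum>k<N. (cmod (A i k))\<^sup>2)"
  by (simp add: mmult_def adj_def complex_norm_square del: of_real_power)

lemma ntr_mmult: "ntr N (mmult N A B) = (\<Sum>i<N. \<Sum>k<N. A i k * B k i) / of_nat N"
  by (simp add: ntr_def mmult_def)

lemma ntr_mmult_commute: "ntr N (mmult N A B) = ntr N (mmult N B A)"
  unfolding ntr_mmult by (subst sum.swap) (simp add: mult.commute)

lemma ntr_adj: "ntr N (adj A) = cnj (ntr N A)"
  by (simp add: ntr_def adj_def)

lemma ntr_idm: "N \<ge> 1 \<Longrightarrow> ntr N (idm N) = 1"
  by (simp add: ntr_def idm_def)

lemma mono_eval_Nil [simp]: "mono_eval N Z [] = idm N"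
  by (simp add: mono_eval_def)

lemma mono_eval_Cons: "mono_eval N Z (x # w) = mmult N (Z x) (mono_eval N Z w)"
  by (simp add: mono_eval_def)

lemma supported_mono_eval [simp]: "supported N (mono_eval N Z w)"
  by (cases w) (simp_all add: mono_eval_Cons)

lemma mono_eval_append: "mono_eval N Z (u @ w) = mmult N (mono_eval N Z u) (mono_eval N Z w)"
  by (induction u) (simp_all add: mono_eval_Cons mmult_assoc)

lemma mono_eval_cong: "(\<And>x. x \<in> set w \<Longrightarrow> Z x = Z' x) \<Longrightarrow> mono_eval N Z w = mono_eval N Z' w"
  by (induction w) (simp_all add: mono_eval_Cons)

lemma ntr_mono_eval_rotate: "ntr N (mono_eval N Z (u @ w)) = ntr N (mono_eval N Z (w @ u))"
  by (simp add: mono_eval_append ntr_mmult_commute)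

text \<open>A one-sided inverse suffices: the defect \<open>I - U\<^sup>* U\<close> is a self-adjoint idempotent of trace zero.\<close>

lemma unitary_mat_left:
  assumes "unitary_mat N U"
  shows "mmult N (adj U) U = idm N"
proof -
  have supp: "supported N U" and right: "mmult N U (adj U) = idm N"
    using assms by (auto simp: unitary_mat_def supported_def)
  define defect where "defect = (\<lambda>i j. idm N i j - mmult N (adj U) U i j)"
  have "mmult N (mmult N (adj U) U) (mmult N (adj U) U) = mmult N (adj U) U"
    by (metis right mmult_assoc mmult_idm_left supp)
  then have idem: "mmult N defect defect = defect"
    unfolding defect_def mmult_diff_left mmult_diff_right by simp
  have self_adj: "adj defect = defect"
    by (auto simp: defect_def adj_def idm_def mmult_def fun_eq_iff mult.commute)
  have "(\<Sum>i<N. defect i i) = (\<Sum>i<N. idm N i i) - (\<Sum>i<N. mmult N (adj U) U i i)"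
    by (simp add: defect_def sum_subtractf)
  also have "(\<Sum>i<N. mmult N (adj U) U i i) = (\<Sum>i<N. mmult N U (adj U) i i)"
    unfolding mmult_def by simp (subst sum.swap, simp add: mult.commute)
  finally have trace: "(\<Sum>i<N. defect i i) = 0"
    by (simp add: right)
  have "(\<Sum>i<N. defect i i) = (\<Sum>i<N. mmult N defect (adj defect) i i)"
    by (simp add: self_adj idem)
  also have "\<dots> = of_real (\<Sum>i<N. \<Sum>k<N. (cmod (defect i k))\<^sup>2)"
    by (simp add: mmult_adj_diag)
  finally have "(\<Sum>i<N. \<Sum>k<N. (cmod (defect i k))\<^sup>2) = 0"
    unfolding trace by (metis of_real_eq_0_iff)
  then have "\<forall>i<N. \<forall>k<N. idm N i k - mmult N (adj U) U i k = 0"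
    by (simp add: sum_nonneg_eq_0_iff sum_nonneg defect_def)
  then show ?thesis
    by (intro supported_eqI[of N]) simp_all
qed

lemma unitary_mat_entry_le:
  assumes "unitary_mat N U"
  shows "cmod (U i j) \<le> 1"
proof (cases "i < N \<and> j < N")
  case True
  then have "complex_of_real (\<Sum>k<N. (cmod (U i k))\<^sup>2) = mmult N U (adj U) i i"
    by (simp only: mmult_adj_diag)
  also have "\<dots> = 1"
    using assms True by (simp add: unitary_mat_def idm_def)
  finally have "complex_of_real (\<Sum>k<N. (cmod (U i k))\<^sup>2) = 1" .
  then have "(\<Sum>k<N. (cmod (U i k))\<^sup>2) = 1"
    by (simp only: of_real_eq_1_iff)
  moreover have "(cmod (U i j))\<^sup>2 \<le> (\<Sum>k<N. (cmod (U i k))\<^sup>2)"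
    using True by (intro member_le_sum) auto
  ultimately show ?thesis
    by (simp add: power_le_one_iff)
next
  case False
  then show ?thesis using assms by (auto simp: unitary_mat_def)
qed

lemma mono_eval_conj:
  assumes "unitary_mat N u"
  shows "mono_eval N (\<lambda>x. mmult N (mmult N u (Z x)) (adj u)) w = mmult N (mmult N u (mono_eval N Z w)) (adj u)"
proof (induction w)
  case Nil
  have "supported N u" using assms by (auto simp: unitary_mat_def supported_def)
  then show ?case using assms by (simp add: unitary_mat_def)
next
  case (Cons x w)
  have "mmult N (adj u) (mmult N u F) = mmult N (idm N) F" for F
    by (simp add: unitary_mat_left[OF assms] flip: mmult_assoc)
  then show ?case
    by (simp only: mono_eval_Cons Cons.IH) (simp add: mmult_assoc)
qed

lemma ntr_conj:
  assumes "unitary_mat N u" "supported N F"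
  shows "ntr N (mmult N (mmult N u F) (adj u)) = ntr N F"
  by (subst ntr_mmult_commute) (simp add: unitary_mat_left[OF assms(1)] assms(2) flip: mmult_assoc)

lemma selfadj_mat_iff_adj: "selfadj_mat N A \<longleftrightarrow> (\<forall>i<N. \<forall>j<N. adj A i j = A i j)"
  by (auto simp: selfadj_mat_def adj_def dest: sym)

lemma mmult_selfadj_left: "selfadj_mat N A \<Longrightarrow> mmult N (adj A) F = mmult N A F"
  and mmult_selfadj_right: "selfadj_mat N A \<Longrightarrow> mmult N F (adj A) = mmult N F A"
  by (simp_all add: selfadj_mat_iff_adj cong: mmult_cong)

lemma selfadj_conj:
  assumes "selfadj_mat N A"
  shows "selfadj_mat N (mmult N (mmult N u A) (adj u))"
  by (simp add: selfadj_mat_iff_adj adj_mmult mmult_assoc mmult_selfadj_left[OF assms])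

lemma mono_eval_rev:
  assumes "\<And>x. x \<in> set w \<Longrightarrow> selfadj_mat N (Z x)"
  shows "mono_eval N Z (rev w) = adj (mono_eval N Z w)"
  using assms
proof (induction w)
  case (Cons x w)
  have "mono_eval N Z (rev (x # w)) = mmult N (mmult N (adj (mono_eval N Z w)) (Z x)) (idm N)"
    using Cons by (simp add: mono_eval_append mono_eval_Cons mmult_assoc)
  also have "\<dots> = adj (mono_eval N Z (x # w))"
    using Cons.prems[of x] by (simp add: mono_eval_Cons adj_mmult mmult_selfadj_right)
  finally show ?case .
qed simp

definition letters :: "nat \<Rightarrow> (nat \<Rightarrow> cmat) \<Rightarrow> (nat \<Rightarrow> cmat) \<Rightarrow> cmat \<Rightarrow> var \<Rightarrow> cmat" where
  "letters N A B u = case_sum A (\<lambda>j. mmult N (mmult N u (B j)) (adj u))"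

lemma letters_simps [simp]:
  "letters N A B u (Inl i) = A i"
  "letters N A B u (Inr j) = mmult N (mmult N u (B j)) (adj u)"
  by (simp_all add: letters_def)

subsection \<open>Rotating the moving letters\<close>

definition rank_one :: "nat \<Rightarrow> cvec \<Rightarrow> cmat" where
  "rank_one N p = (\<lambda>i j. if i < N \<and> j < N then p i * cnj (p j) else 0)"

definition phase :: "nat \<Rightarrow> cvec \<Rightarrow> real \<Rightarrow> cmat" where
  "phase N p t = (\<lambda>i j. idm N i j + (cis t - 1) * rank_one N p i j)"

lemma supported_rank_one [simp]: "supported N (rank_one N p)"
  by (auto simp: supported_def rank_one_def)

lemma adj_phase: "adj (phase N p t) = phase N p (- t)"
  by (auto simp: adj_def phase_def fun_eq_iff idm_def rank_one_def cis_cnj)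

lemma rank_one_idem:
  assumes "unit_vec N p"
  shows "mmult N (rank_one N p) (rank_one N p) = rank_one N p"
proof (intro ext)
  fix i j
  have "(\<Sum>k<N. cnj (p k) * p k) = of_real (\<Sum>k<N. (cmod (p k))\<^sup>2)"
    unfolding of_real_sum by (simp add: complex_norm_square mult.commute del: of_real_power)
  then have "(\<Sum>k<N. cnj (p k) * p k) = 1"
    using assms by (simp add: unit_vec_def del: of_real_sum)
  moreover have "(\<Sum>k<N. p i * cnj (p k) * (p k * cnj (p j))) = p i * cnj (p j) * (\<Sum>k<N. cnj (p k) * p k)"
    by (simp add: sum_distrib_left mult_ac)
  ultimately show "mmult N (rank_one N p) (rank_one N p) i j = rank_one N p i j"
    by (simp add: mmult_def rank_one_def)
qed

lemma rank_one_phase: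
  assumes "unit_vec N p"
  shows "mmult N (rank_one N p) (phase N p t) = (\<lambda>i j. cis t * rank_one N p i j)"
  unfolding phase_def mmult_add_right mmult_scale_right rank_one_idem[OF assms]
  by (simp add: algebra_simps)

lemma phase_rank_one:
  assumes "unit_vec N p"
  shows "mmult N (phase N p t) (rank_one N p) = (\<lambda>i j. cis t * rank_one N p i j)"
  unfolding phase_def mmult_add_left mmult_scale_left rank_one_idem[OF assms]
  by (simp add: algebra_simps)

lemma unitary_phase:
  assumes "unit_vec N p"
  shows "unitary_mat N (phase N p t)"
proof -
  have supp: "supported N (phase N p t)" for t
    by (auto simp: supported_def phase_def idm_def rank_one_def)
  have "mmult N (phase N p t) (phase N p (- t)) i j = idm N i j" for i j
  proof -
    have "mmult N (phase N p t) (phase N p (- t)) i j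
        = phase N p (- t) i j + (cis t - 1) * (cis (- t) * rank_one N p i j)"
      unfolding phase_def[of N p t] mmult_add_left mmult_scale_left rank_one_phase[OF assms]
      by (simp add: supp)
    also have "\<dots> = idm N i j + (cis t * cis (- t) - 1) * rank_one N p i j"
      by (simp add: phase_def algebra_simps)
    finally show ?thesis by (simp add: cis_mult)
  qed
  then show ?thesis
    using supp by (simp add: unitary_mat_def supported_def adj_phase fun_eq_iff)
qed

definition has_matrix_derivative :: "(real \<Rightarrow> cmat) \<Rightarrow> cmat \<Rightarrow> real \<Rightarrow> bool" where
  "has_matrix_derivative F F' t \<longleftrightarrow> (\<forall>i j. ((\<lambda>t. F t i j) has_vector_derivative F' i j) (at t))"

lemma has_matrix_derivative_const: "has_matrix_derivative (\<lambda>t. A) (\<lambda>i j. 0) t"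
  by (simp add: has_matrix_derivative_def)

lemma has_matrix_derivative_mmult:
  assumes "has_matrix_derivative F F' t" "has_matrix_derivative G G' t"
  shows "has_matrix_derivative (\<lambda>t. mmult N (F t) (G t)) (\<lambda>i j. mmult N F' (G t) i j + mmult N (F t) G' i j) t"
  unfolding has_matrix_derivative_def
proof (intro allI)
  fix i j
  have "((\<lambda>t. \<Sum>k<N. F t i k * G t k j) has_vector_derivative (\<Sum>k<N. F t i k * G' k j + F' i k * G t k j)) (at t)"
    using assms unfolding has_matrix_derivative_def
    by (intro has_vector_derivative_sum has_vector_derivative_mult) simp_all
  then show "((\<lambda>t. mmult N (F t) (G t) i j) has_vector_derivative
      mmult N F' (G t) i j + mmult N (F t) G' i j) (at t)"
    by (cases "i < N \<and> j < N") (auto simp: mmult_def sum.distrib add.commute)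
qed

lemma has_vector_derivative_ntr:
  assumes "has_matrix_derivative F F' t"
  shows "((\<lambda>t. ntr N (F t)) has_vector_derivative ntr N F') (at t)"
  using assms unfolding ntr_def has_matrix_derivative_def
  by (intro has_vector_derivative_divide has_vector_derivative_sum) simp

lemma has_matrix_derivative_phase:
  assumes "unit_vec N p"
  shows "has_matrix_derivative (phase N p) (\<lambda>i j. \<i> * mmult N (rank_one N p) (phase N p t) i j) t"
    and "has_matrix_derivative (\<lambda>t. phase N p (- t)) (\<lambda>i j. - \<i> * mmult N (phase N p (- t)) (rank_one N p) i j) t"
  unfolding has_matrix_derivative_def rank_one_phase[OF assms] phase_rank_one[OF assms]
  by (auto simp: phase_def has_vector_derivative_def algebra_simps intro!: derivative_eq_intros)

lemma sum_mset_sum_swap: "(\<Sum>q\<in>#Q. \<Sum>i\<in>I. f q i) = (\<Sum>i\<in>I. \<Sum>q\<in>#Q. f q i :: 'b::comm_monoid_add)"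
  by (induction Q) (simp_all add: sum.distrib)

lemma has_vector_derivative_prod_mset:
  fixes f :: "'a \<Rightarrow> real \<Rightarrow> complex"
  assumes "\<And>q. (f q has_vector_derivative f' q) (at t)"
  shows "((\<lambda>t. \<Prod>q\<in>#Q. f q t) has_vector_derivative (\<Sum>q\<in>#Q. f' q * (\<Prod>r\<in>#Q - {#q#}. f r t))) (at t)"
proof (induction Q)
  case (add x Q)
  have "(\<Sum>q\<in>#Q. f' q * (\<Prod>r\<in>#add_mset x Q - {#q#}. f r t)) = f x t * (\<Sum>q\<in>#Q. f' q * (\<Prod>r\<in>#Q - {#q#}. f r t))"
    unfolding sum_mset_distrib_left
  proof (intro arg_cong[of _ _ sum_mset] image_mset_cong)
    fix q assume "q \<in># Q"
    then have "add_mset x Q - {#q#} = add_mset x (Q - {#q#})" by simp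
    then show "f' q * (\<Prod>r\<in>#add_mset x Q - {#q#}. f r t) = f x t * (f' q * (\<Prod>r\<in>#Q - {#q#}. f r t))"
      by (simp add: mult_ac)
  qed
  then show ?case
    using has_vector_derivative_mult[OF assms[of x] add] by (simp add: add.commute)
qed simp

lemma mmult_lib_deriv:
  "mmult N A (\<lambda>i j. lib_deriv D (\<lambda>p s. F p s i j) w) i j = lib_deriv D (\<lambda>p s. mmult N A (F p s) i j) w"
  by (cases "i < N \<and> j < N") (auto simp: mmult_def lib_deriv_sum lib_deriv_cmult)

lemma ntr_lib_deriv:
  "ntr N (\<lambda>i j. lib_deriv D (\<lambda>p s. F p s i j) w) = lib_deriv D (\<lambda>p s. ntr N (F p s)) w"
  using lib_deriv_cmult[of D "1 / of_nat N" "\<lambda>p s. \<Sum>i<N. F p s i i" w]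
  by (simp add: ntr_def lib_deriv_sum)

abbreviation moving :: "'a + 'b \<Rightarrow> bool" where
  "moving x \<equiv> \<not> isl x"

text \<open>Conjugation by \<open>exp (t G)\<close> differentiates the moving letters by the commutator with \<open>G\<close>, hence words by the
  liberation derivation.\<close>

lemma has_matrix_derivative_mono_eval:
  assumes "supported N G"
    and "\<And>x. has_matrix_derivative (\<lambda>t. Z t x)
      (\<lambda>i j. if D x then mmult N G (Z t x) i j - mmult N (Z t x) G i j else 0) t"
  shows "has_matrix_derivative (\<lambda>t. mono_eval N (Z t) w)
    (\<lambda>i j. lib_deriv D (\<lambda>p s. mmult N (mono_eval N (Z t) p) (mmult N G (mono_eval N (Z t) s)) i j) w) t"
proof -
  define F where "F = (\<lambda>p s. mmult N (mono_eval N (Z t) p) (mmult N G (mono_eval N (Z t) s)))"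
  have "has_matrix_derivative (\<lambda>t. mono_eval N (Z t) w) (\<lambda>i j. lib_deriv D (\<lambda>p s. F p s i j) w) t"
  proof (induction w)
    case Nil
    then show ?case by (simp add: has_matrix_derivative_const)
  next
    case (Cons x w)
    let ?Z' = "\<lambda>i j. if D x then mmult N G (Z t x) i j - mmult N (Z t x) G i j else 0"
    have "mmult N ?Z' (mono_eval N (Z t) w) = (\<lambda>i j. if D x then F [] (x # w) i j - F [x] w i j else 0)"
      using assms(1) by (cases "D x") (simp_all add: F_def mono_eval_Cons mmult_diff_left mmult_assoc)
    moreover have "mmult N (Z t x) (F p s) = F (x # p) s" for p s
      by (simp add: F_def mono_eval_Cons mmult_assoc)
    then have "mmult N (Z t x) (\<lambda>i j. lib_deriv D (\<lambda>p s. F p s i j) w) i j = lib_deriv D (\<lambda>p s. F (x # p) s i j) w"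
      for i j by (simp add: mmult_lib_deriv)
    ultimately show ?case
      using has_matrix_derivative_mmult[OF assms(2)[of x] Cons.IH, of N] by (simp add: mono_eval_Cons)
  qed
  then show ?thesis by (simp add: F_def)
qed

lemma has_matrix_derivative_letters:
  fixes A B :: "nat \<Rightarrow> cmat" and u :: cmat
  assumes "unit_vec N p"
  defines "G \<equiv> \<lambda>i j. \<i> * rank_one N p i j" and "Z \<equiv> \<lambda>t. letters N A B (mmult N (phase N p t) u)"
  shows "has_matrix_derivative (\<lambda>t. Z t x)
    (\<lambda>i j. if moving x then mmult N G (Z t x) i j - mmult N (Z t x) G i j else 0) t"
proof (cases x)
  case (Inl a)
  then show ?thesis by (simp add: Z_def has_matrix_derivative_const)
next
  case (Inr b)
  define V where "V = phase N p"
  define L where "L = letters N A B u x"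
  have Z_eq: "Z t x = mmult N (V t) (mmult N L (V (- t)))" for t
    by (simp add: Z_def L_def Inr V_def adj_mmult adj_phase mmult_assoc)
  have "mmult N (\<lambda>i j. \<i> * mmult N (rank_one N p) (V t) i j) (mmult N L (V (- t))) = mmult N G (Z t x)"
    by (simp add: G_def Z_eq mmult_scale_left mmult_assoc)
  moreover have "mmult N (V t) (\<lambda>i j. mmult N (\<lambda>i j. 0) (V (- t)) i j
        + mmult N L (\<lambda>i j. - \<i> * mmult N (V (- t)) (rank_one N p) i j) i j)
      = (\<lambda>i j. - mmult N (Z t x) G i j)"
    by (simp only: G_def Z_eq mmult_scale_left mmult_scale_right mmult_assoc mmult_zero_left add_0_left) simp
  moreover have "moving x" by (simp add: Inr)
  ultimately show ?thesis
    using has_matrix_derivative_mmult[OF has_matrix_derivative_phase(1)[OF assms(1)]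
        has_matrix_derivative_mmult[OF has_matrix_derivative_const[of L] has_matrix_derivative_phase(2)[OF assms(1)]],
        folded V_def, of N N t]
    by (simp add: Z_eq)
qed

text \<open>The \<open>(a, b)\<close> coefficient in the direction of the infinitesimal rotation of the moving letters, at the test
  function \<open>W P i j * (\<Prod>q\<in>#Q. ntr N (W q))\<close> with \<open>W = mono_eval N Z\<close>.\<close>

definition variation :: "nat \<Rightarrow> (var \<Rightarrow> cmat) \<Rightarrow> var list \<Rightarrow> var list multiset \<Rightarrow> nat \<Rightarrow> nat \<Rightarrow> nat \<Rightarrow> nat \<Rightarrow> complex" where
  "variation N Z P Q i j a b =
    lib_deriv moving (\<lambda>p s. mono_eval N Z p i a * mono_eval N Z s b j) P * (\<Prod>q\<in>#Q. ntr N (mono_eval N Z q)) +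
    mono_eval N Z P i j * (\<Sum>q\<in>#Q. lib_deriv moving (\<lambda>p s. mono_eval N Z (s @ p) b a) q / of_nat N *
      (\<Prod>r\<in>#Q - {#q#}. ntr N (mono_eval N Z r)))"

lemma mmult_mmult_expand:
  assumes "i < N" "j < N"
  shows "mmult N F (mmult N G H) i j = (\<Sum>a<N. \<Sum>b<N. G a b * (F i a * H b j))"
  using assms by (simp add: mmult_def sum_distrib_left mult_ac)

lemma ntr_mmult_mmult_expand:
  "ntr N (mmult N F (mmult N G H)) = (\<Sum>a<N. \<Sum>b<N. G a b * (mmult N H F b a / of_nat N))"
proof -
  have "ntr N (mmult N F (mmult N G H)) = ntr N (mmult N G (mmult N H F))"
    using ntr_mmult_commute[of N F "mmult N G H"] by (simp add: mmult_assoc)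
  then show ?thesis by (simp add: ntr_mmult sum_divide_distrib)
qed

lemma has_vector_derivative_test_function:
  assumes "supported N G" "i < N" "j < N"
    and "\<And>x. has_matrix_derivative (\<lambda>t. Z t x)
      (\<lambda>i j. if moving x then mmult N G (Z t x) i j - mmult N (Z t x) G i j else 0) t"
  shows "((\<lambda>t. mono_eval N (Z t) P i j * (\<Prod>q\<in>#Q. ntr N (mono_eval N (Z t) q))) has_vector_derivative
    (\<Sum>a<N. \<Sum>b<N. G a b * variation N (Z t) P Q i j a b)) (at t)"
proof -
  note word_deriv = has_matrix_derivative_mono_eval[OF assms(1), where D = moving, OF assms(4)]
  let ?W = "mono_eval N (Z t)" and ?prod = "\<lambda>Q. \<Prod>q\<in>#Q. ntr N (mono_eval N (Z t) q)"
  let ?entry' = "\<lambda>a b. lib_deriv moving (\<lambda>p s. ?W p i a * ?W s b j) P"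
  let ?tr' = "\<lambda>q a b. lib_deriv moving (\<lambda>p s. ?W (s @ p) b a) q / of_nat N"
  have entry: "((\<lambda>t. mono_eval N (Z t) P i j) has_vector_derivative (\<Sum>a<N. \<Sum>b<N. G a b * ?entry' a b)) (at t)"
    using word_deriv[of P, unfolded has_matrix_derivative_def, rule_format, of i j] assms(2,3)
    by (simp add: mmult_mmult_expand lib_deriv_sum lib_deriv_cmult)
  have trace_q: "((\<lambda>t. ntr N (mono_eval N (Z t) q)) has_vector_derivative (\<Sum>a<N. \<Sum>b<N. G a b * ?tr' q a b)) (at t)"
    for q
    using has_vector_derivative_ntr[OF word_deriv[of q], of N]
    by (simp add: ntr_lib_deriv ntr_mmult_mmult_expand lib_deriv_sum lib_deriv_cmult lib_deriv_multc
        divide_inverse flip: mono_eval_append)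
  have "(\<Sum>q\<in>#Q. (\<Sum>a<N. \<Sum>b<N. G a b * ?tr' q a b) * ?prod (Q - {#q#}))
      = (\<Sum>a<N. \<Sum>b<N. G a b * (\<Sum>q\<in>#Q. ?tr' q a b * ?prod (Q - {#q#})))"
    unfolding sum_distrib_right sum_mset_sum_swap sum_mset_distrib_left by (simp only: mult.assoc)
  moreover have "(\<Sum>a<N. \<Sum>b<N. G a b * variation N (Z t) P Q i j a b)
      = ?W P i j * (\<Sum>a<N. \<Sum>b<N. G a b * (\<Sum>q\<in>#Q. ?tr' q a b * ?prod (Q - {#q#})))
        + (\<Sum>a<N. \<Sum>b<N. G a b * ?entry' a b) * ?prod Q"
    unfolding variation_def sum_distrib_left[of "?W P i j"] sum_distrib_right[of _ _ "?prod Q"]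
      sum.distrib[symmetric]
    by (intro sum.cong refl) (simp add: algebra_simps)
  ultimately have "(\<Sum>a<N. \<Sum>b<N. G a b * variation N (Z t) P Q i j a b)
      = ?W P i j * (\<Sum>q\<in>#Q. (\<Sum>a<N. \<Sum>b<N. G a b * ?tr' q a b) * ?prod (Q - {#q#}))
        + (\<Sum>a<N. \<Sum>b<N. G a b * ?entry' a b) * ?prod Q"
    by (simp only:)
  then show ?thesis
    by (simp only:) (intro has_vector_derivative_mult entry has_vector_derivative_prod_mset trace_q)
qed

lemma sum_variation_diag:
  fixes Z :: "var \<Rightarrow> cmat"
  assumes "N \<ge> 1"
  defines "T \<equiv> \<lambda>w. ntr N (mono_eval N Z w)"
  shows "(\<Sum>a<N. \<Sum>b<N. variation N Z P Q a b a b) =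
    (of_nat N)\<^sup>2 * (lib_deriv moving (\<lambda>p s. T p * T s) P * (\<Prod>q\<in>#Q. T q)) +
    (\<Sum>q\<in>#Q. lib_deriv moving (\<lambda>p s. T (p @ P @ s)) q * (\<Prod>r\<in>#Q - {#q#}. T r))"
proof -
  let ?W = "mono_eval N Z"
  have "(\<Sum>a<N. \<Sum>b<N. lib_deriv moving (\<lambda>p s. ?W p a a * ?W s b b) P)
      = lib_deriv moving (\<lambda>p s. \<Sum>a<N. \<Sum>b<N. ?W p a a * ?W s b b) P"
    by (simp add: lib_deriv_sum)
  also have "(\<lambda>p s. \<Sum>a<N. \<Sum>b<N. ?W p a a * ?W s b b) = (\<lambda>p s. (of_nat N)\<^sup>2 * (T p * T s))"
    using assms(1) by (simp add: T_def ntr_def power2_eq_square sum_product fun_eq_iff)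
  finally have split: "(\<Sum>a<N. \<Sum>b<N. lib_deriv moving (\<lambda>p s. ?W p a a * ?W s b b) P)
      = (of_nat N)\<^sup>2 * lib_deriv moving (\<lambda>p s. T p * T s) P"
    by (simp add: lib_deriv_cmult)
  have merge: "(\<Sum>a<N. \<Sum>b<N. ?W P a b * (lib_deriv moving (\<lambda>p s. ?W (s @ p) b a) q / of_nat N))
      = lib_deriv moving (\<lambda>p s. T (p @ P @ s)) q" for q
  proof -
    have "T (p @ P @ s) = (\<Sum>a<N. \<Sum>b<N. ?W P a b * ?W (s @ p) b a) / of_nat N" for p s
      using ntr_mono_eval_rotate[of N Z p "P @ s"] unfolding T_def
      by (simp add: mono_eval_append[of N Z P "s @ p"] ntr_mmult)
    then show ?thesis
      by (simp add: divide_inverse lib_deriv_multc lib_deriv_sum lib_deriv_cmult sum_distrib_right mult.assoc)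
  qed
  have "(\<Sum>a<N. \<Sum>b<N. ?W P a b *
        (\<Sum>q\<in>#Q. lib_deriv moving (\<lambda>p s. ?W (s @ p) b a) q / of_nat N * (\<Prod>r\<in>#Q - {#q#}. T r)))
      = (\<Sum>q\<in>#Q. lib_deriv moving (\<lambda>p s. T (p @ P @ s)) q * (\<Prod>r\<in>#Q - {#q#}. T r))"
    unfolding merge[symmetric] sum_mset_distrib_left
    by (simp add: sum_distrib_right sum_mset_sum_swap mult.assoc)
  then show ?thesis
    unfolding variation_def T_def[symmetric]
    by (simp add: sum.distrib split flip: sum_distrib_right)
qed

lemma hermitian_form_on_pair:
  fixes F :: "nat \<Rightarrow> nat \<Rightarrow> complex"
  assumes form: "\<And>p. unit_vec N p \<Longrightarrow> (\<Sum>a<N. \<Sum>b<N. p a * cnj (p b) * F a b) = 0"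
    and "a \<noteq> b" "a < N" "b < N" "(cmod \<alpha>)\<^sup>2 + (cmod \<beta>)\<^sup>2 = 1"
  shows "(cmod \<alpha>)\<^sup>2 * F a a + \<alpha> * cnj \<beta> * F a b + \<beta> * cnj \<alpha> * F b a + (cmod \<beta>)\<^sup>2 * F b b = 0"
proof -
  define p where "p = (\<lambda>i. if i = a then \<alpha> else if i = b then \<beta> else 0)"
  have restrict: "(\<Sum>i<N. f i) = f a + f b" if "\<And>i. i \<noteq> a \<Longrightarrow> i \<noteq> b \<Longrightarrow> f i = 0" for f :: "nat \<Rightarrow> 'b::comm_monoid_add"
    using assms(2-4) that sum.mono_neutral_right[of "{..<N}" "{a, b}" f] by auto
  have "unit_vec N p"
    unfolding unit_vec_def using assms(2-5) by (subst restrict) (auto simp: p_def)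
  from form[OF this] show ?thesis
    using \<open>a \<noteq> b\<close> by (simp add: restrict p_def complex_norm_square algebra_simps del: of_real_power)
qed

lemma hermitian_form_on_coordinate:
  fixes F :: "nat \<Rightarrow> nat \<Rightarrow> complex"
  assumes form: "\<And>p. unit_vec N p \<Longrightarrow> (\<Sum>a<N. \<Sum>b<N. p a * cnj (p b) * F a b) = 0" and "a < N"
  shows "F a a = 0"
proof -
  define p where "p = (\<lambda>i. if i = a then 1 else 0 :: complex)"
  have "(\<Sum>i<N. (cmod (p i))\<^sup>2) = (\<Sum>i<N. if i = a then 1 else 0)"
    by (intro sum.cong) (auto simp: p_def)
  then have "unit_vec N p" using assms(2) by (simp add: unit_vec_def)
  moreover have "(\<Sum>i<N. \<Sum>j<N. p i * cnj (p j) * F i j)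
      = (\<Sum>i<N. \<Sum>j<N. if j = a then if i = a then F i j else 0 else 0)"
    by (intro sum.cong refl) (simp add: p_def)
  ultimately show ?thesis using form[of p] assms(2) by simp
qed

text \<open>Polarization; the coefficients \<open>3/5\<close> and \<open>4/5\<close> give unit vectors with rational entries.\<close>

lemma hermitian_form_eq_0_imp_eq_0:
  fixes F :: "nat \<Rightarrow> nat \<Rightarrow> complex"
  assumes form: "\<And>p. unit_vec N p \<Longrightarrow> (\<Sum>a<N. \<Sum>b<N. p a * cnj (p b) * F a b) = 0"
    and "a < N" "b < N"
  shows "F a b = 0"
proof (cases "a = b")
  case True
  then show ?thesis using hermitian_form_on_coordinate[where F = F, OF form assms(2)] by simp
next
  case False
  have diagonal: "F a a = 0" "F b b = 0"
    using hermitian_form_on_coordinate[where F = F, OF form] assms(2,3) by auto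
  note on_pair = hermitian_form_on_pair[where F = F, OF form False assms(2,3)]
  have "12 * (F a b + F b a) = 0"
    using on_pair[of "3/5" "4/5"] diagonal by (simp add: norm_divide power_divide field_simps)
  moreover have "12 * \<i> * (F b a - F a b) = 0"
    using on_pair[of "3/5" "4/5 * \<i>"] diagonal
    by (simp add: norm_divide norm_mult power_divide field_simps)
  ultimately show ?thesis by simp
qed

subsection \<open>The Schwinger--Dyson equation for Haar unitaries\<close>

lemma continuous_on_entry:
  fixes F :: "'a::topological_space \<Rightarrow> cmat"
  shows "continuous_on S F \<Longrightarrow> continuous_on S (\<lambda>u. F u i j)"
  by (rule continuous_on_product_then_coordinatewise[OF continuous_on_product_then_coordinatewise])

lemma continuous_on_mmult:
  fixes F G :: "'a::topological_space \<Rightarrow> cmat"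
  assumes "continuous_on S F" "continuous_on S G"
  shows "continuous_on S (\<lambda>u. mmult N (F u) (G u))"
proof (intro continuous_on_coordinatewise_then_product)
  fix i j
  have "continuous_on S (\<lambda>u. \<Sum>k<N. F u i k * G u k j)"
    by (intro continuous_on_sum continuous_on_mult continuous_on_entry assms)
  then show "continuous_on S (\<lambda>u. mmult N (F u) (G u) i j)"
    by (cases "i < N \<and> j < N") (auto simp: mmult_def)
qed

lemma continuous_on_letters: "continuous_on S (\<lambda>u. letters N A B u x)"
proof -
  have "continuous_on S adj"
    unfolding adj_def
    by (intro continuous_on_coordinatewise_then_product continuous_on_cnj continuous_on_entry[OF continuous_on_id])
  then show ?thesis
    by (cases x) (auto intro!: continuous_on_mmult continuous_on_id)
qed

lemma continuous_on_mono_eval_letters: "continuous_on S (\<lambda>u. mono_eval N (letters N A B u) w i j)"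
proof -
  have "continuous_on S (\<lambda>u. mono_eval N (letters N A B u) w)"
    by (induction w) (simp_all add: mono_eval_Cons continuous_on_mmult continuous_on_letters)
  then show ?thesis by (rule continuous_on_entry)
qed

lemma continuous_on_ntr_letters: "continuous_on S (\<lambda>u. ntr N (mono_eval N (letters N A B u) w))"
  unfolding ntr_def divide_inverse
  by (intro continuous_on_sum continuous_on_mult continuous_on_const continuous_on_mono_eval_letters)

lemma continuous_on_prod_mset:
  fixes f :: "'a \<Rightarrow> 'b::topological_space \<Rightarrow> complex"
  assumes "\<And>q. continuous_on S (f q)"
  shows "continuous_on S (\<lambda>u. \<Prod>q\<in>#Q. f q u)"
  by (induction Q) (simp_all add: continuous_on_mult assms)

lemma continuous_on_sum_mset:
  fixes f :: "'a \<Rightarrow> 'b::topological_space \<Rightarrow> complex"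
  assumes "\<And>q. continuous_on S (f q)"
  shows "continuous_on S (\<lambda>u. \<Sum>q\<in>#Q. f q u)"
  by (induction Q) (simp_all add: continuous_on_add assms)

lemma continuous_on_lib_deriv:
  fixes f :: "'a list \<Rightarrow> 'a list \<Rightarrow> 'b::topological_space \<Rightarrow> complex"
  assumes "\<And>p s. continuous_on S (f p s)"
  shows "continuous_on S (\<lambda>u. lib_deriv D (\<lambda>p s. f p s u) w)"
  by (rule lib_deriv_closed[where C = "continuous_on S"]) (simp_all add: continuous_on_diff assms)

lemma continuous_on_variation: "continuous_on S (\<lambda>u. variation N (letters N A B u) P Q i j a b)"
  unfolding variation_def divide_inverse
  by (intro continuous_on_add continuous_on_mult continuous_on_const continuous_on_lib_deriv
      continuous_on_prod_mset continuous_on_sum_mset continuous_on_mono_eval_letters continuous_on_ntr_letters)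

lemma continuous_bounded_on_unitaries:
  fixes f :: "cmat \<Rightarrow> complex"
  assumes "continuous_on UNIV f"
  obtains K where "\<And>u. unitary_mat N u \<Longrightarrow> cmod (f u) \<le> K"
proof -
  have compact_PiE: "compact (PiE UNIV (\<lambda>i. C))" if "compact C" for C :: "'b::topological_space set"
    using that compactin_PiE[of "\<lambda>_. euclidean" UNIV "\<lambda>_. C"] by (simp add: euclidean_product_topology)
  define C where "C = PiE UNIV (\<lambda>i::nat. PiE UNIV (\<lambda>j::nat. cball (0::complex) 1))"
  have "compact C"
    unfolding C_def by (intro compact_PiE compact_cball)
  then have "bounded (f ` C)"
    using continuous_on_subset[OF assms] by (intro compact_imp_bounded compact_continuous_image) auto
  then obtain K where "\<And>u. u \<in> C \<Longrightarrow> cmod (f u) \<le> K"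
    by (auto simp: bounded_iff)
  moreover have "u \<in> C" if "unitary_mat N u" for u
    using unitary_mat_entry_le[OF that] by (auto simp: C_def)
  ultimately show thesis
    by (intro that) blast
qed

lemma difference_quotient_tendsto:
  fixes f :: "real \<Rightarrow> complex"
  assumes "(f has_vector_derivative D) (at 0)"
  shows "((\<lambda>h. (f h - f 0) / of_real h) \<longlongrightarrow> D) (at 0)"
proof -
  have "((\<lambda>h. norm (f h - f 0 - h *\<^sub>R D) / norm h) \<longlongrightarrow> 0) (at 0)"
    using assms by (simp add: has_vector_derivative_def has_derivative_at)
  moreover have "norm (f h - f 0 - h *\<^sub>R D) / norm h = norm ((f h - f 0) / of_real h - D)" if "h \<noteq> 0" for h
  proof -
    have "(f h - f 0) / of_real h - D = (f h - f 0 - h *\<^sub>R D) / of_real h"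
      using that by (simp add: scaleR_conv_of_real diff_divide_distrib)
    then show ?thesis by (simp add: norm_divide)
  qed
  ultimately have "((\<lambda>h. norm ((f h - f 0) / of_real h - D)) \<longlongrightarrow> 0) (at 0)"
    by (rule Lim_transform_within[OF _ zero_less_one]) simp
  then show ?thesis
    by (rule LIM_zero_cancel[OF tendsto_norm_zero_cancel])
qed

lemma unitary_mat_mmult:
  assumes "unitary_mat N u" "unitary_mat N v"
  shows "unitary_mat N (mmult N u v)"
proof -
  have "supported N u" using assms(1) by (auto simp: unitary_mat_def supported_def)
  have "mmult N (mmult N u v) (adj (mmult N u v)) = mmult N u (mmult N (mmult N v (adj v)) (adj u))"
    by (simp add: adj_mmult mmult_assoc)
  also have "\<dots> = idm N"
    using assms by (simp add: unitary_mat_def)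
  finally show ?thesis by (simp add: unitary_mat_def) (auto simp: mmult_def)
qed

lemma phase_0: "unitary_mat N u \<Longrightarrow> mmult N (phase N p 0) u = u"
  by (simp add: phase_def unitary_mat_def supported_def)

lemma phase_quotient_le:
  fixes f f' :: "cmat \<Rightarrow> complex"
  assumes p: "unit_vec N p" and u: "unitary_mat N u"
    and deriv: "\<And>t. ((\<lambda>t. f (mmult N (phase N p t) u)) has_vector_derivative f' (mmult N (phase N p t) u)) (at t)"
    and bound: "\<And>u. unitary_mat N u \<Longrightarrow> cmod (f' u) \<le> K" and h: "h > 0"
  shows "cmod ((f (mmult N (phase N p h) u) - f u) / of_real h) \<le> K"
proof -
  let ?g = "\<lambda>t. f (mmult N (phase N p t) u)"
  have "cmod (?g h - ?g 0) \<le> K * h - K * 0"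
  proof (rule differentiable_bound_general)
    show "continuous_on {0..h} ?g"
      using deriv by (intro continuous_at_imp_continuous_on ballI has_vector_derivative_continuous)
    show "cmod (f' (mmult N (phase N p t) u)) \<le> K" for t
      by (intro bound unitary_mat_mmult unitary_phase p u)
  qed (auto intro!: h deriv continuous_intros derivative_eq_intros)
  then show ?thesis
    using h by (simp add: phase_0[OF u] norm_divide pos_divide_le_eq)
qed

lemma integrable_sum_mset:
  fixes f :: "'a \<Rightarrow> 'w \<Rightarrow> complex"
  assumes "\<And>q. integrable M (f q)"
  shows "integrable M (\<lambda>\<omega>. \<Sum>q\<in>#Q. f q \<omega>)"
  by (induction Q) (simp_all add: assms)

lemma integral_sum_mset:
  fixes f :: "'a \<Rightarrow> 'w \<Rightarrow> complex"
  assumes "\<And>q. integrable M (f q)"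
  shows "(\<integral>\<omega>. (\<Sum>q\<in>#Q. f q \<omega>) \<partial>M) = (\<Sum>q\<in>#Q. \<integral>\<omega>. f q \<omega> \<partial>M)"
  by (induction Q) (simp_all add: assms integrable_sum_mset)

locale haar_matrix = prob_space M for M :: "'w measure" +
  fixes N :: nat and A B :: "nat \<Rightarrow> cmat" and U :: "'w \<Rightarrow> cmat"
  assumes haar: "haar_unitary M N U" and N_pos: "N \<ge> 1"
begin

abbreviation trace_word :: "cmat \<Rightarrow> var list \<Rightarrow> complex" where
  "trace_word u w \<equiv> ntr N (mono_eval N (letters N A B u) w)"

lemma U_measurable [measurable]: "U \<in> M \<rightarrow>\<^sub>M borel"
  and U_unitary: "AE \<omega> in M. unitary_mat N (U \<omega>)"
  using haar by (auto simp: haar_unitary_def)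

lemma integrable_continuous:
  fixes f :: "cmat \<Rightarrow> complex"
  assumes "continuous_on UNIV f"
  shows "integrable M (\<lambda>\<omega>. f (U \<omega>))"
proof -
  obtain K where "\<And>u. unitary_mat N u \<Longrightarrow> cmod (f u) \<le> K"
    using continuous_bounded_on_unitaries[OF assms] by blast
  then have "AE \<omega> in M. norm (f (U \<omega>)) \<le> K"
    using U_unitary by auto
  moreover have "f \<in> borel_measurable borel"
    by (rule borel_measurable_continuous_onI[OF assms])
  ultimately show ?thesis
    by (intro integrable_const_bound) auto
qed

lemma haar_invariant:
  fixes f :: "cmat \<Rightarrow> complex"
  assumes "unitary_mat N V" "continuous_on UNIV f"
  shows "expectation (\<lambda>\<omega>. f (mmult N V (U \<omega>))) = expectation (\<lambda>\<omega>. f (U \<omega>))"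
proof -
  have [measurable]: "f \<in> borel_measurable borel"
    by (rule borel_measurable_continuous_onI[OF assms(2)])
  have "(\<lambda>u. mmult N V u i j) \<in> borel_measurable borel" for i j
    by (intro borel_measurable_continuous_onI continuous_on_entry continuous_on_mmult continuous_on_const
        continuous_on_id)
  then have [measurable]: "mmult N V \<in> borel \<rightarrow>\<^sub>M borel"
    by (intro measurable_coordinatewise_then_product)
  have "expectation (\<lambda>\<omega>. f (mmult N V (U \<omega>))) = integral\<^sup>L (distr M borel (\<lambda>\<omega>. mmult N V (U \<omega>))) f"
    by (rule integral_distr[symmetric]) measurable
  also have "distr M borel (\<lambda>\<omega>. mmult N V (U \<omega>)) = distr M borel U"
    using haar assms(1) by (auto simp: haar_unitary_def)
  also have "integral\<^sup>L (distr M borel U) f = expectation (\<lambda>\<omega>. f (U \<omega>))"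
    by (rule integral_distr) measurable
  finally show ?thesis .
qed

lemma expectation_derivative_eq_0:
  fixes f f' :: "cmat \<Rightarrow> complex"
  assumes p: "unit_vec N p" and cont: "continuous_on UNIV f" "continuous_on UNIV f'"
    and deriv: "\<And>u t. ((\<lambda>t. f (mmult N (phase N p t) u)) has_vector_derivative f' (mmult N (phase N p t) u)) (at t)"
  shows "expectation (\<lambda>\<omega>. f' (U \<omega>)) = 0"
proof -
  define h where "h = (\<lambda>n. 1 / real (Suc n))"
  define quotient where "quotient = (\<lambda>n u. (f (mmult N (phase N p (h n)) u) - f u) / of_real (h n))"
  have h_lim: "filterlim h (at 0) sequentially"
    using LIMSEQ_Suc[OF lim_1_over_n[where 'a = real]] by (simp add: filterlim_at h_def)
  obtain K where K: "\<And>u. unitary_mat N u \<Longrightarrow> cmod (f' u) \<le> K"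
    using continuous_bounded_on_unitaries[OF cont(2)] by blast
  have cont_rotated: "continuous_on UNIV (\<lambda>u. f (mmult N (phase N p t) u))" for t
    by (intro continuous_on_compose2[OF cont(1)] continuous_on_mmult continuous_on_const continuous_on_id) simp
  have "(\<lambda>n. expectation (\<lambda>\<omega>. quotient n (U \<omega>))) \<longlonglongrightarrow> expectation (\<lambda>\<omega>. f' (U \<omega>))"
  proof (rule integral_dominated_convergence[where w = "\<lambda>_. K"])
    show "AE \<omega> in M. (\<lambda>n. quotient n (U \<omega>)) \<longlonglongrightarrow> f' (U \<omega>)"
      using U_unitary
    proof eventually_elim
      case (elim \<omega>)
      then show ?case
        using filterlim_compose[OF difference_quotient_tendsto[OF deriv[of "U \<omega>" 0]] h_lim]
        by (simp add: quotient_def phase_0)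
    qed
    show "AE \<omega> in M. norm (quotient n (U \<omega>)) \<le> K" for n
      unfolding quotient_def using U_unitary
      by eventually_elim (intro phase_quotient_le[OF p _ deriv K], simp_all add: h_def)
    show "(\<lambda>\<omega>. f' (U \<omega>)) \<in> borel_measurable M"
      by (intro borel_measurable_integrable integrable_continuous cont)
    show "(\<lambda>\<omega>. quotient n (U \<omega>)) \<in> borel_measurable M" for n
      unfolding quotient_def divide_inverse
      by (intro borel_measurable_integrable integrable_continuous continuous_on_mult continuous_on_diff
          continuous_on_const cont cont_rotated)
  qed simp
  moreover have "expectation (\<lambda>\<omega>. quotient n (U \<omega>)) = 0" for n
    unfolding quotient_def using haar_invariant[OF unitary_phase[OF p] cont(1)]
      integrable_continuous[OF cont(1)] integrable_continuous[OF cont_rotated]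
    by simp
  ultimately show ?thesis
    by (simp add: LIMSEQ_const_iff)
qed

lemma integrable_variation: "integrable M (\<lambda>\<omega>. variation N (letters N A B (U \<omega>)) P Q i j a b)"
  by (intro integrable_continuous continuous_on_variation)

lemma expectation_variation_eq_0:
  assumes "i < N" "j < N" "a < N" "b < N"
  shows "expectation (\<lambda>\<omega>. variation N (letters N A B (U \<omega>)) P Q i j a b) = 0"
proof (rule hermitian_form_eq_0_imp_eq_0[OF _ assms(3,4)])
  fix p assume p: "unit_vec N p"
  let ?var = "\<lambda>u. variation N (letters N A B u) P Q i j"
  let ?G = "\<lambda>a b. \<i> * rank_one N p a b"
  have "supported N ?G" by (simp add: supported_def rank_one_def)
  have "expectation (\<lambda>\<omega>. \<Sum>a<N. \<Sum>b<N. ?G a b * ?var (U \<omega>) a b) = 0"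
    by (rule expectation_derivative_eq_0[OF p _ _
          has_vector_derivative_test_function[OF \<open>supported N ?G\<close> assms(1,2) has_matrix_derivative_letters[OF p]]])
      (intro continuous_on_sum continuous_on_mult continuous_on_const continuous_on_prod_mset
        continuous_on_mono_eval_letters continuous_on_ntr_letters continuous_on_variation)+
  then have "\<i> * (\<Sum>a<N. \<Sum>b<N. p a * cnj (p b) * expectation (\<lambda>\<omega>. ?var (U \<omega>) a b)) = 0"
    by (simp add: integrable_variation rank_one_def sum_distrib_left mult.assoc)
  then show "(\<Sum>a<N. \<Sum>b<N. p a * cnj (p b) * expectation (\<lambda>\<omega>. ?var (U \<omega>) a b)) = 0"
    by simp
qed

definition trace_moment :: "var list multiset \<Rightarrow> complex" where
  "trace_moment Q = expectation (\<lambda>\<omega>. \<Prod>q\<in>#Q. trace_word (U \<omega>) q)"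

lemma integrable_trace_prod: "integrable M (\<lambda>\<omega>. \<Prod>q\<in>#Q. trace_word (U \<omega>) q)"
  by (intro integrable_continuous continuous_on_prod_mset continuous_on_ntr_letters)

theorem schwinger_dyson:
  "lib_deriv moving (\<lambda>p s. trace_moment (add_mset p (add_mset s Q))) P +
   (\<Sum>q\<in>#Q. lib_deriv moving (\<lambda>p s. trace_moment (add_mset (p @ P @ s) (Q - {#q#}))) q) / (of_nat N)\<^sup>2 = 0"
proof -
  let ?prod = "\<lambda>Q \<omega>. \<Prod>q\<in>#Q. trace_word (U \<omega>) q"
  let ?split = "\<lambda>\<omega>. lib_deriv moving (\<lambda>p s. ?prod (add_mset p (add_mset s Q)) \<omega>) P"
  let ?merge = "\<lambda>q \<omega>. lib_deriv moving (\<lambda>p s. ?prod (add_mset (p @ P @ s) (Q - {#q#})) \<omega>) q"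
  have integrable: "integrable M ?split" "integrable M (?merge q)" for q
    by (intro lib_deriv_integrable integrable_trace_prod)+
  have "0 = expectation (\<lambda>\<omega>. \<Sum>a<N. \<Sum>b<N. variation N (letters N A B (U \<omega>)) P Q a b a b)"
    by (simp add: integrable_variation expectation_variation_eq_0)
  also have "\<dots> = expectation (\<lambda>\<omega>. (of_nat N)\<^sup>2 * ?split \<omega> + (\<Sum>q\<in>#Q. ?merge q \<omega>))"
    unfolding sum_variation_diag[OF N_pos] by (simp add: lib_deriv_multc flip: mult.assoc)
  also have "\<dots> = (of_nat N)\<^sup>2 * expectation ?split + (\<Sum>q\<in>#Q. expectation (?merge q))"
    using integrable by (simp add: integrable_sum_mset integral_sum_mset)
  also have "expectation ?split = lib_deriv moving (\<lambda>p s. trace_moment (add_mset p (add_mset s Q))) P"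
    unfolding trace_moment_def by (intro lib_deriv_integral integrable_trace_prod)
  also have "(\<lambda>q. expectation (?merge q))
      = (\<lambda>q. lib_deriv moving (\<lambda>p s. trace_moment (add_mset (p @ P @ s) (Q - {#q#}))) q)"
    unfolding trace_moment_def by (intro ext lib_deriv_integral integrable_trace_prod)
  finally show ?thesis
    using N_pos by (simp add: field_simps)
qed

end

subsection \<open>Asymptotics of solutions of the Schwinger--Dyson equation\<close>

definition monochromatic :: "('a + 'b) list \<Rightarrow> bool" where
  "monochromatic w \<longleftrightarrow> (\<forall>x\<in>set w. isl x) \<or> (\<forall>x\<in>set w. moving x)"

text \<open>The letter \<open>Inl k\<close>, one beyond the variables \<open>X\<close>, marks the matrix \<open>N v v\<^sup>*\<close>. The trace of a word marked twice
  factors at the price of a factor \<open>N\<close>, so limits exist only for words marked at most once.\<close>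

definition admissible :: "nat \<Rightarrow> nat \<Rightarrow> var list \<Rightarrow> bool" where
  "admissible k l w \<longleftrightarrow> set w \<subseteq> insert (Inl k) (Xvars k \<union> Yvars l) \<and> count (mset w) (Inl k) \<le> 1"

lemma admissible_appendD:
  assumes "admissible k l (u @ w)"
  shows "admissible k l u" "admissible k l w"
  using assms by (auto simp: admissible_def)

lemma admissible_rev [simp]: "admissible k l (rev w) \<longleftrightarrow> admissible k l w"
  by (simp add: admissible_def)

lemma mset_rotate [simp]: "mset (rotate n w) = mset w"
  unfolding rotate_drop_take mset_append by (metis add.commute append_take_drop_id mset_append)

lemma admissible_rotate [simp]: "admissible k l (rotate n w) \<longleftrightarrow> admissible k l w"
  by (simp add: admissible_def del: count_mset)

lemma count_2_rotation:
  assumes "count (mset w) x = 2"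
  obtains n u v where "rotate n w = x # u @ x # v" "x \<notin> set u" "x \<notin> set v"
proof -
  have "x \<in> set w" using assms by (metis count_eq_zero_iff set_mset_mset zero_neq_numeral)
  then obtain a b where w_eq: "w = a @ x # b" by (auto simp: in_set_conv_decomp)
  then have "count (mset (b @ a)) x = 1" using assms by simp
  then obtain u v where ba_eq: "b @ a = u @ x # v"
    by (metis count_eq_zero_iff set_mset_mset split_list zero_neq_one)
  have "rotate (length a) w = x # u @ x # v"
    by (simp add: w_eq rotate_append flip: ba_eq)
  moreover have "count (mset u) x = 0" "count (mset v) x = 0"
    using \<open>count (mset (b @ a)) x = 1\<close> unfolding ba_eq by simp_all
  then have "x \<notin> set u" "x \<notin> set v"
    by (simp_all only: count_eq_zero_iff set_mset_mset not_False_eq_True)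
  ultimately show thesis by (rule that)
qed

lemma bigo_sum_mset:
  "(\<And>q. q \<in># Q \<Longrightarrow> f q \<in> O[F](g)) \<Longrightarrow> (\<lambda>n. \<Sum>q\<in>#Q. f q n) \<in> O[F](g)"
  by (induction Q) (simp_all add: sum_in_bigo)

lemma lib_deriv_bigo:
  assumes "\<And>p s. p @ s = w \<Longrightarrow> f p s \<in> O[F](g)"
  shows "(\<lambda>n. lib_deriv D (\<lambda>p s. f p s n) w) \<in> O[F](g)"
  by (rule lib_deriv_closed[where C = "\<lambda>f. f \<in> O[F](g)"]) (use assms in \<open>auto intro: sum_in_bigo(2)\<close>)

lemma inner_deriv_bigo:
  assumes "w \<noteq> []" "D (hd w)" "\<not> D (last w)"
    and "\<And>p s. p \<noteq> [] \<Longrightarrow> s \<noteq> [] \<Longrightarrow> p @ s = w \<Longrightarrow> f p s \<in> O[F](g)"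
  shows "(\<lambda>n. inner_deriv D (\<lambda>p s. f p s n) w) \<in> O[F](g)"
  by (rule inner_deriv_closed[where C = "\<lambda>f. f \<in> O[F](g)"]) (use assms in \<open>auto intro: sum_in_bigo(2)\<close>)

lemma bigo_cong_ge_1:
  "(\<And>N. N \<ge> 1 \<Longrightarrow> f N = g N) \<Longrightarrow> g \<in> O(h) \<Longrightarrow> f \<in> O(h)"
  for f :: "nat \<Rightarrow> 'b::real_normed_field"
  using landau_o.big.in_cong[of f g sequentially h] eventually_sequentiallyI[of 1 "\<lambda>N. f N = g N"] by blast

lemma tendsto_cong_ge_1:
  "(\<And>N. N \<ge> 1 \<Longrightarrow> f N = g N) \<Longrightarrow> g \<longlonglongrightarrow> L \<Longrightarrow> f \<longlonglongrightarrow> L"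
  by (rule Lim_transform_eventually[OF _ eventually_sequentiallyI[of 1]]) simp_all

lemma inverse_nat_power_bigo: "b \<le> a \<Longrightarrow> (\<lambda>N. 1 / of_nat N ^ a) \<in> O(\<lambda>N. 1 / of_nat N ^ b :: complex)"
  by (intro bigoI[of _ 1] eventually_sequentiallyI[of 1])
    (simp add: norm_divide norm_power frac_le power_increasing)

lemma bigo_absorb_divide_nat:
  fixes f :: "nat \<Rightarrow> real"
  assumes "f \<in> O(\<lambda>N. 1 + f N / real N)"
  shows "f \<in> O(\<lambda>_. 1)"
proof -
  obtain C where C: "C > 0" and bound: "\<forall>\<^sub>F N in sequentially. norm (f N) \<le> C * norm (1 + f N / real N)"
    using landau_o.bigE[OF assms] by blast
  have "\<forall>\<^sub>F N in sequentially. 2 * C \<le> real N"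
    using filterlim_real_sequentially by (auto simp: filterlim_at_top)
  with bound eventually_ge_at_top[of 1] have "\<forall>\<^sub>F N in sequentially. norm (f N) \<le> 2 * C"
  proof eventually_elim
    case (elim N)
    have "norm (1 + f N / real N) \<le> 1 + norm (f N) / real N"
      using norm_triangle_ineq[of 1 "f N / real N"] by simp
    then have "norm (f N) \<le> C * (1 + norm (f N) / real N)"
      using elim(1) C by (meson mult_left_mono order_trans less_imp_le)
    then have "norm (f N) \<le> C + C * (norm (f N) / real N)"
      by (simp only: distrib_left mult_1_right)
    moreover have "C * (norm (f N) / real N) \<le> norm (f N) / 2"
      using elim(2,3) mult_right_mono[OF elim(3), of "norm (f N)"] by (simp add: field_simps)
    ultimately show ?case by linarith
  qed
  then show ?thesis by (intro bigoI[of _ "2 * C"]) simp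
qed

lemma AE_tendsto_0_of_summable_integral:
  fixes Y :: "nat \<Rightarrow> 'w \<Rightarrow> real"
  assumes int: "\<And>n. integrable M (Y n)" and nonneg: "\<And>n \<omega>. 0 \<le> Y n \<omega>"
    and summable: "summable (\<lambda>n. \<integral>\<omega>. Y n \<omega> \<partial>M)"
  shows "AE \<omega> in M. (\<lambda>n. Y n \<omega>) \<longlonglongrightarrow> 0"
proof -
  have [measurable]: "Y n \<in> borel_measurable M" for n using int by auto
  have "(\<integral>\<^sup>+\<omega>. (\<Sum>n. ennreal (Y n \<omega>)) \<partial>M) = (\<Sum>n. \<integral>\<^sup>+\<omega>. ennreal (Y n \<omega>) \<partial>M)"
    by (rule nn_integral_suminf) measurable
  also have "\<dots> = (\<Sum>n. ennreal (\<integral>\<omega>. Y n \<omega> \<partial>M))"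
    using nonneg int by (intro suminf_cong nn_integral_eq_integral) auto
  also have "\<dots> = ennreal (\<Sum>n. \<integral>\<omega>. Y n \<omega> \<partial>M)"
    using summable nonneg by (intro suminf_ennreal2) simp_all
  finally have "(\<integral>\<^sup>+\<omega>. (\<Sum>n. ennreal (Y n \<omega>)) \<partial>M) \<noteq> \<infinity>" by simp
  then have "AE \<omega> in M. (\<Sum>n. ennreal (Y n \<omega>)) \<noteq> \<infinity>"
    by (intro nn_integral_PInf_AE) measurable
  then show ?thesis
  proof eventually_elim
    case (elim \<omega>)
    then have "summable (\<lambda>n. Y n \<omega>)"
      using nonneg by (intro summable_suminf_not_top) auto
    then show ?case by (rule summable_LIMSEQ_zero)
  qed
qed

locale sd_system = prob_space M for M :: "'w measure" +
  fixes k l :: nat and X :: "nat \<Rightarrow> 'w \<Rightarrow> var list \<Rightarrow> complex"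
  assumes integrable_prod: "N \<ge> 1 \<Longrightarrow> integrable M (\<lambda>\<omega>. \<Prod>q\<in>#Q. X N \<omega> q)"
    and X_Nil: "N \<ge> 1 \<Longrightarrow> X N \<omega> [] = 1"
    and X_rotate: "X N \<omega> (u @ w) = X N \<omega> (w @ u)"
    and X_monochromatic: "N \<ge> 1 \<Longrightarrow> monochromatic w \<Longrightarrow> \<exists>c. AE \<omega> in M. X N \<omega> w = c"
    and X_marked_twice: "N \<ge> 1 \<Longrightarrow>
      X N \<omega> (Inl k # u @ Inl k # w) = of_nat N * (X N \<omega> (Inl k # u) * X N \<omega> (Inl k # w))"
    and X_schwinger_dyson: "N \<ge> 1 \<Longrightarrow>
      lib_deriv moving (\<lambda>p s. expectation (\<lambda>\<omega>. \<Prod>q\<in>#add_mset p (add_mset s Q). X N \<omega> q)) P +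
      (\<Sum>q\<in>#Q. lib_deriv moving (\<lambda>p s. expectation (\<lambda>\<omega>. \<Prod>r\<in>#add_mset (p @ P @ s) (Q - {#q#}). X N \<omega> r)) q)
        / (of_nat N)\<^sup>2 = 0"
    and monochromatic_convergent: "monochromatic w \<Longrightarrow> admissible k l w \<Longrightarrow>
      convergent (\<lambda>N. expectation (\<lambda>\<omega>. X N \<omega> w))"
begin

abbreviation mark :: var where "mark \<equiv> Inl k"

abbreviation adm :: "var list \<Rightarrow> bool" where "adm \<equiv> admissible k l"

definition mean :: "var list \<Rightarrow> nat \<Rightarrow> complex" where
  "mean w N = expectation (\<lambda>\<omega>. X N \<omega> w)"

definition cmoment :: "var list multiset \<Rightarrow> var list multiset \<Rightarrow> nat \<Rightarrow> complex" where
  "cmoment S Q N = expectation (\<lambda>\<omega>. (\<Prod>w\<in>#S. X N \<omega> w - mean w N) * (\<Prod>w\<in>#Q. X N \<omega> w))"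

lemma integrable_cmoment:
  assumes "N \<ge> 1"
  shows "integrable M (\<lambda>\<omega>. (\<Prod>w\<in>#S. X N \<omega> w - mean w N) * (\<Prod>w\<in>#Q. X N \<omega> w))"
proof (induction S arbitrary: Q)
  case empty
  then show ?case using integrable_prod[OF assms] by simp
next
  case (add w S)
  let ?S = "\<lambda>\<omega>. \<Prod>w\<in>#S. X N \<omega> w - mean w N" and ?Q = "\<lambda>\<omega>. \<Prod>w\<in>#Q. X N \<omega> w"
  have "integrable M (\<lambda>\<omega>. ?S \<omega> * (X N \<omega> w * ?Q \<omega>) - mean w N * (?S \<omega> * ?Q \<omega>))"
    using add[of "add_mset w Q"] add[of Q]
    by (intro Bochner_Integration.integrable_diff integrable_mult_right) simp_all
  then show ?case by (simp add: algebra_simps)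
qed

lemma cmoment_add_centered:
  assumes "N \<ge> 1"
  shows "cmoment (add_mset w S) Q N = cmoment S (add_mset w Q) N - mean w N * cmoment S Q N"
proof -
  let ?S = "\<lambda>\<omega>. \<Prod>w\<in>#S. X N \<omega> w - mean w N" and ?Q = "\<lambda>\<omega>. \<Prod>w\<in>#Q. X N \<omega> w"
  have "cmoment (add_mset w S) Q N = expectation (\<lambda>\<omega>. ?S \<omega> * (X N \<omega> w * ?Q \<omega>) - mean w N * (?S \<omega> * ?Q \<omega>))"
    unfolding cmoment_def by (simp add: algebra_simps)
  then show ?thesis
    unfolding cmoment_def
    using integrable_cmoment[OF assms, of S "add_mset w Q"] integrable_cmoment[OF assms, of S Q] by simp
qed

lemma cmoment_empty [simp]: "cmoment {#} {#} = (\<lambda>_. 1)"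
  by (simp add: cmoment_def prob_space fun_eq_iff)

lemma cmoment_single [simp]: "cmoment {#} {#w#} N = mean w N"
  by (simp add: cmoment_def mean_def)

lemma cmoment_Nil: "N \<ge> 1 \<Longrightarrow> cmoment S (add_mset [] Q) N = cmoment S Q N"
  by (simp add: cmoment_def X_Nil)

lemma X_rotate_n: "X N \<omega> (rotate n w) = X N \<omega> w"
  unfolding rotate_drop_take by (subst X_rotate) simp

lemma mean_rotate: "mean (rotate n w) N = mean w N"
  by (simp add: mean_def X_rotate_n)

lemma cmoment_rotate: "cmoment S (add_mset (rotate n w) Q) N = cmoment S (add_mset w Q) N"
  and cmoment_rotate_centered: "cmoment (add_mset (rotate n w) S) Q N = cmoment (add_mset w S) Q N"
  by (simp_all add: cmoment_def X_rotate_n mean_rotate)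

lemma cmoment_monochromatic:
  assumes "N \<ge> 1" "monochromatic w"
  shows "cmoment S (add_mset w Q) N = mean w N * cmoment S Q N"
proof -
  obtain c where c: "AE \<omega> in M. X N \<omega> w = c" using X_monochromatic[OF assms] by blast
  let ?S = "\<lambda>\<omega>. \<Prod>w\<in>#S. X N \<omega> w - mean w N" and ?Q = "\<lambda>\<omega>. \<Prod>w\<in>#Q. X N \<omega> w"
  have "integrable M (\<lambda>\<omega>. X N \<omega> w)" using integrable_prod[OF assms(1), of "{#w#}"] by simp
  then have "mean w N = expectation (\<lambda>\<omega>. c)"
    unfolding mean_def using c by (intro integral_cong_AE) auto
  moreover have "cmoment S (add_mset w Q) N = expectation (\<lambda>\<omega>. c * (?S \<omega> * ?Q \<omega>))"
    unfolding cmoment_def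
  proof (rule integral_cong_AE)
    show "AE \<omega> in M. ?S \<omega> * (\<Prod>q\<in>#add_mset w Q. X N \<omega> q) = c * (?S \<omega> * ?Q \<omega>)"
      using c by eventually_elim (simp add: mult_ac)
    show "(\<lambda>\<omega>. ?S \<omega> * (\<Prod>q\<in>#add_mset w Q. X N \<omega> q)) \<in> borel_measurable M"
      by (rule borel_measurable_integrable[OF integrable_cmoment[OF assms(1)]])
    show "(\<lambda>\<omega>. c * (?S \<omega> * ?Q \<omega>)) \<in> borel_measurable M"
      by (intro borel_measurable_times[OF borel_measurable_const]
          borel_measurable_integrable[OF integrable_cmoment[OF assms(1)]])
  qed
  ultimately show ?thesis by (simp add: cmoment_def prob_space)
qed

lemma cmoment_centered_monochromatic: "N \<ge> 1 \<Longrightarrow> monochromatic w \<Longrightarrow> cmoment (add_mset w S) Q N = 0"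
  by (simp add: cmoment_add_centered cmoment_monochromatic)

lemma cmoment_marked_twice:
  assumes "N \<ge> 1"
  shows "cmoment S (add_mset (mark # u @ mark # w) Q) N
    = of_nat N * cmoment S (add_mset (mark # u) (add_mset (mark # w) Q)) N"
proof -
  have "cmoment S (add_mset (mark # u @ mark # w) Q) N = expectation (\<lambda>\<omega>. of_nat N *
      ((\<Prod>w\<in>#S. X N \<omega> w - mean w N) * (\<Prod>q\<in>#add_mset (mark # u) (add_mset (mark # w) Q). X N \<omega> q)))"
    by (simp add: cmoment_def X_marked_twice[OF assms] mult_ac)
  then show ?thesis by (simp add: cmoment_def)
qed

definition merging :: "var list multiset \<Rightarrow> var list multiset \<Rightarrow> var list \<Rightarrow> nat \<Rightarrow> complex" where
  "merging S Q P N =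
    (\<Sum>q\<in>#S. lib_deriv moving (\<lambda>p s. cmoment (S - {#q#}) (add_mset (p @ P @ s) Q) N) q) +
    (\<Sum>q\<in>#Q. lib_deriv moving (\<lambda>p s. cmoment S (add_mset (p @ P @ s) (Q - {#q#})) N) q)"

lemma merging_add_centered:
  assumes "N \<ge> 1"
  shows "merging (add_mset w S) Q P N = merging S (add_mset w Q) P N - mean w N * merging S Q P N"
proof -
  have diff: "(\<Sum>q\<in>#A. f q - c * g q) = (\<Sum>q\<in>#A. f q) - c * (\<Sum>q\<in>#A. g q)"
    for A and f g :: "var list \<Rightarrow> complex" and c
    by (induction A) (simp_all add: algebra_simps)
  have "(\<Sum>q\<in>#S. lib_deriv moving (\<lambda>p s. cmoment (add_mset w S - {#q#}) (add_mset (p @ P @ s) Q) N) q)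
      = (\<Sum>q\<in>#S. lib_deriv moving (\<lambda>p s. cmoment (S - {#q#}) (add_mset (p @ P @ s) (add_mset w Q)) N) q)
        - mean w N * (\<Sum>q\<in>#S. lib_deriv moving (\<lambda>p s. cmoment (S - {#q#}) (add_mset (p @ P @ s) Q) N) q)"
    unfolding diff[symmetric]
    by (intro arg_cong[of _ _ sum_mset] image_mset_cong)
      (simp add: cmoment_add_centered[OF assms] lib_deriv_diff lib_deriv_cmult add_mset_commute)
  moreover have "(\<Sum>q\<in>#Q. lib_deriv moving (\<lambda>p s. cmoment (add_mset w S) (add_mset (p @ P @ s) (Q - {#q#})) N) q)
      = (\<Sum>q\<in>#Q. lib_deriv moving (\<lambda>p s. cmoment S (add_mset (p @ P @ s) (add_mset w Q - {#q#})) N) q)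
        - mean w N * (\<Sum>q\<in>#Q. lib_deriv moving (\<lambda>p s. cmoment S (add_mset (p @ P @ s) (Q - {#q#})) N) q)"
    unfolding diff[symmetric]
    by (intro arg_cong[of _ _ sum_mset] image_mset_cong)
      (simp add: cmoment_add_centered[OF assms] lib_deriv_diff lib_deriv_cmult add_mset_commute)
  ultimately show ?thesis
    by (simp add: merging_def algebra_simps)
qed

lemma cmoment_schwinger_dyson:
  assumes "N \<ge> 1"
  shows "lib_deriv moving (\<lambda>p s. cmoment S (add_mset p (add_mset s Q)) N) P + merging S Q P N / (of_nat N)\<^sup>2 = 0"
proof (induction S arbitrary: Q)
  case empty
  show ?case
    using X_schwinger_dyson[OF assms, of Q P] by (simp add: cmoment_def merging_def)
next
  case (add w S)
  let ?lhs = "\<lambda>S Q. lib_deriv moving (\<lambda>p s. cmoment S (add_mset p (add_mset s Q)) N) P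
      + merging S Q P N / (of_nat N)\<^sup>2"
  have "?lhs (add_mset w S) Q = ?lhs S (add_mset w Q) - mean w N * ?lhs S Q"
    by (simp add: cmoment_add_centered[OF assms] merging_add_centered[OF assms] lib_deriv_diff lib_deriv_cmult
        add_mset_commute diff_divide_distrib right_diff_distrib distrib_left)
  then show ?case by (simp add: add)
qed

lemma cmoment_eq_splitting:
  assumes "N \<ge> 1"
  shows "cmoment S (add_mset P Q) N =
    inner_deriv moving (\<lambda>p s. cmoment S (add_mset p (add_mset s Q)) N) P - merging S Q P N / (of_nat N)\<^sup>2"
  using cmoment_schwinger_dyson[OF assms, of S Q P]
  by (simp add: inner_deriv_def cmoment_Nil[OF assms] add_eq_0_iff)

lemma mean_eq_splitting: "N \<ge> 1 \<Longrightarrow> mean P N = inner_deriv moving (\<lambda>p s. cmoment {#} {#p, s#} N) P"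
  using cmoment_eq_splitting[of N "{#}" P "{#}"] by (simp add: merging_def)

text \<open>A merged word that is marked twice factors with weight \<open>N\<close>, so merging always costs a factor \<open>1 / N\<close>.\<close>

lemma merged_word_bigo:
  assumes P: "adm P" and q: "adm q" "q \<noteq> []" and w: "mset w = mset P + mset q"
    and bound: "\<And>W. \<forall>w\<in>#W. adm w \<and> w \<noteq> [] \<Longrightarrow> (\<Sum>w\<in>#W. mset w) = mset P + mset q \<Longrightarrow> cmoment S (W + Q) \<in> O(g)"
  shows "(\<lambda>N. cmoment S (add_mset w Q) N / (of_nat N)\<^sup>2) \<in> O(\<lambda>N. g N / of_nat N)"
proof (cases "adm w")
  case True
  moreover have "w \<noteq> []" using q(2) w by auto
  ultimately have "cmoment S ({#w#} + Q) \<in> O(g)"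
    by (intro bound) (simp_all add: w)
  moreover have "(\<lambda>N. 1 / (of_nat N)\<^sup>2 :: complex) \<in> O(\<lambda>N. 1 / of_nat N)"
    using inverse_nat_power_bigo[of 1 2] by simp
  ultimately have "(\<lambda>N. cmoment S ({#w#} + Q) N * (1 / (of_nat N)\<^sup>2)) \<in> O(\<lambda>N. g N * (1 / of_nat N))"
    by (rule landau_o.big.mult)
  then show ?thesis by simp
next
  case False
  have letters_w: "set w \<subseteq> insert mark (Xvars k \<union> Yvars l)" and count_w: "count (mset w) mark \<le> 2"
    using P q(1) w by (auto simp: admissible_def simp flip: set_mset_mset)
  with False have "count (mset w) mark = 2" by (auto simp: admissible_def)
  then obtain n u v where rotation: "rotate n w = mark # u @ mark # v"
    and unmarked: "mark \<notin> set u" "mark \<notin> set v"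
    by (rule count_2_rotation)
  have mset_w: "mset w = mset (mark # u) + mset (mark # v)"
    using arg_cong[OF rotation, of mset] by simp
  have "set w = insert mark (set u \<union> set v)"
    using arg_cong[OF mset_w, of set_mset] by simp
  then have "cmoment S ({#mark # u, mark # v#} + Q) \<in> O(g)"
    using letters_w unmarked mset_w w by (intro bound) (auto simp: admissible_def count_eq_zero_iff)
  then have "(\<lambda>N. cmoment S ({#mark # u, mark # v#} + Q) N * (1 / of_nat N)) \<in> O(\<lambda>N. g N * (1 / of_nat N))"
    by (intro landau_o.big.mult) simp_all
  moreover have "cmoment S (add_mset w Q) N / (of_nat N)\<^sup>2
      = cmoment S ({#mark # u, mark # v#} + Q) N * (1 / of_nat N)"
    if "N \<ge> 1" for N
    using that cmoment_marked_twice[OF that, of S u v Q] unfolding rotation[symmetric] cmoment_rotate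
    by (simp add: power2_eq_square)
  ultimately show ?thesis
    using bigo_cong_ge_1[of "\<lambda>N. cmoment S (add_mset w Q) N / (of_nat N)\<^sup>2"] by simp
qed

lemma merging_bigo:
  assumes P: "adm P" and adm: "\<forall>q\<in>#S + Q. adm q"
    and centered: "\<And>q W. q \<in># S \<Longrightarrow> \<forall>w\<in>#W. adm w \<and> w \<noteq> [] \<Longrightarrow> (\<Sum>w\<in>#W. mset w) = mset P + mset q \<Longrightarrow>
      cmoment (S - {#q#}) (W + Q) \<in> O(g)"
    and plain: "\<And>q W. q \<in># Q \<Longrightarrow> \<forall>w\<in>#W. adm w \<and> w \<noteq> [] \<Longrightarrow> (\<Sum>w\<in>#W. mset w) = mset P + mset q \<Longrightarrow>
      cmoment S (W + (Q - {#q#})) \<in> O(g)"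
  shows "(\<lambda>N. merging S Q P N / (of_nat N)\<^sup>2) \<in> O(\<lambda>N. g N / of_nat N)"
proof -
  have merged: "(\<lambda>N. lib_deriv moving (\<lambda>p s. cmoment S' (add_mset (p @ P @ s) Q') N) q / (of_nat N)\<^sup>2)
      \<in> O(\<lambda>N. g N / of_nat N)"
    if "adm q" and bound: "\<And>W. \<forall>w\<in>#W. adm w \<and> w \<noteq> [] \<Longrightarrow> (\<Sum>w\<in>#W. mset w) = mset P + mset q \<Longrightarrow>
      cmoment S' (W + Q') \<in> O(g)"
    for S' Q' q
  proof (cases "q = []")
    case False
    have "(\<lambda>N. lib_deriv moving (\<lambda>p s. cmoment S' (add_mset (p @ P @ s) Q') N / (of_nat N)\<^sup>2) q)
        \<in> O(\<lambda>N. g N / of_nat N)"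
      by (intro lib_deriv_bigo merged_word_bigo[OF P \<open>adm q\<close> False] bound) auto
    then show ?thesis by (simp add: divide_inverse lib_deriv_multc)
  qed simp
  have "(\<lambda>N. (\<Sum>q\<in>#S. lib_deriv moving (\<lambda>p s. cmoment (S - {#q#}) (add_mset (p @ P @ s) Q) N) q / (of_nat N)\<^sup>2)
      + (\<Sum>q\<in>#Q. lib_deriv moving (\<lambda>p s. cmoment S (add_mset (p @ P @ s) (Q - {#q#})) N) q / (of_nat N)\<^sup>2))
      \<in> O(\<lambda>N. g N / of_nat N)"
    using adm by (intro sum_in_bigo bigo_sum_mset merged centered plain) auto
  then show ?thesis
    by (simp add: merging_def add_divide_distrib divide_inverse distrib_right sum_mset_distrib_right)
qed

definition word_msets :: "nat \<Rightarrow> var list multiset set" where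
  "word_msets L = {W. (\<forall>w\<in>#W. adm w \<and> w \<noteq> []) \<and> size (\<Sum>w\<in>#W. mset w) = L}"

lemma size_sum_mset_ge:
  "\<forall>w\<in>#W. w \<noteq> [] \<Longrightarrow> size W \<le> size (\<Sum>w\<in>#W. mset w)"
  by (induction W) (auto simp: Suc_le_eq add_strict_increasing)

lemma finite_word_msets: "finite (word_msets L)"
proof (rule finite_subset)
  let ?V = "insert mark (Xvars k \<union> Yvars l)"
  let ?words = "{w. set w \<subseteq> ?V \<and> length w \<le> L}"
  show "word_msets L \<subseteq> (\<Union>n\<le>L. multisets_of_size ?words n)"
  proof
    fix W assume W: "W \<in> word_msets L"
    have "length w \<le> L" if "w \<in># W" for w
      using W multi_member_split[OF that] by (auto simp: word_msets_def)
    then show "W \<in> (\<Union>n\<le>L. multisets_of_size ?words n)"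
      using W size_sum_mset_ge[of W] by (auto simp: word_msets_def multisets_of_size_def admissible_def)
  qed
  have "finite ?words"
    by (intro finite_lists_length_le) (simp add: Xvars_def Yvars_def)
  then show "finite (\<Union>n\<le>L. multisets_of_size ?words n)"
    by auto
qed

definition moment_sum :: "nat \<Rightarrow> nat \<Rightarrow> real" where
  "moment_sum L N = (\<Sum>W\<in>word_msets L. cmod (cmoment {#} W N))"

lemma moment_sum_nonneg: "moment_sum L N \<ge> 0"
  by (simp add: moment_sum_def sum_nonneg)

lemma cmoment_bigo_moment_sum:
  assumes "W \<in> word_msets L"
  shows "cmoment {#} W \<in> O(\<lambda>N. of_real (moment_sum L N))"
proof -
  have "cmod (cmoment {#} W N) \<le> cmod (of_real (moment_sum L N))" for N
    unfolding norm_of_real abs_of_nonneg[OF moment_sum_nonneg]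
    unfolding moment_sum_def by (intro member_le_sum assms finite_word_msets) simp
  then show ?thesis by (intro bigoI[of _ 1]) simp
qed

lemma word_msets_exchange:
  assumes "R + Q \<in> word_msets L" "\<forall>w\<in>#W. adm w \<and> w \<noteq> []" "(\<Sum>w\<in>#W. mset w) = (\<Sum>w\<in>#R. mset w)"
  shows "W + Q \<in> word_msets L"
  using assms(1,2) arg_cong[OF assms(3), of size] by (auto simp: word_msets_def)

lemma cmoment_monochromatic_bigo_1:
  assumes "\<forall>w\<in>#W. adm w \<and> monochromatic w"
  shows "cmoment {#} W \<in> O(\<lambda>_. 1)"
  using assms
proof (induction W)
  case (add w W)
  obtain L where "mean w \<longlonglongrightarrow> L"
    using monochromatic_convergent[of w] add.prems by (auto simp: convergent_def mean_def[abs_def])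
  then have "mean w \<in> O(\<lambda>_. 1)"
    by (intro bigoI_tendsto[of _ _ L]) simp_all
  then have product: "(\<lambda>N. mean w N * cmoment {#} W N) \<in> O(\<lambda>_. 1)"
    using add by (intro landau_o.big.mult_in_1) auto
  show ?case
    by (rule bigo_cong_ge_1[OF _ product]) (use add.prems in \<open>simp add: cmoment_monochromatic\<close>)
qed simp

lemma not_monochromatic_rotation:
  assumes "\<not> monochromatic w"
  obtains n where "w \<noteq> []" "moving (hd (rotate n w))" "\<not> moving (last (rotate n w))"
proof -
  have "w \<noteq> []" using assms by (auto simp: monochromatic_def)
  with assms show thesis
    using that rotation_starting_in_ending_outside[of w moving] by (auto simp: monochromatic_def)
qed

abbreviation moment_bound :: "nat \<Rightarrow> nat \<Rightarrow> complex" where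
  "moment_bound L \<equiv> \<lambda>N. of_real (1 + moment_sum L N / N)"

lemma moment_bound_absorbs:
  "(\<lambda>_. 1) \<in> O(moment_bound L)" "(\<lambda>N. of_real (moment_sum L N / N)) \<in> O(moment_bound L)"
proof -
  have "(\<lambda>_. 1) \<in> O(\<lambda>N. 1 + moment_sum L N / N)"
    using moment_sum_nonneg[of L] by (intro bigoI[of _ 1]) simp
  then show "(\<lambda>_. 1) \<in> O(moment_bound L)"
    using landau_o.big.of_real_iff[of "\<lambda>_. 1" sequentially "\<lambda>N. 1 + moment_sum L N / N"] by simp
  show "(\<lambda>N. of_real (moment_sum L N / N)) \<in> O(moment_bound L)"
    unfolding landau_o.big.of_real_iff using moment_sum_nonneg[of L] by (intro bigoI[of _ 1]) simp
qed

lemma merging_bigo_moment_bound: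
  assumes PQ: "{#P#} + Q \<in> word_msets L"
  shows "(\<lambda>N. merging {#} Q P N / (of_nat N)\<^sup>2) \<in> O(moment_bound L)"
proof -
  have adm: "adm P" "\<forall>q\<in>#Q. adm q" using PQ by (auto simp: word_msets_def)
  have "(\<lambda>N. merging {#} Q P N / (of_nat N)\<^sup>2) \<in> O(\<lambda>N. of_real (moment_sum L N) / of_nat N)"
  proof (rule merging_bigo[OF adm(1)])
    fix q W assume q: "q \<in># Q" and "\<forall>w\<in>#W. adm w \<and> w \<noteq> []" "(\<Sum>w\<in>#W. mset w) = mset P + mset q"
    then have "W + (Q - {#q#}) \<in> word_msets L"
      using PQ word_msets_exchange[of "{#P, q#}" "Q - {#q#}" L W] by simp
    then show "cmoment {#} (W + (Q - {#q#})) \<in> O(\<lambda>N. of_real (moment_sum L N))"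
      by (rule cmoment_bigo_moment_sum)
  qed (use adm in auto)
  then have "(\<lambda>N. merging {#} Q P N / (of_nat N)\<^sup>2) \<in> O(\<lambda>N. of_real (moment_sum L N / N))"
    by simp
  then show ?thesis
    using moment_bound_absorbs(2) by (rule landau_o.big_trans)
qed

text \<open>Splitting increases the number of words at constant total length, so it can be iterated only finitely often, while
  merging costs a factor \<open>1 / N\<close>.\<close>

lemma cmoment_bigo_moment_bound:
  assumes "W \<in> word_msets L"
  shows "cmoment {#} W \<in> O(moment_bound L)"
  using assms
proof (induction "L - size W" arbitrary: W rule: less_induct)
  case less
  show ?case
  proof (cases "\<forall>w\<in>#W. monochromatic w")
    case True
    then have "cmoment {#} W \<in> O(\<lambda>_. 1)"
      using less.prems by (intro cmoment_monochromatic_bigo_1) (auto simp: word_msets_def)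
    then show ?thesis using moment_bound_absorbs(1) by (rule landau_o.big_trans)
  next
    case False
    then obtain P0 Q where W_eq: "W = add_mset P0 Q" and "\<not> monochromatic P0"
      by (metis insert_DiffM)
    then obtain n where n: "P0 \<noteq> []" "moving (hd (rotate n P0))" "\<not> moving (last (rotate n P0))"
      using not_monochromatic_rotation by blast
    define P where "P = rotate n P0"
    have PQ: "{#P#} + Q \<in> word_msets L"
      by (rule word_msets_exchange[of "{#P0#}"]) (use less.prems n(1) in \<open>auto simp: W_eq P_def word_msets_def\<close>)
    have "(\<lambda>N. inner_deriv moving (\<lambda>p s. cmoment {#} (add_mset p (add_mset s Q)) N) P) \<in> O(moment_bound L)"
    proof (rule inner_deriv_bigo)
      fix p s assume ps: "p \<noteq> []" "s \<noteq> []" "p @ s = P"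
      moreover have "adm (p @ s)" using PQ ps(3) by (simp add: word_msets_def)
      note admissible_appendD[OF this]
      ultimately have split: "{#p, s#} + Q \<in> word_msets L"
        using word_msets_exchange[OF PQ, of "{#p, s#}"] by auto
      then have "size ({#p, s#} + Q) \<le> L"
        using size_sum_mset_ge[of "{#p, s#} + Q"] by (auto simp: word_msets_def)
      then show "cmoment {#} (add_mset p (add_mset s Q)) \<in> O(moment_bound L)"
        using less.hyps[OF _ split] by (simp add: W_eq)
    qed (use n in \<open>simp_all add: P_def\<close>)
    from bigo_cong_ge_1[OF cmoment_eq_splitting sum_in_bigo(2)[OF this merging_bigo_moment_bound[OF PQ]]]
    show ?thesis
      by (simp add: W_eq P_def cmoment_rotate[abs_def])
  qed
qed

lemma moment_sum_bigo_1: "moment_sum L \<in> O(\<lambda>_. 1)"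
proof (rule bigo_absorb_divide_nat)
  have "(\<lambda>N. cmod (cmoment {#} W N)) \<in> O(\<lambda>N. 1 + moment_sum L N / N)" if "W \<in> word_msets L" for W
    using landau_o.big.norm_iff[THEN iffD2, OF cmoment_bigo_moment_bound[OF that]]
    by (simp only: norm_of_real landau_o.big.abs)
  then show "moment_sum L \<in> O(\<lambda>N. 1 + moment_sum L N / N)"
    unfolding moment_sum_def[abs_def] by (intro big_sum_in_bigo)
qed

lemma cmoment_bounded:
  assumes "\<forall>q\<in>#Q. adm q"
  shows "cmoment {#} Q \<in> O(\<lambda>_. 1)"
proof -
  define W where "W = {#q \<in># Q. q \<noteq> []#}"
  have "cmoment {#} Q N = cmoment {#} W N" if "N \<ge> 1" for N
  proof -
    have "(\<Prod>q\<in>#Q. X N \<omega> q) = (\<Prod>q\<in>#W. X N \<omega> q)" for \<omega>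
      unfolding W_def by (induction Q) (simp_all add: X_Nil[OF that])
    then show ?thesis by (simp add: cmoment_def)
  qed
  moreover have "(\<lambda>N. complex_of_real (moment_sum L N)) \<in> O(\<lambda>_. of_real 1)" for L
    by (simp only: landau_o.big.of_real_iff moment_sum_bigo_1)
  moreover have "W \<in> word_msets (size (\<Sum>w\<in>#W. mset w))"
    using assms by (auto simp: word_msets_def W_def)
  ultimately show ?thesis
    using bigo_cong_ge_1 landau_o.big_trans[OF cmoment_bigo_moment_sum] by (metis of_real_1)
qed

definition decay :: "nat \<Rightarrow> nat \<Rightarrow> complex" where
  "decay n N = 1 / of_nat N ^ (Suc n div 2)"

lemma inverse_nat_power_bigo_decay:
  assumes "f \<in> O(\<lambda>N. 1 / of_nat N ^ a)" "Suc n div 2 \<le> a"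
  shows "f \<in> O(decay n)"
  unfolding decay_def[abs_def] using landau_o.big_trans[OF assms(1) inverse_nat_power_bigo[OF assms(2)]] .

lemma decay_mono: "f \<in> O(decay m) \<Longrightarrow> n \<le> m \<Longrightarrow> f \<in> O(decay n)"
  by (rule inverse_nat_power_bigo_decay[of _ "Suc m div 2"]) (simp_all add: decay_def[abs_def] div_le_mono)

lemma decay_mult:
  assumes "f \<in> O(decay m)" "g \<in> O(decay n)"
  shows "(\<lambda>N. f N * g N) \<in> O(decay (m + n))"
proof (rule inverse_nat_power_bigo_decay)
  show "(\<lambda>N. f N * g N) \<in> O(\<lambda>N. 1 / of_nat N ^ (Suc m div 2 + Suc n div 2))"
    using landau_o.big.mult[OF assms] by (simp add: decay_def power_add)
qed linarith

lemma decay_divide: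
  assumes "f \<in> O(\<lambda>N. decay (n - 1) N / of_nat N)"
  shows "f \<in> O(decay (Suc n))"
proof (rule inverse_nat_power_bigo_decay)
  show "f \<in> O(\<lambda>N. 1 / of_nat N ^ (Suc (n - 1) div 2 + 1))"
    using assms by (simp add: decay_def mult.commute)
qed linarith

lemma cmoment_pair_deviation:
  assumes "N \<ge> 1"
  shows "cmoment S (add_mset p (add_mset s Q)) N - cmoment {#} {#p, s#} N * cmoment S Q N =
    cmoment (add_mset p S) (add_mset s Q) N + mean p N * cmoment (add_mset s S) Q N
      - cmoment {#p#} {#s#} N * cmoment S Q N"
  by (simp add: cmoment_add_centered[OF assms] algebra_simps)

lemma cmoment_centered_splitting:
  assumes "N \<ge> 1"
  shows "cmoment (add_mset P S) Q N =
    inner_deriv moving (\<lambda>p s. cmoment S (add_mset p (add_mset s Q)) N - cmoment {#} {#p, s#} N * cmoment S Q N) P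
      - merging S Q P N / (of_nat N)\<^sup>2"
  by (simp add: cmoment_add_centered[OF assms] cmoment_eq_splitting[OF assms, of S P Q]
      mean_eq_splitting[OF assms, of P] inner_deriv_def lib_deriv_diff lib_deriv_multc left_diff_distrib)

text \<open>A merging removes at most one centered factor and costs \<open>1 / N\<close>, which amounts to \<open>1 / sqrt N\<close> for each of the
  two centered traces it involves.\<close>

lemma merging_bigo_decay:
  assumes P: "adm P" and adm: "\<forall>q\<in>#S + Q. adm q"
    and fewer: "\<And>S' Q'. size S' \<le> size S \<Longrightarrow> \<forall>q\<in>#S' + Q'. adm q \<Longrightarrow> cmoment S' Q' \<in> O(decay (size S'))"
  shows "(\<lambda>N. merging S Q P N / (of_nat N)\<^sup>2) \<in> O(decay (Suc (size S)))"
proof (intro decay_divide merging_bigo P adm)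
  fix q W assume q: "q \<in># S" and W: "\<forall>w\<in>#W. adm w \<and> w \<noteq> []"
  have "cmoment (S - {#q#}) (W + Q) \<in> O(decay (size (S - {#q#})))"
    using adm W by (intro fewer) (auto simp: size_Diff_singleton[OF q] dest: in_diffD)
  then show "cmoment (S - {#q#}) (W + Q) \<in> O(decay (size S - 1))"
    by (simp add: size_Diff_singleton[OF q])
next
  fix q W assume W: "\<forall>w\<in>#W. adm w \<and> w \<noteq> []"
  have "\<forall>r\<in>#Q - {#q#}. adm r" using adm by (auto dest: in_diffD)
  then have "cmoment S (W + (Q - {#q#})) \<in> O(decay (size S))"
    using adm W by (intro fewer) auto
  then show "cmoment S (W + (Q - {#q#})) \<in> O(decay (size S - 1))"
    by (rule decay_mono) simp
qed

lemma cmoment_pair_deviation_bigo: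
  assumes "adm p" "cmoment (add_mset p S) (add_mset s Q) \<in> O(decay (Suc n))"
    "cmoment (add_mset s S) Q \<in> O(decay (Suc n))" "cmoment {#p#} {#s#} \<in> O(decay 1)" "cmoment S Q \<in> O(decay n)"
  shows "(\<lambda>N. cmoment S (add_mset p (add_mset s Q)) N - cmoment {#} {#p, s#} N * cmoment S Q N) \<in> O(decay (Suc n))"
proof (rule bigo_cong_ge_1[OF cmoment_pair_deviation])
  have "mean p \<in> O(decay 0)"
    using cmoment_bounded[of "{#p#}"] assms(1) by (simp add: decay_def[abs_def] cmoment_single[abs_def])
  from decay_mult[OF this assms(3)] decay_mult[OF assms(4,5)] assms(2)
  show "(\<lambda>N. cmoment (add_mset p S) (add_mset s Q) N + mean p N * cmoment (add_mset s S) Q N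
      - cmoment {#p#} {#s#} N * cmoment S Q N) \<in> O(decay (Suc n))"
    by (simp add: sum_in_bigo)
qed

lemma cmoment_add_centered_bigo:
  assumes fewer: "\<And>S' Q'. size S' \<le> n \<Longrightarrow> \<forall>q\<in>#S' + Q'. adm q \<Longrightarrow> cmoment S' Q' \<in> O(decay (size S'))"
    and "size S = n" "adm P" "\<forall>q\<in>#S + Q. adm q"
  shows "cmoment (add_mset P S) Q \<in> O(decay (Suc n))"
  using assms(2-)
proof (induction "length P" arbitrary: P S Q rule: less_induct)
  case less
  show ?case
  proof (cases "monochromatic P")
    case True
    then show ?thesis
      by (intro bigo_cong_ge_1[OF cmoment_centered_monochromatic]) simp_all
  next
    case False
    then obtain m where m: "P \<noteq> []" "moving (hd (rotate m P))" "\<not> moving (last (rotate m P))"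
      using not_monochromatic_rotation by blast
    define P' where "P' = rotate m P"
    have P': "adm P'" "length P' = length P" using less.prems by (simp_all add: P'_def)
    have "(\<lambda>N. inner_deriv moving
          (\<lambda>p s. cmoment S (add_mset p (add_mset s Q)) N - cmoment {#} {#p, s#} N * cmoment S Q N) P')
        \<in> O(decay (Suc n))"
    proof (intro inner_deriv_bigo cmoment_pair_deviation_bigo)
      fix p s assume ps: "p \<noteq> []" "s \<noteq> []" "p @ s = P'"
      then show adm_p: "adm p" using P'(1) by (auto dest: admissible_appendD)
      have adm_s: "adm s" using P'(1) ps(3) by (auto dest: admissible_appendD)
      have "length P = length p + length s" using P'(2) by (simp flip: ps(3))
      then have "length p < length P" "length s < length P" using ps(1,2) by simp_all
      note shorter = less.hyps[OF this(1)] less.hyps[OF this(2)]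
      show "cmoment (add_mset p S) (add_mset s Q) \<in> O(decay (Suc n))" "cmoment (add_mset s S) Q \<in> O(decay (Suc n))"
        using shorter less.prems adm_p adm_s by auto
      show "cmoment {#p#} {#s#} \<in> O(decay 1)"
        using shorter(1)[of "{#}" "{#s#}"] fewer[of "{#p#}" "{#s#}"] adm_p adm_s by (cases n) auto
      show "cmoment S Q \<in> O(decay n)"
        using fewer[of S Q] less.prems by simp
    qed (use m in \<open>simp_all add: P'_def\<close>)
    moreover have "(\<lambda>N. merging S Q P' N / (of_nat N)\<^sup>2) \<in> O(decay (Suc n))"
      using merging_bigo_decay[OF P'(1), of S Q] less.prems fewer by simp
    ultimately have "cmoment (add_mset P' S) Q \<in> O(decay (Suc n))"
      by (intro bigo_cong_ge_1[OF cmoment_centered_splitting] sum_in_bigo(2))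
    then show ?thesis
      by (simp add: P'_def cmoment_rotate_centered[abs_def])
  qed
qed

theorem cmoment_centered_bigo:
  assumes "\<forall>q\<in>#S + Q. adm q"
  shows "cmoment S Q \<in> O(decay (size S))"
  using assms
proof (induction "size S" arbitrary: S Q rule: less_induct)
  case less
  show ?case
  proof (cases S)
    case empty
    then show ?thesis using cmoment_bounded less.prems by (simp add: decay_def[abs_def])
  next
    case (add P S')
    then have "cmoment (add_mset P S') Q \<in> O(decay (Suc (size S')))"
      using less by (intro cmoment_add_centered_bigo) auto
    then show ?thesis by (simp add: add)
  qed
qed

lemma cmoment_pair_tendsto_0:
  assumes "adm p" "adm s"
  shows "cmoment {#p#} {#s#} \<longlonglongrightarrow> 0"
proof -
  have "cmoment {#p#} {#s#} \<in> O(decay 1)"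
    using cmoment_centered_bigo[of "{#p#}" "{#s#}"] assms by simp
  moreover have "decay 1 \<in> o(\<lambda>_. 1)"
    using lim_1_over_n[where 'a = complex] by (intro smalloI_tendsto) (simp_all add: decay_def)
  ultimately have "cmoment {#p#} {#s#} \<in> o(\<lambda>_. 1)"
    by (rule landau_o.big_small_trans)
  then show ?thesis
    using smalloD_tendsto by fastforce
qed

lemma cmoment_pair_eq: "N \<ge> 1 \<Longrightarrow> cmoment {#} {#p, s#} N = cmoment {#p#} {#s#} N + mean p N * mean s N"
  by (simp add: cmoment_add_centered)

lemma cmoment_pair_tendsto:
  assumes "adm p" "adm s" "mean p \<longlonglongrightarrow> a" "mean s \<longlonglongrightarrow> b"
  shows "cmoment {#} {#p, s#} \<longlonglongrightarrow> a * b"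
proof -
  have "(\<lambda>N. cmoment {#p#} {#s#} N + mean p N * mean s N) \<longlonglongrightarrow> 0 + a * b"
    by (intro tendsto_add tendsto_mult cmoment_pair_tendsto_0 assms)
  from tendsto_cong_ge_1[OF cmoment_pair_eq this] show ?thesis by simp
qed

lemma mean_convergent: "adm w \<Longrightarrow> convergent (mean w)"
proof (induction "length w" arbitrary: w rule: less_induct)
  case less
  show ?case
  proof (cases "monochromatic w")
    case True
    then show ?thesis
      using monochromatic_convergent less.prems by (simp add: mean_def[abs_def])
  next
    case False
    then obtain n where n: "w \<noteq> []" "moving (hd (rotate n w))" "\<not> moving (last (rotate n w))"
      using not_monochromatic_rotation by blast
    define w' where "w' = rotate n w"
    have w': "adm w'" "length w' = length w" using less.prems by (simp_all add: w'_def)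
    have "convergent (\<lambda>N. inner_deriv moving (\<lambda>p s. cmoment {#} {#p, s#} N) w')"
    proof (rule inner_deriv_closed)
      fix p s assume ps: "p \<noteq> []" "s \<noteq> []" "p @ s = w'"
      then have adm: "adm p" "adm s" using w'(1) by (auto dest: admissible_appendD)
      have "length w = length p + length s" using w'(2) by (simp flip: ps(3))
      then have "convergent (mean p)" "convergent (mean s)"
        using less.hyps[of p] less.hyps[of s] ps adm by simp_all
      then show "convergent (cmoment {#} {#p, s#})"
        unfolding convergent_def using cmoment_pair_tendsto[OF adm] by blast
    qed (use n in \<open>auto simp: w'_def convergent_const intro: convergent_diff\<close>)
    then obtain L where "(\<lambda>N. inner_deriv moving (\<lambda>p s. cmoment {#} {#p, s#} N) w') \<longlonglongrightarrow> L"
      by (auto simp: convergent_def)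
    from tendsto_cong_ge_1[OF mean_eq_splitting this] show ?thesis
      by (auto simp: convergent_def w'_def mean_rotate[abs_def])
  qed
qed

definition limit :: "var list \<Rightarrow> complex" where
  "limit w = lim (mean w)"

lemma mean_tendsto: "adm w \<Longrightarrow> mean w \<longlonglongrightarrow> limit w"
  using mean_convergent by (simp add: limit_def convergent_LIMSEQ_iff)

lemma limit_Nil: "limit [] = 1"
proof -
  have "mean [] \<longlonglongrightarrow> 1"
    by (rule tendsto_cong_ge_1[of _ "\<lambda>_. 1"]) (simp_all add: mean_def X_Nil prob_space)
  then show ?thesis by (simp add: limit_def limI)
qed

lemma limit_append_commute: "limit (u @ w) = limit (w @ u)"
  by (simp add: limit_def mean_def[abs_def] X_rotate[of _ _ u])

lemma limit_schwinger_dyson: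
  assumes "adm w"
  shows "lib_deriv moving (\<lambda>p s. limit p * limit s) w = 0"
proof (rule LIMSEQ_unique)
  show "(\<lambda>N. lib_deriv moving (\<lambda>p s. cmoment {#} {#p, s#} N) w) \<longlonglongrightarrow> lib_deriv moving (\<lambda>p s. limit p * limit s) w"
  proof (rule lib_deriv_tendsto)
    fix p s assume "p @ s = w"
    then have "adm p" "adm s" using assms by (auto dest: admissible_appendD)
    then show "cmoment {#} {#p, s#} \<longlonglongrightarrow> limit p * limit s"
      by (intro cmoment_pair_tendsto mean_tendsto)
  qed
  show "(\<lambda>N. lib_deriv moving (\<lambda>p s. cmoment {#} {#p, s#} N) w) \<longlonglongrightarrow> 0"
    by (rule tendsto_cong_ge_1[of _ "\<lambda>_. 0"])
      (use cmoment_schwinger_dyson[of _ "{#}" "{#}" w] in \<open>simp_all add: merging_def\<close>)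
qed

context
  fixes w assumes cnj_X: "\<And>N \<omega>. cnj (X N \<omega> w) = X N \<omega> (rev w)" and adm_w: "adm w"
begin

lemma fourth_power_deviation:
  "complex_of_real (cmod (X N \<omega> w - mean w N) ^ 4) = (\<Prod>u\<in>#{#w, w, rev w, rev w#}. X N \<omega> u - mean u N)"
proof -
  let ?z = "X N \<omega> w - mean w N"
  have "complex_of_real (cmod ?z ^ 4) = (complex_of_real ((cmod ?z)\<^sup>2))\<^sup>2"
    by (simp flip: power_mult)
  also have "\<dots> = (?z * cnj ?z)\<^sup>2" by (simp add: complex_norm_square del: of_real_power)
  also have "cnj ?z = X N \<omega> (rev w) - mean (rev w) N" by (simp add: mean_def flip: cnj_X)
  finally show ?thesis by (simp add: power2_eq_square mult_ac)
qed

lemma integrable_fourth_power_deviation: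
  assumes "N \<ge> 1"
  shows "integrable M (\<lambda>\<omega>. cmod (X N \<omega> w - mean w N) ^ 4)"
proof -
  have "integrable M (\<lambda>\<omega>. complex_of_real (cmod (X N \<omega> w - mean w N) ^ 4))"
    unfolding fourth_power_deviation using integrable_cmoment[OF assms, of "{#w, w, rev w, rev w#}" "{#}"] by simp
  then show ?thesis by (simp only: complex_of_real_integrable_eq)
qed

lemma summable_fourth_power_deviation:
  "summable (\<lambda>N. expectation (\<lambda>\<omega>. cmod (X N \<omega> w - mean w N) ^ 4))"
proof (rule summable_comparison_test_bigo)
  let ?S = "{#w, w, rev w, rev w#}"
  have "complex_of_real (expectation (\<lambda>\<omega>. cmod (X N \<omega> w - mean w N) ^ 4)) = cmoment ?S {#} N" for N
    unfolding integral_complex_of_real[symmetric] fourth_power_deviation cmoment_def by simp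
  moreover have "cmoment ?S {#} \<in> O(decay 4)"
    using cmoment_centered_bigo[of ?S "{#}"] adm_w
    by (simp add: eval_nat_numeral)
  ultimately have "(\<lambda>N. complex_of_real (expectation (\<lambda>\<omega>. cmod (X N \<omega> w - mean w N) ^ 4)))
      \<in> O(\<lambda>N. of_real (1 / real N ^ 2))"
    by (simp add: decay_def[abs_def])
  then show "(\<lambda>N. expectation (\<lambda>\<omega>. cmod (X N \<omega> w - mean w N) ^ 4)) \<in> O(\<lambda>N. 1 / real N ^ 2)"
    by (simp only: landau_o.big.of_real_iff)
  show "summable (\<lambda>N. norm (1 / real N ^ 2))"
    using inverse_power_summable[of 2, where 'a = real] by (simp add: divide_inverse)
qed

lemma AE_tendsto_limit: "AE \<omega> in M. (\<lambda>N. X N \<omega> w) \<longlonglongrightarrow> limit w"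
proof -
  have "AE \<omega> in M. (\<lambda>n. cmod (X (Suc n) \<omega> w - mean w (Suc n)) ^ 4) \<longlonglongrightarrow> 0"
    using summable_fourth_power_deviation
    by (intro AE_tendsto_0_of_summable_integral integrable_fourth_power_deviation)
      (simp_all add: summable_Suc_iff[of "\<lambda>N. expectation (\<lambda>\<omega>. cmod (X N \<omega> w - mean w N) ^ 4)"])
  then show ?thesis
  proof eventually_elim
    case (elim \<omega>)
    then have "(\<lambda>N. cmod (X N \<omega> w - mean w N) ^ 4) \<longlonglongrightarrow> 0" by (rule LIMSEQ_imp_Suc)
    then have "(\<lambda>N. root 4 (cmod (X N \<omega> w - mean w N) ^ 4)) \<longlonglongrightarrow> root 4 0" by (rule tendsto_real_root)
    then have "(\<lambda>N. cmod (X N \<omega> w - mean w N)) \<longlonglongrightarrow> 0"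
      by (simp add: real_root_power_cancel)
    then have "(\<lambda>N. X N \<omega> w - mean w N) \<longlonglongrightarrow> 0" by (rule tendsto_norm_zero_cancel)
    from tendsto_add[OF this mean_tendsto[OF adm_w]] show ?case by simp
  qed
qed

end

end

subsection \<open>Noncommutative polynomials\<close>

definition polys_on :: "var list set \<Rightarrow> ncpoly set" where
  "polys_on W = {p. finite {w. p w \<noteq> 0} \<and> {w. p w \<noteq> 0} \<subseteq> W}"

definition lin_ext :: "(var list \<Rightarrow> complex) \<Rightarrow> ncpoly \<Rightarrow> complex" where
  "lin_ext f p = (\<Sum>w\<in>{w. p w \<noteq> 0}. p w * f w)"

lemma ncpolys_eq_polys_on: "ncpolys V = polys_on (lists V)"
  by (auto simp: ncpolys_def polys_on_def)

lemma polys_on_mono: "p \<in> polys_on W \<Longrightarrow> W \<subseteq> W' \<Longrightarrow> p \<in> polys_on W'"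
  by (auto simp: polys_on_def)

lemma polys_on_UNIV: "p \<in> polys_on W \<Longrightarrow> p \<in> polys_on UNIV"
  by (rule polys_on_mono) simp_all

lemma polys_on_nonzeroD: "p \<in> polys_on W \<Longrightarrow> p w \<noteq> 0 \<Longrightarrow> w \<in> W"
  by (auto simp: polys_on_def)

lemma lin_ext_superset: "finite S \<Longrightarrow> {w. p w \<noteq> 0} \<subseteq> S \<Longrightarrow> lin_ext f p = (\<Sum>w\<in>S. p w * f w)"
  unfolding lin_ext_def by (intro sum.mono_neutral_left) auto

lemma lin_ext_cong: "p \<in> polys_on W \<Longrightarrow> (\<And>w. w \<in> W \<Longrightarrow> f w = g w) \<Longrightarrow> lin_ext f p = lin_ext g p"
  unfolding lin_ext_def by (intro sum.cong) (auto dest: polys_on_nonzeroD)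

lemma lin_ext_zero [simp]: "lin_ext (\<lambda>w. 0) p = 0"
  by (simp add: lin_ext_def)

lemma lin_ext_add: "lin_ext (\<lambda>w. f w + g w) p = lin_ext f p + lin_ext g p"
  by (simp add: lin_ext_def sum.distrib distrib_left)

lemma lin_ext_diff: "lin_ext (\<lambda>w. f w - g w) p = lin_ext f p - lin_ext g p"
  by (simp add: lin_ext_def sum_subtractf right_diff_distrib)

lemma lin_ext_cmult: "lin_ext (\<lambda>w. c * f w) p = c * lin_ext f p"
  by (simp add: lin_ext_def sum_distrib_left mult.left_commute)

lemma lin_ext_multc: "lin_ext (\<lambda>w. f w * c) p = lin_ext f p * c"
  by (simp add: lin_ext_def sum_distrib_right mult.assoc)

lemma lin_ext_swap: "lin_ext (\<lambda>u. lin_ext (\<lambda>w. f u w) q) p = lin_ext (\<lambda>w. lin_ext (\<lambda>u. f u w) p) q"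
  unfolding lin_ext_def sum_distrib_left by (subst sum.swap) (simp add: mult_ac)

lemma lin_ext_lib_deriv:
  "lin_ext (\<lambda>u. lib_deriv D (F u) w) p = lib_deriv D (\<lambda>x y. lin_ext (\<lambda>u. F u x y) p) w"
  by (simp add: lin_ext_def lib_deriv_sum lib_deriv_cmult)

lemma lin_ext_tendsto:
  "p \<in> polys_on W \<Longrightarrow> (\<And>w. w \<in> W \<Longrightarrow> ((\<lambda>n. f n w) \<longlongrightarrow> L w) F) \<Longrightarrow> ((\<lambda>n. lin_ext (f n) p) \<longlongrightarrow> lin_ext L p) F"
  unfolding lin_ext_def by (intro tendsto_sum tendsto_mult_left) (auto dest: polys_on_nonzeroD)

lemma polys_on_lincomb:
  assumes "p \<in> polys_on W" "q \<in> polys_on W"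
  shows "(\<lambda>w. p w + c * q w) \<in> polys_on W"
proof -
  have "{w. p w + c * q w \<noteq> 0} \<subseteq> {w. p w \<noteq> 0} \<union> {w. q w \<noteq> 0}" by auto
  then show ?thesis
    using assms unfolding polys_on_def by (auto intro: finite_subset)
qed

lemma lin_ext_lincomb:
  assumes "p \<in> polys_on UNIV" "q \<in> polys_on UNIV"
  shows "lin_ext f (\<lambda>w. p w + c * q w) = lin_ext f p + c * lin_ext f q"
proof -
  let ?S = "{w. p w \<noteq> 0} \<union> {w. q w \<noteq> 0}"
  have "finite ?S" using assms by (simp add: polys_on_def)
  then have "lin_ext f (\<lambda>w. p w + c * q w) = (\<Sum>w\<in>?S. (p w + c * q w) * f w)"
    "lin_ext f p = (\<Sum>w\<in>?S. p w * f w)" "lin_ext f q = (\<Sum>w\<in>?S. q w * f w)"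
    by (intro lin_ext_superset; auto)+
  then show ?thesis by (simp add: sum.distrib sum_distrib_left algebra_simps)
qed

lemma lin_on_lin_ext: "lin_on (polys_on W) (lin_ext f)"
proof -
  have "lin_ext f (\<lambda>w. p w + q w) = lin_ext f p + lin_ext f q" if "p \<in> polys_on W" "q \<in> polys_on W" for p q
    using lin_ext_lincomb[of p q f 1] that by (simp add: polys_on_UNIV)
  moreover have "lin_ext f (\<lambda>w. c * p w) = c * lin_ext f p" for c p
    unfolding lin_ext_def sum_distrib_left by (cases "c = 0") (auto simp: mult.assoc)
  ultimately show ?thesis by (simp add: lin_on_def)
qed

definition monom :: "var list \<Rightarrow> ncpoly" where
  "monom w = (\<lambda>u. if u = w then 1 else 0)"

lemma monom_polys_on: "w \<in> W \<Longrightarrow> monom w \<in> polys_on W"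
  by (auto simp: polys_on_def monom_def)

lemma monom_ncpolys: "set w \<subseteq> V \<Longrightarrow> monom w \<in> ncpolys V"
  by (auto simp: ncpolys_eq_polys_on intro: monom_polys_on)

lemma lin_ext_monom [simp]: "lin_ext f (monom w) = f w"
  using lin_ext_superset[of "{w}" "monom w" f] by (auto simp: monom_def)

lemma ncone_eq_monom: "ncone = monom []"
  by (simp add: ncone_def monom_def)

lemma ncone_polys_on [simp]: "[] \<in> W \<Longrightarrow> ncone \<in> polys_on W"
  by (simp add: ncone_eq_monom monom_polys_on)

lemma lin_ext_ncone [simp]: "lin_ext f ncone = f []"
  by (simp add: ncone_eq_monom)

lemma ncmult_nonzeroD:
  assumes "ncmult p q w \<noteq> 0"
  obtains u v where "w = u @ v" "p u \<noteq> 0" "q v \<noteq> 0"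
proof -
  obtain i where "p (take i w) * q (drop i w) \<noteq> 0"
    using assms unfolding ncmult_def by (metis (mono_tags, lifting) sum.neutral)
  then show thesis by (intro that[of "take i w" "drop i w"]) auto
qed

lemma ncmult_polys_on:
  assumes "p \<in> polys_on W1" "q \<in> polys_on W2" "\<And>u v. u \<in> W1 \<Longrightarrow> v \<in> W2 \<Longrightarrow> u @ v \<in> W"
  shows "ncmult p q \<in> polys_on W"
proof -
  have "{w. ncmult p q w \<noteq> 0} \<subseteq> (\<lambda>(u, v). u @ v) ` ({w. p w \<noteq> 0} \<times> {w. q w \<noteq> 0})"
    by (auto elim!: ncmult_nonzeroD)
  moreover have "finite ({w. p w \<noteq> 0} \<times> {w. q w \<noteq> 0})"
    using assms(1,2) by (simp add: polys_on_def)
  moreover have "{w. ncmult p q w \<noteq> 0} \<subseteq> W"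
    using assms by (auto simp: polys_on_def elim!: ncmult_nonzeroD)
  ultimately show ?thesis
    by (auto simp: polys_on_def intro: finite_subset)
qed

lemma ncmult_UNIV [simp]: "p \<in> polys_on UNIV \<Longrightarrow> q \<in> polys_on UNIV \<Longrightarrow> ncmult p q \<in> polys_on UNIV"
  by (rule ncmult_polys_on) simp_all

lemma ncmult_eq_sum_factorizations:
  assumes "p \<in> polys_on UNIV" "q \<in> polys_on UNIV"
  shows "ncmult p q w = (\<Sum>x | x \<in> {u. p u \<noteq> 0} \<times> {v. q v \<noteq> 0} \<and> fst x @ snd x = w. p (fst x) * q (snd x))"
proof -
  let ?cuts = "(\<lambda>i. (take i w, drop i w)) ` {..length w}"
  have cuts: "?cuts = {x. fst x @ snd x = w}"
  proof (intro equalityI subsetI)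
    fix x assume "x \<in> {x. fst x @ snd x = w}"
    then show "x \<in> ?cuts" by (intro image_eqI[of _ _ "length (fst x)"]) auto
  qed auto
  have "finite ?cuts" by simp
  have "inj_on (\<lambda>i. (take i w, drop i w)) {..length w}"
    by (rule inj_onI) (metis atMost_iff length_take min.absorb2 prod.inject)
  then have "ncmult p q w = (\<Sum>x\<in>?cuts. p (fst x) * q (snd x))"
    by (simp add: ncmult_def sum.reindex)
  also have "\<dots> = (\<Sum>x | x \<in> {u. p u \<noteq> 0} \<times> {v. q v \<noteq> 0} \<and> fst x @ snd x = w. p (fst x) * q (snd x))"
    using \<open>finite ?cuts\<close> unfolding cuts by (intro sum.mono_neutral_right) auto
  finally show ?thesis .
qed

lemma lin_ext_ncmult:
  assumes "p \<in> polys_on UNIV" "q \<in> polys_on UNIV"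
  shows "lin_ext f (ncmult p q) = lin_ext (\<lambda>u. lin_ext (\<lambda>v. f (u @ v)) q) p"
proof -
  let ?S = "{u. p u \<noteq> 0} \<times> {v. q v \<noteq> 0}" and ?cat = "\<lambda>x. fst x @ snd x :: var list"
  have fin: "finite ?S" using assms by (simp add: polys_on_def)
  have "lin_ext f (ncmult p q) = (\<Sum>w\<in>?cat ` ?S. ncmult p q w * f w)"
    using fin by (intro lin_ext_superset) (auto elim!: ncmult_nonzeroD intro!: rev_image_eqI)
  also have "\<dots> = (\<Sum>w\<in>?cat ` ?S. \<Sum>x | x \<in> ?S \<and> ?cat x = w. p (fst x) * q (snd x) * f (?cat x))"
    unfolding ncmult_eq_sum_factorizations[OF assms] sum_distrib_right by (intro sum.cong refl) auto
  also have "\<dots> = (\<Sum>x\<in>?S. p (fst x) * q (snd x) * f (?cat x))"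
    by (rule sum.image_gen[OF fin, symmetric])
  also have "\<dots> = lin_ext (\<lambda>u. lin_ext (\<lambda>v. f (u @ v)) q) p"
    unfolding lin_ext_def sum_distrib_left sum.cartesian_product by (intro sum.cong) (auto simp: mult.assoc)
  finally show ?thesis .
qed

lemma polys_eqI:
  assumes "p \<in> polys_on UNIV" "q \<in> polys_on UNIV" "\<And>f. lin_ext f p = lin_ext f q"
  shows "p = q"
proof
  fix w
  have "lin_ext (\<lambda>u. if u = w then 1 else 0) r = r w" if "r \<in> polys_on UNIV" for r
  proof -
    have "lin_ext (\<lambda>u. if u = w then 1 else 0) r = (\<Sum>u\<in>insert w {u. r u \<noteq> 0}. if u = w then r u else 0)"
      using that lin_ext_superset[of "insert w {u. r u \<noteq> 0}" r "\<lambda>u. if u = w then 1 else 0"]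
      by (auto simp: polys_on_def if_distrib cong: if_cong)
    then show ?thesis using that by (simp add: polys_on_def sum.delta)
  qed
  then show "p w = q w" using assms by metis
qed

lemma ncmult_assoc:
  assumes "p \<in> polys_on UNIV" "q \<in> polys_on UNIV" "r \<in> polys_on UNIV"
  shows "ncmult (ncmult p q) r = ncmult p (ncmult q r)"
  using assms by (intro polys_eqI) (simp_all add: lin_ext_ncmult)

lemma ncmult_ncone_left [simp]: "p \<in> polys_on UNIV \<Longrightarrow> ncmult ncone p = p"
  by (intro polys_eqI) (simp_all add: lin_ext_ncmult)

lemma ncmult_ncone_right [simp]: "p \<in> polys_on UNIV \<Longrightarrow> ncmult p ncone = p"
  by (intro polys_eqI) (simp_all add: lin_ext_ncmult)

lemma ncprod_Nil [simp]: "ncprod [] = ncone"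
  and ncprod_Cons [simp]: "ncprod (p # ps) = ncmult p (ncprod ps)"
  by (simp_all add: ncprod_def)

lemma ncprod_UNIV [simp]: "\<forall>p\<in>set ps. p \<in> polys_on UNIV \<Longrightarrow> ncprod ps \<in> polys_on UNIV"
  by (induction ps) simp_all

lemma ncprod_snoc:
  "\<forall>p\<in>set ps. p \<in> polys_on UNIV \<Longrightarrow> q \<in> polys_on UNIV \<Longrightarrow> ncprod (ps @ [q]) = ncmult (ncprod ps) q"
  by (induction ps) (simp_all add: ncmult_assoc)

lemma lin_ext_lib_deriv_monochromatic:
  assumes "a \<in> polys_on {w. \<forall>x\<in>set w. isl x = s}"
  shows "lin_ext (lib_deriv moving F) a = (if s then 0 else lin_ext (\<lambda>u. F [] u - F u []) a)"
proof (cases s)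
  case True
  have "lin_ext (lib_deriv moving F) a = lin_ext (\<lambda>u. 0) a"
    by (rule lin_ext_cong[OF assms]) (simp add: True lib_deriv_none_moving)
  then show ?thesis by (simp add: True)
next
  case False
  have "lin_ext (lib_deriv moving F) a = lin_ext (\<lambda>u. F [] u - F u []) a"
    by (rule lin_ext_cong[OF assms]) (simp add: False lib_deriv_all_moving)
  then show ?thesis by (simp add: False)
qed

text \<open>A block of equal type is either not moved by the liberation derivation or moved as a single letter.\<close>

lemma lin_ext_lib_deriv_ncprod:
  assumes "\<forall>(a, s)\<in>set as. a \<in> polys_on {w. \<forall>x\<in>set w. isl x = s}"
  shows "lin_ext (lib_deriv moving G) (ncprod (map fst as)) =
    lib_deriv (\<lambda>x. \<not> snd x) (\<lambda>ps ss. lin_ext (\<lambda>u. lin_ext (G u) (ncprod (map fst ss))) (ncprod (map fst ps))) as"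
  using assms
proof (induction as arbitrary: G)
  case (Cons x as)
  obtain a s where x: "x = (a, s)" by (cases x)
  have a: "a \<in> polys_on {w. \<forall>x\<in>set w. isl x = s}" using Cons.prems by (simp add: x)
  have fin: "a \<in> polys_on UNIV" "\<forall>p\<in>set (map fst as). p \<in> polys_on UNIV"
    using Cons.prems polys_on_UNIV by (fastforce simp: x)+
  let ?form = "\<lambda>G ps ss. lin_ext (\<lambda>u. lin_ext (G u) (ncprod (map fst ss))) (ncprod (map fst ps))"
  let ?rest = "ncprod (map fst as)"
  have head: "lin_ext (\<lambda>u. lin_ext (\<lambda>v. lib_deriv moving (\<lambda>p s. G p (s @ v)) u) ?rest) a
      = (if \<not> snd x then ?form G [] (x # as) - ?form G [x] as else 0)"
    using fin by (simp add: x lin_ext_lib_deriv lin_ext_lib_deriv_monochromatic[OF a] lin_ext_ncmult lin_ext_diff)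
  have "lin_ext (\<lambda>u. lin_ext (lib_deriv moving (\<lambda>p. G (u @ p))) ?rest) a
      = lin_ext (\<lambda>u. lib_deriv (\<lambda>x. \<not> snd x) (?form (\<lambda>p. G (u @ p))) as) a"
    using Cons by simp
  also have "\<dots> = lib_deriv (\<lambda>x. \<not> snd x) (\<lambda>ps. ?form G (x # ps)) as"
    unfolding lin_ext_lib_deriv using fin by (intro lib_deriv_cong) (auto simp: x lin_ext_ncmult)
  finally have tail: "lin_ext (\<lambda>u. lin_ext (lib_deriv moving (\<lambda>p. G (u @ p))) ?rest) a
      = lib_deriv (\<lambda>x. \<not> snd x) (\<lambda>ps. ?form G (x # ps)) as" .
  have "lin_ext (lib_deriv moving G) (ncprod (map fst (x # as)))
      = lin_ext (\<lambda>u. lin_ext (\<lambda>v. lib_deriv moving (\<lambda>p s. G p (s @ v)) u) ?rest) a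
        + lin_ext (\<lambda>u. lin_ext (lib_deriv moving (\<lambda>p. G (u @ p))) ?rest) a"
    using fin by (simp add: x lin_ext_ncmult lib_deriv_append lin_ext_add)
  then show ?case by (simp add: head tail)
qed simp

subsection \<open>Conditional freeness from the limiting equation\<close>

lemma unmarked_count: "set w \<subseteq> Xvars k \<union> Yvars l \<Longrightarrow> count (mset w) (Inl k) = 0"
  by (auto simp: Xvars_def Yvars_def count_eq_zero_iff)

lemma admissible_unmarked: "set w \<subseteq> Xvars k \<union> Yvars l \<Longrightarrow> admissible k l w"
  by (auto simp: admissible_def unmarked_count simp del: count_mset)

lemma admissible_append_unmarked:
  assumes "set u \<subseteq> Xvars k \<union> Yvars l"
  shows "admissible k l (u @ w) \<longleftrightarrow> admissible k l w" "admissible k l (w @ u) \<longleftrightarrow> admissible k l w"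
  using assms by (auto simp: admissible_def unmarked_count[OF assms] simp del: count_mset)

lemma admissible_mark_unmarked: "set w \<subseteq> Xvars k \<union> Yvars l \<Longrightarrow> admissible k l (Inl k # w)"
  using admissible_append_unmarked(2)[of w k l "[Inl k]"] by (simp add: admissible_def)

locale sd_functional =
  fixes k l :: nat and t :: "var list \<Rightarrow> complex"
  assumes t_Nil: "t [] = 1"
    and t_append_commute: "t (u @ w) = t (w @ u)"
    and t_schwinger_dyson: "admissible k l w \<Longrightarrow> lib_deriv moving (\<lambda>p s. t p * t s) w = 0"
    and t_mark: "t [Inl k] = 1"
begin

abbreviation Xpolys :: "ncpoly set" where "Xpolys \<equiv> ncpolys (Xvars k)"
abbreviation Ypolys :: "ncpoly set" where "Ypolys \<equiv> ncpolys (Yvars l)"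

definition Xpolys_marked :: "ncpoly set" where
  "Xpolys_marked = polys_on {w. admissible k l w \<and> (\<forall>x\<in>set w. isl x)}"

definition tau :: "ncpoly \<Rightarrow> complex" where
  "tau = lin_ext t"

definition phi :: "ncpoly \<Rightarrow> complex" where
  "phi = lin_ext (\<lambda>w. t (Inl k # w))"

lemma ncpolys_UNIV: "p \<in> ncpolys V \<Longrightarrow> p \<in> polys_on UNIV"
  by (auto simp: ncpolys_eq_polys_on intro: polys_on_UNIV)

lemma Xpolys_marked_UNIV: "p \<in> Xpolys_marked \<Longrightarrow> p \<in> polys_on UNIV"
  by (auto simp: Xpolys_marked_def intro: polys_on_UNIV)

lemma ncone_Xpolys_marked: "ncone \<in> Xpolys_marked"
  by (simp add: Xpolys_marked_def admissible_def)

lemma mark_Xpolys_marked: "monom [Inl k] \<in> Xpolys_marked"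
  by (simp add: Xpolys_marked_def monom_polys_on admissible_def)

lemma Xpolys_marked_ncmult:
  assumes "p \<in> Xpolys" "q \<in> Xpolys_marked"
  shows "ncmult p q \<in> Xpolys_marked" "ncmult q p \<in> Xpolys_marked"
proof -
  have "isl x" if "x \<in> Xvars k" for x using that by (auto simp: Xvars_def)
  then have "u @ w \<in> {w. admissible k l w \<and> (\<forall>x\<in>set w. isl x)}"
    "w @ u \<in> {w. admissible k l w \<and> (\<forall>x\<in>set w. isl x)}"
    if "u \<in> lists (Xvars k)" "w \<in> {w. admissible k l w \<and> (\<forall>x\<in>set w. isl x)}" for u w
    using that admissible_append_unmarked[of u k l w] by auto
  note closed = this
  show "ncmult p q \<in> Xpolys_marked"
    using assms unfolding Xpolys_marked_def ncpolys_eq_polys_on by (rule ncmult_polys_on) (rule closed)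
  show "ncmult q p \<in> Xpolys_marked"
    using assms(2,1) unfolding Xpolys_marked_def ncpolys_eq_polys_on by (rule ncmult_polys_on) (rule closed)
qed

lemma Xpolys_subset_marked: "p \<in> Xpolys \<Longrightarrow> p \<in> Xpolys_marked"
  using Xpolys_marked_ncmult(1)[OF _ ncone_Xpolys_marked, of p] by (simp add: ncpolys_UNIV)

lemma tau_commute:
  assumes "p \<in> polys_on UNIV" "q \<in> polys_on UNIV"
  shows "tau (ncmult p q) = tau (ncmult q p)"
proof -
  have "tau (ncmult p q) = lin_ext (\<lambda>v. lin_ext (\<lambda>u. t (u @ v)) p) q"
    using assms by (simp add: tau_def lin_ext_ncmult lin_ext_swap[of "\<lambda>u v. t (u @ v)" q p])
  also have "(\<lambda>v. lin_ext (\<lambda>u. t (u @ v)) p) = (\<lambda>v. lin_ext (\<lambda>u. t (v @ u)) p)"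
    by (intro ext lin_ext_cong[OF assms(1)] t_append_commute)
  also have "lin_ext (\<lambda>v. lin_ext (\<lambda>u. t (v @ u)) p) q = tau (ncmult q p)"
    using assms by (simp add: tau_def lin_ext_ncmult)
  finally show ?thesis .
qed

definition center :: "ncpoly \<Rightarrow> ncpoly" where
  "center p = (\<lambda>w. p w + (- tau p) * ncone w)"

lemma center_ncpolys: "p \<in> ncpolys V \<Longrightarrow> center p \<in> ncpolys V"
  unfolding center_def ncpolys_eq_polys_on by (intro polys_on_lincomb) simp_all

lemma tau_center: "p \<in> polys_on UNIV \<Longrightarrow> tau (center p) = 0"
  using lin_ext_lincomb[of p ncone t "- tau p"] by (simp add: center_def tau_def t_Nil)

lemma tau_ncmult_center:
  assumes "p \<in> polys_on UNIV" "q \<in> polys_on UNIV"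
  shows "tau (ncmult p q) = tau (ncmult (center p) q) + tau p * tau q"
proof -
  have "center p \<in> polys_on UNIV" unfolding center_def using assms by (intro polys_on_lincomb) simp_all
  then show ?thesis
    using assms lin_ext_lincomb[of p ncone "\<lambda>u. lin_ext (\<lambda>v. t (u @ v)) q" "- tau p"]
    by (simp add: tau_def lin_ext_ncmult) (simp add: center_def tau_def)
qed

text \<open>The flag \<open>True\<close> indicates a polynomial in the variables \<open>X\<close>.\<close>

definition alternating :: "(ncpoly \<times> bool) list \<Rightarrow> bool" where
  "alternating as \<longleftrightarrow> distinct_adj (map snd as) \<and>
    (\<forall>x\<in>set as. fst x \<in> (if snd x then Xpolys else Ypolys) \<and> tau (fst x) = 0)"

abbreviation block_prod :: "(ncpoly \<times> bool) list \<Rightarrow> ncpoly" where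
  "block_prod as \<equiv> ncprod (map fst as)"

lemma alternating_append:
  "alternating (as @ bs) \<Longrightarrow> alternating as" "alternating (as @ bs) \<Longrightarrow> alternating bs"
  by (auto simp: alternating_def)

lemma alternating_UNIV: "alternating as \<Longrightarrow> x \<in> set as \<Longrightarrow> fst x \<in> polys_on UNIV"
  by (auto simp: alternating_def split: if_splits dest!: bspec intro: ncpolys_UNIV)

lemma block_prod_UNIV: "alternating as \<Longrightarrow> block_prod as \<in> polys_on UNIV"
  by (intro ncprod_UNIV) (auto intro: alternating_UNIV)

lemma block_prod_snoc:
  assumes "alternating as" "fst x \<in> polys_on UNIV"
  shows "block_prod (as @ [x]) = ncmult (block_prod as) (fst x)"
proof -
  have "\<forall>p\<in>set (map fst as). p \<in> polys_on UNIV"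
    using alternating_UNIV[OF assms(1)] by auto
  then show ?thesis using assms(2) by (simp add: ncprod_snoc)
qed

lemma alternating_polys_on_monochromatic:
  assumes "alternating as" "(a, s) \<in> set as"
  shows "a \<in> polys_on {w. \<forall>x\<in>set w. isl x = s}"
proof -
  have "a \<in> polys_on (lists (if s then Xvars k else Yvars l))"
    using assms by (auto simp: alternating_def ncpolys_eq_polys_on split: if_splits dest!: bspec)
  then show ?thesis by (rule polys_on_mono) (auto simp: Xvars_def Yvars_def split: if_splits)
qed

lemma block_prod_polys_on_admissible:
  assumes "alternating as" and h: "h \<in> Xpolys_marked"
  shows "block_prod (as @ [(h, True)]) \<in> polys_on {w. admissible k l w}"
  using assms(1)
proof (induction as)
  case Nil
  then show ?case
    using h Xpolys_marked_UNIV[OF h] by (auto simp: Xpolys_marked_def elim!: polys_on_mono)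
next
  case (Cons x as)
  have "fst x \<in> ncpolys (Xvars k) \<or> fst x \<in> ncpolys (Yvars l)"
    using Cons.prems by (auto simp: alternating_def split: if_splits)
  then have "fst x \<in> polys_on (lists (Xvars k \<union> Yvars l))"
    unfolding ncpolys_eq_polys_on by (auto elim!: polys_on_mono)
  then show ?case
    using Cons alternating_append(2)[of "[x]" as]
    by (auto intro!: ncmult_polys_on admissible_append_unmarked(1)[THEN iffD2])
qed

lemma tau_blocks_schwinger_dyson:
  assumes blocks: "alternating as" and h: "h \<in> Xpolys_marked"
  shows "lib_deriv (\<lambda>x. \<not> snd x) (\<lambda>ps ss. tau (block_prod ps) * tau (block_prod ss)) (as @ [(h, True)]) = 0"
proof -
  have "h \<in> polys_on {w. \<forall>x\<in>set w. isl x = True}"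
    using h unfolding Xpolys_marked_def by (rule polys_on_mono) auto
  then have "\<forall>(a, s)\<in>set (as @ [(h, True)]). a \<in> polys_on {w. \<forall>x\<in>set w. isl x = s}"
    using alternating_polys_on_monochromatic[OF blocks] by auto
  from lin_ext_lib_deriv_ncprod[OF this, of "\<lambda>p s. t p * t s"]
  have "lib_deriv (\<lambda>x. \<not> snd x) (\<lambda>ps ss. tau (block_prod ps) * tau (block_prod ss)) (as @ [(h, True)])
      = lin_ext (lib_deriv moving (\<lambda>p s. t p * t s)) (block_prod (as @ [(h, True)]))"
    by (simp add: tau_def lin_ext_cmult lin_ext_multc)
  also have "\<dots> = lin_ext (\<lambda>w. 0) (block_prod (as @ [(h, True)]))"
    by (rule lin_ext_cong[OF block_prod_polys_on_admissible[OF assms]]) (simp add: t_schwinger_dyson)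
  finally show ?thesis by simp
qed

text \<open>The block form of the limiting equation expresses \<open>tau (c\<^sub>1 a\<^sub>1 \<dots> c\<^sub>n a\<^sub>n h)\<close> through the values of \<open>tau\<close> at the
  prefixes \<open>c\<^sub>1 a\<^sub>1 \<dots> a\<^sub>j\<close> and \<open>c\<^sub>1 a\<^sub>1 \<dots> a\<^sub>j c\<^sub>j\<^sub>+\<^sub>1\<close>. In the latter, the block \<open>c\<^sub>j\<^sub>+\<^sub>1 c\<^sub>1\<close> that arises by traciality is
  recentered, which leaves shorter alternating products.\<close>

lemma tau_alternating_ncmult_Y:
  assumes shorter: "\<And>bs h. length bs \<le> length as \<Longrightarrow> bs \<noteq> [] \<Longrightarrow> alternating bs \<Longrightarrow> \<not> snd (hd bs) \<Longrightarrow>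
      h \<in> Xpolys_marked \<Longrightarrow> tau (ncmult (block_prod bs) h) = 0"
    and as: "alternating as" "as \<noteq> []" "\<not> snd (hd as)" "snd (last as)" and d: "d \<in> Ypolys"
  shows "tau (ncmult (block_prod as) d) = 0"
proof -
  obtain c p where as_eq: "as = (c, False) # p" using as(2,3) by (cases as) auto
  then have c: "c \<in> Ypolys" and p: "alternating p" "p \<noteq> []"
    using as(1,4) alternating_append(2)[of "[(c, False)]" p] by (auto simp: alternating_def split: if_splits)
  obtain a p' where p_eq: "p = (a, True) # p'"
    using as(1) p(2) by (cases p) (auto simp: as_eq alternating_def)
  then have a: "a \<in> Xpolys" "tau a = 0" and p': "alternating p'" "p' \<noteq> [] \<longrightarrow> \<not> snd (hd p')"
    using p(1) alternating_append(2)[of "[(a, True)]" p'] by (auto simp: alternating_def neq_Nil_conv)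
  have fin: "c \<in> polys_on UNIV" "d \<in> polys_on UNIV" "a \<in> polys_on UNIV"
    "block_prod p \<in> polys_on UNIV" "block_prod p' \<in> polys_on UNIV"
    using c d a p p' by (simp_all add: ncpolys_UNIV block_prod_UNIV)
  have "tau (ncmult (block_prod as) d) = tau (ncmult (ncmult d c) (block_prod p))"
    using fin tau_commute[of "ncmult c (block_prod p)" d] by (simp add: as_eq ncmult_assoc)
  also have "\<dots> = tau (ncmult (center (ncmult d c)) (block_prod p)) + tau (ncmult d c) * tau (block_prod p)"
    using fin by (intro tau_ncmult_center) simp_all
  also have "tau (ncmult (center (ncmult d c)) (block_prod p)) = 0"
  proof -
    have "ncmult d c \<in> Ypolys"
      using d c unfolding ncpolys_eq_polys_on by (rule ncmult_polys_on) simp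
    then have recentered: "alternating ((center (ncmult d c), False) # p)"
      using as(1) fin by (auto simp: alternating_def as_eq center_ncpolys tau_center)
    then show ?thesis
      using shorter[OF _ _ recentered _ ncone_Xpolys_marked] block_prod_UNIV[OF recentered] by (simp add: as_eq)
  qed
  also have "tau (block_prod p) = 0"
  proof (cases "p' = []")
    case True
    then show ?thesis using a fin by (simp add: p_eq)
  next
    case False
    then have "tau (ncmult (block_prod p') a) = 0"
      using p' Xpolys_subset_marked[OF a(1)] by (intro shorter) (simp_all add: as_eq p_eq)
    then show ?thesis using fin tau_commute[of a "block_prod p'"] by (simp add: p_eq)
  qed
  finally show ?thesis by simp
qed

lemma tau_alternating_append_marked:
  assumes shorter: "\<And>bs h. length bs < length as \<Longrightarrow> bs \<noteq> [] \<Longrightarrow> alternating bs \<Longrightarrow> \<not> snd (hd bs) \<Longrightarrow>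
      h \<in> Xpolys_marked \<Longrightarrow> tau (ncmult (block_prod bs) h) = 0"
    and as: "as \<noteq> []" "alternating as" "\<not> snd (hd as)" and h: "h \<in> Xpolys_marked"
  shows "tau (block_prod (as @ [(h, True)])) = 0"
proof -
  obtain c bs where as_eq: "as = (c, False) # bs" and c: "tau c = 0" "c \<in> polys_on UNIV"
    using as by (cases as) (auto simp: alternating_def ncpolys_UNIV)
  let ?f = "\<lambda>ps ss. tau (block_prod ps) * tau (block_prod ss)"
  have "lib_deriv (\<lambda>x. \<not> snd x) (\<lambda>ps. ?f ((c, False) # ps)) (bs @ [(h, True)]) = 0"
  proof (rule lib_deriv_eq_0)
    fix p d s assume eq: "bs @ [(h, True)] = p @ d # s" and d: "\<not> snd d"
    let ?p = "(c, False) # p"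
    obtain s' where "s = s' @ [(h, True)]"
      using eq d by (cases s rule: rev_cases) auto
    then have as_split: "as = ?p @ [d] @ s'" using eq by (simp add: as_eq)
    have prefix: "alternating ?p"
      using as(2) unfolding as_split by (rule alternating_append(1))
    have d_Y: "fst d \<in> Ypolys"
      using as(2) d by (auto simp: as_split alternating_def)
    have "distinct_adj (map snd ?p @ map snd ([d] @ s'))"
      using as(2) by (simp only: as_split alternating_def map_append)
    then have last_p: "snd (last ?p)"
      using d unfolding distinct_adj_append_iff by (auto simp: last_map)
    have shorter_p: "tau (ncmult (block_prod bs) h) = 0"
      if "length bs \<le> length ?p" "bs \<noteq> []" "alternating bs" "\<not> snd (hd bs)" "h \<in> Xpolys_marked" for bs h
      using that by (intro shorter) (simp_all add: as_split)
    have "tau (block_prod ?p) = 0"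
      using shorter_p[OF order_refl _ prefix _ ncone_Xpolys_marked] block_prod_UNIV[OF prefix] by simp
    moreover have "tau (block_prod (?p @ [d])) = 0"
      unfolding block_prod_snoc[OF prefix ncpolys_UNIV[OF d_Y]]
      by (rule tau_alternating_ncmult_Y[OF shorter_p prefix _ _ last_p d_Y]) simp_all
    ultimately show "?f ?p (d # s) = ?f ((c, False) # (p @ [d])) s" by simp
  qed
  then show ?thesis
    using tau_blocks_schwinger_dyson[OF as(2) h] c by (simp add: as_eq tau_def t_Nil)
qed

lemma tau_alternating_ncmult:
  assumes "as \<noteq> []" "alternating as" "\<not> snd (hd as)" "h \<in> Xpolys_marked"
  shows "tau (ncmult (block_prod as) h) = 0"
  using assms
proof (induction "length as" arbitrary: as h rule: less_induct)
  case less
  have "tau (block_prod (as @ [(h, True)])) = 0"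
    by (rule tau_alternating_append_marked[OF less.hyps less.prems])
  then show ?case
    using block_prod_snoc[OF less.prems(2), of "(h, True)"] less.prems(4) by (simp add: Xpolys_marked_UNIV)
qed

lemma tau_ncmult_alternating:
  assumes as: "alternating as" "length as > 1"
    and g: "g \<in> Xpolys_marked"
  shows "tau (ncmult g (block_prod as)) = 0"
proof (cases "snd (hd as)")
  case False
  have "tau (ncmult (block_prod as) g) = 0"
    using as g False by (intro tau_alternating_ncmult) auto
  then show ?thesis
    using tau_commute as(1) g by (simp add: block_prod_UNIV Xpolys_marked_UNIV)
next
  case True
  obtain a bs where as_eq: "as = (a, True) # bs" using as(2) True by (cases as) auto
  then have bs: "alternating bs" "bs \<noteq> []" "\<not> snd (hd bs)" and a: "a \<in> Xpolys"
    using as alternating_append(2)[of "[(a, True)]" bs] by (auto simp: alternating_def neq_Nil_conv)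
  have ga: "ncmult g a \<in> Xpolys_marked" by (rule Xpolys_marked_ncmult(2)[OF a g])
  have "tau (ncmult (block_prod bs) (ncmult g a)) = 0"
    by (intro tau_alternating_ncmult bs ga)
  then have "tau (ncmult (ncmult g a) (block_prod bs)) = 0"
    using tau_commute bs(1) ga by (simp add: block_prod_UNIV Xpolys_marked_UNIV)
  then show ?thesis
    using bs(1) a g by (simp add: as_eq ncmult_assoc block_prod_UNIV ncpolys_UNIV Xpolys_marked_UNIV)
qed

lemma phi_eq_tau_mark: "p \<in> polys_on UNIV \<Longrightarrow> phi p = tau (ncmult (monom [Inl k]) p)"
  by (simp add: phi_def tau_def lin_ext_ncmult monom_polys_on)

lemma phi_Ypolys:
  assumes "p \<in> Ypolys"
  shows "phi p = tau p"
proof -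
  let ?m = "monom [Inl k]"
  have fin: "p \<in> polys_on UNIV" "?m \<in> polys_on UNIV" "center p \<in> polys_on UNIV"
    using assms by (simp_all add: ncpolys_UNIV[OF center_ncpolys] ncpolys_UNIV monom_polys_on)
  have "alternating [(center p, False)]"
    using assms fin by (simp add: alternating_def center_ncpolys tau_center)
  from tau_alternating_ncmult[OF _ this _ mark_Xpolys_marked]
  have "tau (ncmult (center p) ?m) = 0"
    using fin by simp
  then have "tau (ncmult p ?m) = tau p * tau ?m"
    using tau_ncmult_center[OF fin(1,2)] by simp
  then show ?thesis
    using fin tau_commute[of p ?m] by (simp add: phi_eq_tau_mark tau_def t_mark)
qed

theorem cond_free_tau_phi: "cond_free Xpolys Ypolys tau phi"
  unfolding cond_free_def
proof (intro allI impI)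
  fix as :: "(ncpoly \<times> bool) list"
  assume len: "1 < length as" and adj: "\<forall>i. Suc i < length as \<longrightarrow> snd (as ! i) \<noteq> snd (as ! Suc i)"
    and centered: "\<forall>(a, s)\<in>set as. a \<in> (if s then Xpolys else Ypolys) \<and> tau a = 0"
  have alt: "alternating as"
    using adj centered by (auto simp: alternating_def distinct_adj_conv_nth)
  note vanish = tau_ncmult_alternating[OF alt len]
  have "tau (block_prod as) = 0" "phi (block_prod as) = 0"
    using vanish[OF ncone_Xpolys_marked] vanish[OF mark_Xpolys_marked] block_prod_UNIV[OF alt]
    by (simp_all add: phi_eq_tau_mark)
  moreover have "(\<Prod>a\<leftarrow>map fst as. phi a) = 0"
  proof -
    obtain x y bs where as_eq: "as = x # y # bs" using len by (cases as; cases "tl as") auto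
    have "snd x \<noteq> snd y" using spec[OF adj, of 0] by (simp add: as_eq)
    then have "phi (fst x) = 0 \<or> phi (fst y) = 0"
      using centered phi_Ypolys by (cases "snd x") (auto simp: as_eq split: if_splits)
    then show ?thesis by (auto simp: as_eq)
  qed
  ultimately show "tau (block_prod as) = 0 \<and> phi (block_prod as) = (\<Prod>a\<leftarrow>map fst as. phi a)"
    by simp
qed

end

subsection \<open>The Haar unitary model\<close>

context sd_system
begin

lemma integrable_X: "N \<ge> 1 \<Longrightarrow> integrable M (\<lambda>\<omega>. X N \<omega> w)"
  using integrable_prod[of N "{#w#}"] by simp

lemma expectation_lin_ext:
  "N \<ge> 1 \<Longrightarrow> expectation (\<lambda>\<omega>. lin_ext (\<lambda>w. X N \<omega> (g w)) p) = lin_ext (\<lambda>w. mean (g w) N) p"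
  by (simp add: lin_ext_def mean_def integrable_X)

lemma expectation_lin_ext_tendsto:
  assumes "p \<in> polys_on W" "\<And>w. w \<in> W \<Longrightarrow> adm (g w)"
  shows "(\<lambda>N. expectation (\<lambda>\<omega>. lin_ext (\<lambda>w. X N \<omega> (g w)) p)) \<longlonglongrightarrow> lin_ext (\<lambda>w. limit (g w)) p"
  by (rule tendsto_cong_ge_1[OF expectation_lin_ext lin_ext_tendsto[OF assms(1)]])
    (simp_all add: mean_tendsto assms(2))

lemma AE_lin_ext_tendsto:
  assumes p: "p \<in> polys_on W" and adm: "\<And>w. w \<in> W \<Longrightarrow> adm (g w)"
    and cnj_X: "\<And>N \<omega> w. adm w \<Longrightarrow> cnj (X N \<omega> w) = X N \<omega> (rev w)"
  shows "AE \<omega> in M. (\<lambda>N. lin_ext (\<lambda>w. X N \<omega> (g w)) p) \<longlonglongrightarrow> lin_ext (\<lambda>w. limit (g w)) p"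
proof -
  have "AE \<omega> in M. \<forall>w\<in>{w. p w \<noteq> 0}. (\<lambda>N. X N \<omega> (g w)) \<longlonglongrightarrow> limit (g w)"
  proof (rule AE_finite_allI)
    show "finite {w. p w \<noteq> 0}" using p by (simp add: polys_on_def)
    show "AE \<omega> in M. (\<lambda>N. X N \<omega> (g w)) \<longlonglongrightarrow> limit (g w)" if "w \<in> {w. p w \<noteq> 0}" for w
      using that by (intro AE_tendsto_limit cnj_X adm) (auto dest: polys_on_nonzeroD[OF p])
  qed
  then show ?thesis
    by eventually_elim (auto simp: lin_ext_def intro!: tendsto_sum tendsto_mult_left)
qed

end

lemma ntr_poly_eval: "ntr N (poly_eval N Z p) = lin_ext (\<lambda>w. ntr N (mono_eval N Z w)) p"
  unfolding ntr_def poly_eval_def lin_ext_def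
  by (subst sum.swap) (simp add: sum_distrib_left sum_divide_distrib)

lemma vstate_poly_eval: "vstate N v (poly_eval N Z p) = lin_ext (\<lambda>w. vstate N v (mono_eval N Z w)) p"
proof -
  have "vstate N v (poly_eval N Z p) = (\<Sum>i<N. \<Sum>j<N. \<Sum>w | p w \<noteq> 0. p w * (mono_eval N Z w i j * v j * cnj (v i)))"
    by (simp add: vstate_def poly_eval_def sum_distrib_right mult.assoc)
  also have "\<dots> = (\<Sum>i<N. \<Sum>w | p w \<noteq> 0. \<Sum>j<N. p w * (mono_eval N Z w i j * v j * cnj (v i)))"
    by (intro sum.cong refl sum.swap)
  also have "\<dots> = (\<Sum>w | p w \<noteq> 0. \<Sum>i<N. \<Sum>j<N. p w * (mono_eval N Z w i j * v j * cnj (v i)))"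
    by (rule sum.swap)
  finally show ?thesis
    by (simp add: lin_ext_def vstate_def sum_distrib_left sum_distrib_right)
qed

lemma vstate_idm:
  assumes "unit_vec N v"
  shows "vstate N v (idm N) = 1"
proof -
  have "vstate N v (idm N) = (\<Sum>i<N. (\<Sum>j<N. if j = i then v j else 0) * cnj (v i))"
    unfolding vstate_def by (intro sum.cong arg_cong2[of _ _ _ _ "(*)"] refl) (auto simp: idm_def)
  also have "\<dots> = of_real (\<Sum>i<N. (cmod (v i))\<^sup>2)"
    unfolding of_real_sum by (intro sum.cong) (simp_all add: complex_norm_square del: of_real_power)
  finally show ?thesis
    using assms by (simp only: unit_vec_def of_real_1)
qed

lemma rank_one_sandwich:
  "mmult N (rank_one N v) (mmult N F (rank_one N v)) = (\<lambda>i j. vstate N v F * rank_one N v i j)"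
proof (intro ext)
  fix i j
  have "(\<Sum>k<N. v i * cnj (v k) * (\<Sum>m<N. F k m * (v m * cnj (v j))))
     = (\<Sum>k<N. (\<Sum>m<N. F k m * v m) * cnj (v k)) * (v i * cnj (v j))"
    by (simp add: sum_distrib_left sum_distrib_right mult_ac)
  then show "mmult N (rank_one N v) (mmult N F (rank_one N v)) i j = vstate N v F * rank_one N v i j"
    by (simp add: mmult_def rank_one_def vstate_def)
qed

lemma ntr_rank_one: "ntr N (mmult N (rank_one N v) F) = vstate N v F / of_nat N"
proof -
  have "(\<Sum>i<N. \<Sum>k<N. v i * cnj (v k) * F k i) = (\<Sum>k<N. \<Sum>i<N. F k i * v i * cnj (v k))"
    by (subst sum.swap) (simp add: mult_ac)
  then show ?thesis by (simp add: ntr_def mmult_def rank_one_def vstate_def sum_distrib_right)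
qed

lemma ntr_scale: "ntr N (\<lambda>i j. c * F i j) = c * ntr N F"
  by (simp add: ntr_def sum_distrib_left)

definition marker :: "nat \<Rightarrow> cvec \<Rightarrow> cmat" where
  "marker N v = (\<lambda>i j. of_nat N * rank_one N v i j)"

lemma ntr_marker: "N \<ge> 1 \<Longrightarrow> ntr N (mmult N (marker N v) F) = vstate N v F"
  by (simp add: marker_def mmult_scale_left ntr_scale ntr_rank_one)

lemma ntr_marker_twice:
  assumes "N \<ge> 1"
  shows "ntr N (mmult N (marker N v) (mmult N F (mmult N (marker N v) G)))
    = of_nat N * (ntr N (mmult N (marker N v) F) * ntr N (mmult N (marker N v) G))"
proof -
  have "mmult N (rank_one N v) (mmult N F (mmult N (rank_one N v) G))
      = (\<lambda>i j. vstate N v F * mmult N (rank_one N v) G i j)"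
    using arg_cong[OF rank_one_sandwich[of N v F], of "\<lambda>H. mmult N H G"]
    by (simp add: mmult_assoc mmult_scale_left)
  then have "ntr N (mmult N (marker N v) (mmult N F (mmult N (marker N v) G)))
      = of_nat N * (of_nat N * (vstate N v F * (vstate N v G / of_nat N)))"
    by (simp only: marker_def mmult_scale_left mmult_scale_right ntr_scale ntr_rank_one)
  then show ?thesis
    using assms by (simp add: ntr_marker)
qed

lemma selfadj_marker: "selfadj_mat N (marker N v)"
  by (simp add: selfadj_mat_def marker_def rank_one_def)

lemma mono_eval_letters_X:
  assumes "\<forall>x\<in>set w. isl x"
  shows "mono_eval N (letters N A B u) w = mono_eval N (case_sum A C) w"
  using assms by (intro mono_eval_cong) (auto simp: letters_def split: sum.splits)

lemma ntr_mono_eval_letters_Y: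
  assumes "unitary_mat N u" "\<forall>x\<in>set w. moving x"
  shows "ntr N (mono_eval N (letters N A B u) w) = ntr N (mono_eval N (case_sum C B) w)"
proof -
  have "mono_eval N (letters N A B u) w = mono_eval N (\<lambda>x. mmult N (mmult N u (case_sum C B x)) (adj u)) w"
    using assms(2) by (intro mono_eval_cong) (auto simp: letters_def split: sum.splits)
  then show ?thesis
    by (simp add: mono_eval_conj[OF assms(1)] ntr_conj[OF assms(1)])
qed

abbreviation (input) zeros :: "nat \<Rightarrow> cmat" where "zeros \<equiv> \<lambda>_ _ _. 0"

locale haar_model = prob_space M for M :: "'w measure" +
  fixes k l :: nat and A B :: "nat \<Rightarrow> nat \<Rightarrow> cmat" and v :: "nat \<Rightarrow> cvec"
    and \<tau> \<phi> :: "ncpoly \<Rightarrow> complex" and U :: "nat \<Rightarrow> 'w \<Rightarrow> cmat"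
  assumes unit: "N \<ge> 1 \<Longrightarrow> unit_vec N (v N)"
    and lim_A: "P \<in> ncpolys (Xvars k) \<Longrightarrow> (\<lambda>N. ntr N (poly_eval N (case_sum (A N) zeros) P)) \<longlonglongrightarrow> \<tau> P"
    and lim_A_vstate: "P \<in> ncpolys (Xvars k) \<Longrightarrow>
      (\<lambda>N. vstate N (v N) (poly_eval N (case_sum (A N) zeros) P)) \<longlonglongrightarrow> \<phi> P"
    and lim_B: "P \<in> ncpolys (Yvars l) \<Longrightarrow> (\<lambda>N. ntr N (poly_eval N (case_sum zeros (B N)) P)) \<longlonglongrightarrow> \<tau> P"
    and haar_U: "N \<ge> 1 \<Longrightarrow> haar_unitary M N (U N)"
begin

abbreviation A_marked :: "nat \<Rightarrow> nat \<Rightarrow> cmat" where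
  "A_marked N \<equiv> (A N)(k := marker N (v N))"

abbreviation Z :: "nat \<Rightarrow> 'w \<Rightarrow> var \<Rightarrow> cmat" where
  "Z N \<omega> \<equiv> letters N (A N) (B N) (U N \<omega>)"

definition X :: "nat \<Rightarrow> 'w \<Rightarrow> var list \<Rightarrow> complex" where
  "X N \<omega> w = ntr N (mono_eval N (letters N (A_marked N) (B N) (U N \<omega>)) w)"

lemma haar_matrix: "N \<ge> 1 \<Longrightarrow> haar_matrix M N (U N)"
  using haar_U by unfold_locales auto

lemma mono_eval_A_marked:
  "set w \<subseteq> Xvars k \<union> Yvars l \<Longrightarrow>
    mono_eval N (letters N (A_marked N) (B N) u) w = mono_eval N (letters N (A N) (B N) u) w"
  by (intro mono_eval_cong) (auto simp: letters_def Xvars_def Yvars_def)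

lemma X_unmarked: "set w \<subseteq> Xvars k \<union> Yvars l \<Longrightarrow> X N \<omega> w = ntr N (mono_eval N (Z N \<omega>) w)"
  by (simp add: X_def mono_eval_A_marked)

lemma X_mark:
  "N \<ge> 1 \<Longrightarrow> set w \<subseteq> Xvars k \<union> Yvars l \<Longrightarrow> X N \<omega> (Inl k # w) = vstate N (v N) (mono_eval N (Z N \<omega>) w)"
  by (simp add: X_def mono_eval_Cons mono_eval_A_marked ntr_marker)

lemma Xvars_isl: "set w \<subseteq> Xvars k \<Longrightarrow> \<forall>x\<in>set w. isl x"
  and Yvars_moving: "set w \<subseteq> Yvars l \<Longrightarrow> \<forall>x\<in>set w. moving x"
  by (auto simp: Xvars_def Yvars_def)

lemma AE_X_moving:
  assumes "N \<ge> 1" "\<forall>x\<in>set w. moving x"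
  shows "AE \<omega> in M. X N \<omega> w = ntr N (mono_eval N (case_sum zeros (B N)) w)"
  using haar_U[OF assms(1)] ntr_mono_eval_letters_Y[OF _ assms(2)] by (auto simp: haar_unitary_def X_def)

lemma AE_X_monochromatic:
  assumes "N \<ge> 1" "monochromatic w"
  shows "\<exists>c. AE \<omega> in M. X N \<omega> w = c"
proof (cases "\<forall>x\<in>set w. isl x")
  case True
  then show ?thesis
    using mono_eval_letters_X[OF True, of N "A_marked N" "B N" _ zeros] by (auto simp: X_def)
next
  case False
  then show ?thesis
    using assms AE_X_moving by (auto simp: monochromatic_def)
qed

lemma expectation_X_Xvars:
  "set w \<subseteq> Xvars k \<Longrightarrow> expectation (\<lambda>\<omega>. X N \<omega> w) = ntr N (mono_eval N (case_sum (A N) zeros) w)"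
  using mono_eval_letters_X[OF Xvars_isl, where C = zeros] by (simp add: X_unmarked le_supI1 prob_space)

lemma expectation_X_mark_Xvars:
  "N \<ge> 1 \<Longrightarrow> set w \<subseteq> Xvars k \<Longrightarrow>
    expectation (\<lambda>\<omega>. X N \<omega> (Inl k # w)) = vstate N (v N) (mono_eval N (case_sum (A N) zeros) w)"
  using mono_eval_letters_X[OF Xvars_isl, where C = zeros] by (simp add: X_mark le_supI1 prob_space)

lemma expectation_X_Yvars:
  assumes "N \<ge> 1" "set w \<subseteq> Yvars l"
  shows "expectation (\<lambda>\<omega>. X N \<omega> w) = ntr N (mono_eval N (case_sum zeros (B N)) w)"
proof -
  interpret haar_matrix M N "A_marked N" "B N" "U N" by (rule haar_matrix[OF assms(1)])
  have "expectation (\<lambda>\<omega>. X N \<omega> w) = expectation (\<lambda>\<omega>. ntr N (mono_eval N (case_sum zeros (B N)) w))"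
    using integrable_trace_prod[of "{#w#}"] AE_X_moving[OF assms(1) Yvars_moving[OF assms(2)]]
    by (intro integral_cong_AE) (auto simp: X_def[abs_def])
  then show ?thesis by (simp add: prob_space)
qed

lemma expectation_X_Xvars_tendsto:
  assumes "set w \<subseteq> Xvars k"
  shows "(\<lambda>N. expectation (\<lambda>\<omega>. X N \<omega> w)) \<longlonglongrightarrow> \<tau> (monom w)"
  using assms lim_A[of "monom w"]
  by (simp add: expectation_X_Xvars ntr_poly_eval monom_ncpolys)

lemma expectation_X_mark_Xvars_tendsto:
  assumes "set w \<subseteq> Xvars k"
  shows "(\<lambda>N. expectation (\<lambda>\<omega>. X N \<omega> (Inl k # w))) \<longlonglongrightarrow> \<phi> (monom w)"
proof (rule tendsto_cong_ge_1)
  show "(\<lambda>N. vstate N (v N) (mono_eval N (case_sum (A N) zeros) w)) \<longlonglongrightarrow> \<phi> (monom w)"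
    using assms lim_A_vstate[of "monom w"] by (simp add: vstate_poly_eval monom_ncpolys)
qed (simp add: expectation_X_mark_Xvars assms)

lemma expectation_X_Yvars_tendsto:
  assumes "set w \<subseteq> Yvars l"
  shows "(\<lambda>N. expectation (\<lambda>\<omega>. X N \<omega> w)) \<longlonglongrightarrow> \<tau> (monom w)"
proof (rule tendsto_cong_ge_1)
  show "(\<lambda>N. ntr N (mono_eval N (case_sum zeros (B N)) w)) \<longlonglongrightarrow> \<tau> (monom w)"
    using assms lim_B[of "monom w"] by (simp add: ntr_poly_eval monom_ncpolys)
qed (simp add: expectation_X_Yvars assms)

lemma X_rotate: "X N \<omega> (u @ w) = X N \<omega> (w @ u)"
  by (simp add: X_def ntr_mono_eval_rotate)

lemma convergent_expectation_X_monochromatic: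
  assumes "monochromatic w" "admissible k l w"
  shows "convergent (\<lambda>N. expectation (\<lambda>\<omega>. X N \<omega> w))"
proof -
  have in_Xvars: "x \<in> Xvars k" if "isl x" "x \<in> set w" "x \<noteq> Inl k" for x
    using that assms(2) by (auto simp: admissible_def Yvars_def)
  have in_Yvars: "x \<in> Yvars l" if "moving x" "x \<in> set w" for x
    using that assms(2) by (auto simp: admissible_def Xvars_def)
  consider (unmarked) "\<forall>x\<in>set w. isl x" "Inl k \<notin> set w"
    | (marked) "\<forall>x\<in>set w. isl x" "Inl k \<in> set w"
    | (moving) "\<forall>x\<in>set w. moving x"
    using assms(1) unfolding monochromatic_def by blast
  then show ?thesis
  proof cases
    case unmarked
    then have "set w \<subseteq> Xvars k" using in_Xvars by fast
    from expectation_X_Xvars_tendsto[OF this] show ?thesis by (auto simp: convergent_def)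
  next
    case marked
    then obtain u w' where w: "w = u @ Inl k # w'" using split_list by metis
    have "Inl k \<notin> set (w' @ u)" using assms(2) by (auto simp: admissible_def w count_eq_zero_iff)
    then have "set (w' @ u) \<subseteq> Xvars k" using marked(1) in_Xvars unfolding w by auto
    from expectation_X_mark_Xvars_tendsto[OF this] show ?thesis
      unfolding w by (subst X_rotate) (auto simp: convergent_def)
  next
    case moving
    then have "set w \<subseteq> Yvars l" using in_Yvars by fast
    from expectation_X_Yvars_tendsto[OF this] show ?thesis by (auto simp: convergent_def)
  qed
qed

sublocale sd_system M k l X
proof
  fix N :: nat assume N: "N \<ge> 1"
  interpret h: haar_matrix M N "A_marked N" "B N" "U N" by (rule haar_matrix[OF N])
  show "integrable M (\<lambda>\<omega>. \<Prod>q\<in>#Q. X N \<omega> q)" for Q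
    unfolding X_def[abs_def] by (rule h.integrable_trace_prod)
  show "X N \<omega> [] = 1" for \<omega> by (simp add: X_def ntr_idm[OF N])
  show "\<exists>c. AE \<omega> in M. X N \<omega> w = c" if "monochromatic w" for w
    by (rule AE_X_monochromatic[OF N that])
  show "X N \<omega> (Inl k # u @ Inl k # w) = of_nat N * (X N \<omega> (Inl k # u) * X N \<omega> (Inl k # w))" for \<omega> u w
    by (simp add: X_def mono_eval_Cons mono_eval_append ntr_marker_twice[OF N])
  show "lib_deriv moving (\<lambda>p s. expectation (\<lambda>\<omega>. \<Prod>q\<in>#add_mset p (add_mset s Q). X N \<omega> q)) P +
      (\<Sum>q\<in>#Q. lib_deriv moving (\<lambda>p s. expectation (\<lambda>\<omega>. \<Prod>r\<in>#add_mset (p @ P @ s) (Q - {#q#}). X N \<omega> r)) q)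
        / (of_nat N)\<^sup>2 = 0" for Q P
    using h.schwinger_dyson[of Q P] unfolding h.trace_moment_def X_def .
qed (auto simp: X_def ntr_mono_eval_rotate intro: convergent_expectation_X_monochromatic[unfolded X_def])

lemma limit_mark: "limit [Inl k] = 1"
proof (rule LIMSEQ_unique)
  show "mean [Inl k] \<longlonglongrightarrow> limit [Inl k]"
    using admissible_mark_unmarked[of "[]" k l] by (intro mean_tendsto) simp
  show "mean [Inl k] \<longlonglongrightarrow> 1"
    by (rule tendsto_cong_ge_1[of _ "\<lambda>_. 1"])
      (simp_all add: mean_def expectation_X_mark_Xvars[of _ "[]"] vstate_idm unit)
qed

sublocale sd_functional k l limit
  by unfold_locales (simp_all add: limit_Nil limit_append_commute limit_schwinger_dyson limit_mark)

abbreviation XY :: "ncpoly set" where "XY \<equiv> ncpolys (Xvars k \<union> Yvars l)"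

lemma ntr_poly_eval_Z: "P \<in> XY \<Longrightarrow> ntr N (poly_eval N (Z N \<omega>) P) = lin_ext (X N \<omega>) P"
  unfolding ntr_poly_eval ncpolys_eq_polys_on by (erule lin_ext_cong) (auto intro: X_unmarked[symmetric])

lemma vstate_poly_eval_Z:
  "N \<ge> 1 \<Longrightarrow> P \<in> XY \<Longrightarrow> vstate N (v N) (poly_eval N (Z N \<omega>) P) = lin_ext (\<lambda>w. X N \<omega> (Inl k # w)) P"
  unfolding vstate_poly_eval ncpolys_eq_polys_on by (erule lin_ext_cong) (auto intro: X_mark[symmetric])

lemma expectation_ntr_tendsto:
  assumes "P \<in> XY"
  shows "(\<lambda>N. expectation (\<lambda>\<omega>. ntr N (poly_eval N (Z N \<omega>) P))) \<longlonglongrightarrow> tau P"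
  unfolding ntr_poly_eval_Z[OF assms] tau_def
  by (rule expectation_lin_ext_tendsto[where g = "\<lambda>w. w"])
    (use assms in \<open>auto simp: ncpolys_eq_polys_on intro: admissible_unmarked\<close>)

lemma expectation_vstate_tendsto:
  assumes "P \<in> XY"
  shows "(\<lambda>N. expectation (\<lambda>\<omega>. vstate N (v N) (poly_eval N (Z N \<omega>) P))) \<longlonglongrightarrow> phi P"
proof (rule tendsto_cong_ge_1)
  show "(\<lambda>N. expectation (\<lambda>\<omega>. lin_ext (\<lambda>w. X N \<omega> (Inl k # w)) P)) \<longlonglongrightarrow> phi P"
    unfolding phi_def
    by (rule expectation_lin_ext_tendsto)
      (use assms in \<open>auto simp: ncpolys_eq_polys_on intro: admissible_mark_unmarked\<close>)
qed (simp add: vstate_poly_eval_Z assms)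

lemma tau_extends:
  assumes "P \<in> Xpolys \<union> Ypolys"
  shows "tau P = \<tau> P"
proof (rule LIMSEQ_unique)
  show "(\<lambda>N. lin_ext (\<lambda>w. mean w N) P) \<longlonglongrightarrow> tau P"
    unfolding tau_def
    by (rule lin_ext_tendsto[where W = "lists (Xvars k \<union> Yvars l)"])
      (use assms in \<open>auto simp: ncpolys_eq_polys_on polys_on_def intro!: mean_tendsto admissible_unmarked\<close>)
  from assms show "(\<lambda>N. lin_ext (\<lambda>w. mean w N) P) \<longlonglongrightarrow> \<tau> P"
  proof
    assume P: "P \<in> Xpolys"
    have "lin_ext (\<lambda>w. mean w N) P = ntr N (poly_eval N (case_sum (A N) zeros) P)" for N
      unfolding ntr_poly_eval using P unfolding ncpolys_eq_polys_on
      by (rule lin_ext_cong) (auto simp: mean_def intro: expectation_X_Xvars)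
    from tendsto_cong_ge_1[OF this lim_A[OF P]] show ?thesis .
  next
    assume P: "P \<in> Ypolys"
    have "lin_ext (\<lambda>w. mean w N) P = ntr N (poly_eval N (case_sum zeros (B N)) P)" if "N \<ge> 1" for N
      unfolding ntr_poly_eval using P unfolding ncpolys_eq_polys_on
      by (rule lin_ext_cong) (auto simp: mean_def intro: expectation_X_Yvars[OF that])
    from tendsto_cong_ge_1[OF this lim_B[OF P]] show ?thesis .
  qed
qed

lemma phi_extends:
  assumes P: "P \<in> Xpolys"
  shows "phi P = \<phi> P"
proof (rule LIMSEQ_unique)
  show "(\<lambda>N. lin_ext (\<lambda>w. mean (Inl k # w) N) P) \<longlonglongrightarrow> phi P"
    unfolding phi_def using P unfolding ncpolys_eq_polys_on
    by (rule lin_ext_tendsto) (auto intro!: mean_tendsto admissible_mark_unmarked)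
  have "lin_ext (\<lambda>w. mean (Inl k # w) N) P = vstate N (v N) (poly_eval N (case_sum (A N) zeros) P)"
    if "N \<ge> 1" for N
    unfolding vstate_poly_eval using P unfolding ncpolys_eq_polys_on
    by (rule lin_ext_cong) (auto simp: mean_def intro: expectation_X_mark_Xvars[OF that])
  from tendsto_cong_ge_1[OF this lim_A_vstate[OF P]]
  show "(\<lambda>N. lin_ext (\<lambda>w. mean (Inl k # w) N) P) \<longlonglongrightarrow> \<phi> P" .
qed

lemma cnj_X:
  assumes sa: "\<And>N i. i < k \<Longrightarrow> selfadj_mat N (A N i)" "\<And>N j. j < l \<Longrightarrow> selfadj_mat N (B N j)"
    and w: "admissible k l w"
  shows "cnj (X N \<omega> w) = X N \<omega> (rev w)"
proof -
  have "selfadj_mat N (letters N (A_marked N) (B N) (U N \<omega>) x)" if "x \<in> set w" for x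
    using w that sa by (cases x) (auto simp: admissible_def Xvars_def Yvars_def selfadj_marker selfadj_conj)
  then show ?thesis by (simp add: X_def mono_eval_rev ntr_adj)
qed

lemma AE_tendsto:
  assumes sa: "\<And>N i. i < k \<Longrightarrow> selfadj_mat N (A N i)" "\<And>N j. j < l \<Longrightarrow> selfadj_mat N (B N j)"
    and P: "P \<in> XY"
  shows "AE \<omega> in M. (\<lambda>N. ntr N (poly_eval N (Z N \<omega>) P)) \<longlonglongrightarrow> tau P"
    and "AE \<omega> in M. (\<lambda>N. vstate N (v N) (poly_eval N (Z N \<omega>) P)) \<longlonglongrightarrow> phi P"
proof -
  have P': "P \<in> polys_on (lists (Xvars k \<union> Yvars l))" using P by (simp add: ncpolys_eq_polys_on)
  note lin_ext = AE_lin_ext_tendsto[OF P' _ cnj_X[OF sa]]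
  show "AE \<omega> in M. (\<lambda>N. ntr N (poly_eval N (Z N \<omega>) P)) \<longlonglongrightarrow> tau P"
    unfolding ntr_poly_eval_Z[OF P] tau_def
    by (rule lin_ext[where g = "\<lambda>w. w"]) (auto intro: admissible_unmarked)
  have "AE \<omega> in M. (\<lambda>N. lin_ext (\<lambda>w. X N \<omega> (Inl k # w)) P) \<longlonglongrightarrow> phi P"
    unfolding phi_def by (rule lin_ext) (auto intro: admissible_mark_unmarked)
  then show "AE \<omega> in M. (\<lambda>N. vstate N (v N) (poly_eval N (Z N \<omega>) P)) \<longlonglongrightarrow> phi P"
    by eventually_elim (rule tendsto_cong_ge_1[OF vstate_poly_eval_Z[OF _ P]])
qed

end

theorem theorem3p10:
  fixes k l :: nat
    and A :: "nat \<Rightarrow> nat \<Rightarrow> cmat" and B :: "nat \<Rightarrow> nat \<Rightarrow> cmat" and v :: "nat \<Rightarrow> cvec"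
    and \<tau> \<phi> :: "ncpoly \<Rightarrow> complex"
    and M :: "'w measure" and U :: "nat \<Rightarrow> 'w \<Rightarrow> cmat"
  defines "XA \<equiv> \<lambda>N. (\<lambda>x. case x of Inl i \<Rightarrow> A N i | Inr j \<Rightarrow> (\<lambda>_ _. 0)) :: var \<Rightarrow> cmat"
    and "YB \<equiv> \<lambda>N. (\<lambda>x. case x of Inl i \<Rightarrow> (\<lambda>_ _. 0) | Inr j \<Rightarrow> B N j) :: var \<Rightarrow> cmat"
    and "Z \<equiv> \<lambda>N \<omega>. (\<lambda>x. case x of Inl i \<Rightarrow> A N i
                     | Inr j \<Rightarrow> mmult N (mmult N (U N \<omega>) (B N j)) (adj (U N \<omega>))) :: var \<Rightarrow> cmat"
  assumes unit: "\<And>N. N \<ge> 1 \<Longrightarrow> unit_vec N (v N)"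
    and limA: "\<And>P. P \<in> ncpolys (Xvars k) \<Longrightarrow> (\<lambda>N. ntr N (poly_eval N (XA N) P)) \<longlonglongrightarrow> \<tau> P"
    and limAv: "\<And>P. P \<in> ncpolys (Xvars k) \<Longrightarrow> (\<lambda>N. vstate N (v N) (poly_eval N (XA N) P)) \<longlonglongrightarrow> \<phi> P"
    and limB: "\<And>P. P \<in> ncpolys (Yvars l) \<Longrightarrow> (\<lambda>N. ntr N (poly_eval N (YB N) P)) \<longlonglongrightarrow> \<tau> P"
    and prob: "prob_space M"
    and haar: "\<And>N. N \<ge> 1 \<Longrightarrow> haar_unitary M N (U N)"
  shows "(\<exists>\<tau>' \<phi>'.
           lin_on (ncpolys (Xvars k \<union> Yvars l)) \<tau>' \<and> lin_on (ncpolys (Xvars k \<union> Yvars l)) \<phi>' \<and>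
           (\<forall>P \<in> ncpolys (Xvars k) \<union> ncpolys (Yvars l). \<tau>' P = \<tau> P) \<and>
           (\<forall>P \<in> ncpolys (Xvars k). \<phi>' P = \<phi> P) \<and>
           (\<forall>P \<in> ncpolys (Xvars k \<union> Yvars l).
              (\<lambda>N. integral\<^sup>L M (\<lambda>\<omega>. ntr N (poly_eval N (Z N \<omega>) P))) \<longlonglongrightarrow> \<tau>' P) \<and>
           (\<forall>P \<in> ncpolys (Xvars k \<union> Yvars l).
              (\<lambda>N. integral\<^sup>L M (\<lambda>\<omega>. vstate N (v N) (poly_eval N (Z N \<omega>) P))) \<longlonglongrightarrow> \<phi>' P) \<and>
           cond_free (ncpolys (Xvars k)) (ncpolys (Yvars l)) \<tau>' \<phi>' \<and>
           (\<forall>P \<in> ncpolys (Yvars l). \<phi>' P = \<tau>' P) \<and>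
           ((\<forall>N i. i < k \<longrightarrow> selfadj_mat N (A N i)) \<and> (\<forall>N j. j < l \<longrightarrow> selfadj_mat N (B N j)) \<longrightarrow>
              (\<forall>P \<in> ncpolys (Xvars k \<union> Yvars l).
                 (AE \<omega> in M. (\<lambda>N. ntr N (poly_eval N (Z N \<omega>) P)) \<longlonglongrightarrow> \<tau>' P) \<and>
                 (AE \<omega> in M. (\<lambda>N. vstate N (v N) (poly_eval N (Z N \<omega>) P)) \<longlonglongrightarrow> \<phi>' P))))"
proof -
  have XA: "XA N = case_sum (A N) zeros" and YB: "YB N = case_sum zeros (B N)"
    and Z: "Z N \<omega> = letters N (A N) (B N) (U N \<omega>)" for N \<omega>
    by (simp_all add: XA_def YB_def Z_def letters_def)
  interpret prob_space M by (rule prob)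
  interpret haar_model M k l A B v \<tau> \<phi> U
    using unit limA limAv limB haar unfolding XA YB by unfold_locales
  show ?thesis
    unfolding Z
  proof (rule exI[of _ tau], rule exI[of _ phi], intro conjI impI ballI)
    show "lin_on XY tau" "lin_on XY phi"
      unfolding tau_def phi_def ncpolys_eq_polys_on by (rule lin_on_lin_ext)+
  qed (use AE_tendsto in \<open>simp_all add: tau_extends phi_extends expectation_ntr_tendsto expectation_vstate_tendsto
    cond_free_tau_phi phi_Ypolys\<close>)
qed

end
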